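(* Let $\alpha>0$ and $\beta\in\mathbb{R}$, and let $\phi\ge 0$ be a smooth function, not identically zero, with compact support contained in $[1,2]$. Then, as $T\to\infty$, $$\sum_{\ell\in\mathbb{Z}}\big|\zeta(\tfrac12+i(\alpha\ell+\beta))\big|^2\phi\Big(\frac{\ell}{T}\Big)=\Big(1+\delta(\alpha,\beta)+o(1)\Big)\int_{\mathbb{R}}\big|\zeta(\tfrac12+i(\alpha t+\beta))\big|^2\phi\Big(\frac{t}{T}\Big)\,dt,$$ where the $o(1)$ term tends to $0$ as $T\to\infty$ (at a rate possibly depending on $\alpha,\beta,\phi$).
   Context: Define $\delta(\alpha,\beta)$ as follows. If $e^{2\pi\ell/\alpha}$ is irrational for every integer $\ell>0$, set $\delta(\alpha,\beta)=0$. Otherwise, let $\ell_0$ be the least positive integer for which $e^{2\pi\ell_0/\alpha}$ is rational, write $e^{2\pi\ell_0/\alpha}=m/n$ with $m,n$ coprime positive integers (so $m/n>1$), and set $$\delta(\alpha,\beta)=\frac{2\cos(\beta\log(m/n))\sqrt{mn}-2}{mn+1-2\sqrt{mn}\cos(\beta\log(m/n))}.$$ *)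

theory Defs
  imports "HOL-Analysis.Analysis"
begin

definition smooth_real :: "(real \<Rightarrow> real) \<Rightarrow> bool" where
  "smooth_real f \<longleftrightarrow> (\<forall>k x. (deriv ^^ k) f differentiable (at x))"

definition supp_real :: "(real \<Rightarrow> real) \<Rightarrow> real set" where
  "supp_real f = closure {x. f x \<noteq> 0}"

text \<open>Dirichlet eta function, as the (conditionally convergent for Re s > 0) alternating series.\<close>
definition dirichlet_eta :: "complex \<Rightarrow> complex" where
  "dirichlet_eta s = lim (\<lambda>N. \<Sum>n<N. (-1) ^ n / (of_nat (Suc n)) powr s)"

text \<open>Riemann zeta function in the half-plane Re s > 0 (s not a zero of 1 - 2^(1-s)),
  via zeta(s) = eta(s) / (1 - 2^(1-s)).  On the critical line this is the
  analytic continuation of the Riemann zeta function.\<close>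
definition riemann_zeta :: "complex \<Rightarrow> complex" where
  "riemann_zeta s = dirichlet_eta s / (1 - 2 powr (1 - s))"

definition delta :: "real \<Rightarrow> real \<Rightarrow> real" where
  "delta \<alpha> \<beta> =
    (if \<forall>l::nat. l > 0 \<longrightarrow> exp (2 * pi * real l / \<alpha>) \<notin> \<rat> then 0
     else
       let l0 = (LEAST l::nat. l > 0 \<and> exp (2 * pi * real l / \<alpha>) \<in> \<rat>);
           r = (THE r::rat. of_rat r = exp (2 * pi * real l0 / \<alpha>));
           m = fst (quotient_of r); n = snd (quotient_of r);
           mn = real_of_int (m * n);
           c = cos (\<beta> * ln (real_of_int m / real_of_int n))
       in (2 * c * sqrt mn - 2) / (mn + 1 - 2 * sqrt mn * c))"

end

theory Submission
  imports Defs "HOL-Real_Asymp.Real_Asymp"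
begin

text \<open>
  For \<open>y\<close> of size \<open>T\<close>, the sum \<open>D(y) = \<Sum>n\<le>N. n powr (-1/2 - i y)\<close> with \<open>N\<close> a suitable multiple of
  \<open>T\<close> equals \<open>\<zeta>(1/2 + i y)\<close> up to \<open>O(T powr (-1/2))\<close>, and trivially \<open>D = O(T powr (1/2))\<close>; so
  \<open>\<bar>\<zeta>\<bar>\<^sup>2\<close> may be replaced by \<open>\<bar>D\<bar>\<^sup>2\<close> at the cost \<open>O(T)\<close>, while both sides have order \<open>T ln T\<close>.
  Expanding the square, a pair \<open>n < m\<close> contributes \<open>(m n) powr (-1/2)\<close> times a kernel which is
  \<open>O(T)\<close>, and \<open>O(1 / (T d\<^sup>2))\<close> when \<open>a ln (m / n)\<close>, \<open>a = \<alpha> / 2\<pi>\<close>, is at distance \<open>d\<close> from the integers.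
  Sort the pairs by the integer \<open>k\<close> nearest to \<open>a ln (m / n)\<close>.  After division by \<open>T ln T\<close> the
  \<open>k\<close>-th class is \<open>O(exp (-k / 2 a))\<close>, so it suffices to find the limit of each class.  There the
  pairs with \<open>m \<noteq> n exp (k / a)\<close> are negligible: those with \<open>m\<close> very close to \<open>n exp (k / a)\<close> have
  widely spaced \<open>n\<close>.  The exact pairs \<open>m = n exp (k / a)\<close> exist only if \<open>exp (k / a)\<close> is a rational
  \<open>p / q\<close>, and then contribute \<open>(p q) powr (-1/2)\<close>.  Summing these as a geometric series gives
  \<open>\<delta>(\<alpha>, \<beta>)\<close>.  For the integral the same bounds hold, but the exact pairs cancel as well.
\<close>

subsection \<open>Exponential sums without stationary points\<close>

text \<open>The length of D is of order T and not of order sqrt T, because beyond n = y the phase y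
  ln n turns by at most 1 per step; no stationary point occurs and an elementary bound for
  exponential sums suffices. Zeta is given through the eta series, so D enters through the eta
  partial sum of length 2N, which is D(2N) - 2^(1-s) D(N). The price of the length is that m may
  come very close to n exp (k / a), where the kernel has size T. Since \<alpha> is arbitrary, exp (k
  / a) may be approximable by fractions arbitrarily well, and no Diophantine lower bound is at hand.
  A qualitative statement replaces it: for every D there is \<eta> > 0 such that the n having a
  multiple within \<eta> of an integer, but not on it, are at least D apart, so their harmonic sum
  is at most 1 + harm N / D. As \<eta> depends on D and k in an uncontrolled way, each class has a
  limit but no rate, and Tannery's theorem joins the classes. The factor exp (-k / 2 a) is the size
  of 1 / sqrt (m n) relative to 1 / n. The pairs m < n are the conjugates of those with n < m,
  whence \<delta> is twice the real part of a geometric series.\<close>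

lemma norm_cis_diff_le: "norm (cis a - cis b) \<le> \<bar>a - b\<bar>"
proof -
  have *: "cis a - cis b = cis b * (exp (\<i> * of_real (a - b)) - 1)"
    by (simp add: cis_conv_exp algebra_simps flip: exp_add)
  have "norm (exp (\<i> * of_real (a - b)) - 1) = 2 * \<bar>sin ((a - b) / 2)\<bar>"
    using dist_exp_i_1[of "a - b"] by (simp add: dist_norm)
  also have "\<dots> \<le> \<bar>a - b\<bar>"
    using abs_sin_x_le_abs_x[of "(a - b) / 2"] by simp
  finally show ?thesis by (simp add: * norm_mult)
qed

text \<open>The second difference is minus the logarithm of u = 1 + 1 / (n (n + 2)), and ln u <= u -
  1. This controls how fast the phase increments of n^(-i y) vary.\<close>

lemma ln_second_diff_le:
  assumes "n > 0"
  shows "\<bar>(ln (real n + 2) - ln (real n + 1)) - (ln (real n + 1) - ln (real n))\<bar> \<le> 1 / (real n)\<^sup>2"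
proof -
  define u where "u = (real n + 1)\<^sup>2 / (real n * (real n + 2))"
  have n: "real n > 0" using assms by simp
  have "real n * (real n + 2) > 0" using n by simp
  then have u1: "u \<ge> 1" unfolding u_def by (subst le_divide_eq_1_pos) (auto simp: power2_eq_square algebra_simps)
  have lnu: "ln u = 2 * ln (real n + 1) - ln (real n) - ln (real n + 2)"
    unfolding u_def using n by (simp add: ln_div ln_mult ln_realpow)
  have "ln u \<le> u - 1" using u1 by (intro ln_le_minus_one) auto
  also have "(real n + 1)\<^sup>2 = real n * (real n + 2) + 1"
    by (simp add: power2_eq_square algebra_simps)
  then have "u - 1 = 1 / (real n * (real n + 2))"
    unfolding u_def using n by (simp add: add_divide_distrib)
  also have "\<dots> \<le> 1 / (real n)\<^sup>2"
    using n by (intro divide_left_mono) (auto simp: power2_eq_square)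
  finally have "ln u \<le> 1 / (real n)\<^sup>2" .
  moreover have "ln u \<ge> 0" using u1 by simp
  ultimately show ?thesis unfolding lnu by linarith
qed

lemma sum_inverse_squares_le:
  assumes "1 \<le> M" "M \<le> M'"
  shows "(\<Sum>n=M..<M'. 1 / (real n)\<^sup>2) \<le> 2 / real M"
proof -
  \<comment> \<open>Subtracting 2 / M' makes the claim inductive: each term is at most the
    telescoping difference 2 / n - 2 / (n + 1).\<close>
  have "(\<Sum>n=M..<M'. 1 / (real n)\<^sup>2) \<le> 2 / real M - 2 / real M'"
    using assms(2)
  proof (induction M' rule: dec_induct)
    case (step n)
    have n: "real n \<ge> 1" using step assms by simp
    have "1 / (real n)\<^sup>2 \<le> 2 / real n - 2 / (real n + 1)"
    proof -
      have "2 / real n - 2 / (real n + 1) = 2 / (real n * (real n + 1))"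
        using n by (simp add: field_simps)
      moreover have "1 / (real n)\<^sup>2 = 2 / (real n * (real n + real n))"
        using n by (simp add: field_simps power2_eq_square)
      moreover have "2 / (real n * (real n + real n)) \<le> 2 / (real n * (real n + 1))"
        using n by (intro divide_left_mono mult_left_mono) auto
      ultimately show ?thesis by simp
    qed
    with step show ?case by (simp add: add.commute)
  qed simp
  then show ?thesis
    by (smt (verit, best) divide_nonneg_nonneg of_nat_0_le_iff)
qed

text \<open>The Kusmin--Landau method: \<open>v n\<close> is \<open>(v (n + 1) - v n) / (q n - 1)\<close>, so
  summation by parts moves the difference onto the slowly varying factor \<open>1 / (q n - 1)\<close>.\<close>

lemma kusmin_landau:
  fixes v q :: "nat \<Rightarrow> complex"
  assumes M: "1 \<le> M" "M \<le> M'" and c: "c > 0" and B: "B \<ge> 0"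
    and v: "\<And>n. norm (v n) = 1"
    and vq: "\<And>n. M \<le> n \<Longrightarrow> n \<le> M' \<Longrightarrow> v (Suc n) = v n * q n"
    and q: "\<And>n. M \<le> n \<Longrightarrow> n \<le> M' \<Longrightarrow> c \<le> norm (q n - 1)"
    and dq: "\<And>n. M \<le> n \<Longrightarrow> n \<le> M' \<Longrightarrow> norm (q (Suc n) - q n) \<le> B / (real n)\<^sup>2"
  shows "norm (\<Sum>n=M..<M'. v n / of_real (sqrt (real n))) \<le> (2 / c + 2 * B / (c\<^sup>2 * real M)) / sqrt (real M)"
proof -
  define s where "s n = 1 / sqrt (real n)" for n :: nat
  define g where "g n = of_real (s n) / (q n - 1)" for n
  have q1: "q n \<noteq> 1" if "M \<le> n" "n \<le> M'" for n
    using q[OF that] c by auto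
  have s_pos: "s n \<ge> 0" for n by (simp add: s_def)
  have gb: "norm (g n) \<le> s n / c" if "M \<le> n" "n \<le> M'" for n
    unfolding g_def norm_divide norm_of_real abs_of_nonneg[OF s_pos]
    using q[OF that] c s_pos[of n] by (intro divide_left_mono mult_pos_pos) auto
  have parts: "(\<Sum>n=M..<K. g n * (v (Suc n) - v n)) =
      g K * v K - g M * v M - (\<Sum>n=M..<K. (g (Suc n) - g n) * v (Suc n))" if "M \<le> K" for K
    using that by (induction K rule: dec_induct) (auto simp: algebra_simps)
  have eq: "(\<Sum>n=M..<M'. v n / of_real (sqrt (real n))) = (\<Sum>n=M..<M'. g n * (v (Suc n) - v n))"
  proof (rule sum.cong)
    fix n assume n: "n \<in> {M..<M'}"
    have "g n * (v (Suc n) - v n) = g n * (q n - 1) * v n"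
      using vq[of n] n by (simp add: algebra_simps)
    also have "\<dots> = v n / of_real (sqrt (real n))"
      using q1[of n] n by (simp add: g_def s_def)
    finally show "v n / of_real (sqrt (real n)) = g n * (v (Suc n) - v n)" ..
  qed simp
  \<comment> \<open>The increment of g has two sources: the change of 1 / sqrt n, whose bound
    telescopes, and the change of q, summable by the 1 / n^2 in the hypothesis.\<close>
  have dg: "norm (g (Suc n) - g n) \<le> (s n - s (Suc n)) / c + (B / (c\<^sup>2 * sqrt (real M))) * (1 / (real n)\<^sup>2)"
    if n: "n \<in> {M..<M'}" for n
  proof -
    have n1: "M \<le> n" "n \<le> M'" "M \<le> Suc n" "Suc n \<le> M'" using n by auto
    have nz: "q n - 1 \<noteq> 0" "q (Suc n) - 1 \<noteq> 0" using q1 n1 by auto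
    have sdec: "s (Suc n) \<le> s n"
      unfolding s_def using n1 M by (intro divide_left_mono) auto
    have smon: "s n \<le> 1 / sqrt (real M)"
      unfolding s_def using n1 M by (intro divide_left_mono) auto
    have dec: "g (Suc n) - g n = of_real (s (Suc n) - s n) / (q (Suc n) - 1)
        + of_real (s n) * ((q n - q (Suc n)) / ((q (Suc n) - 1) * (q n - 1)))"
      unfolding g_def using nz by (simp add: divide_simps) (simp add: algebra_simps)
    have A: "norm (of_real (s (Suc n) - s n) / (q (Suc n) - 1)) \<le> (s n - s (Suc n)) / c"
    proof -
      have "norm (of_real (s (Suc n) - s n) / (q (Suc n) - 1)) = (s n - s (Suc n)) / norm (q (Suc n) - 1)"
        using sdec by (simp only: norm_divide norm_of_real) simp
      also have "\<dots> \<le> (s n - s (Suc n)) / c"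
        using sdec q[OF n1(3,4)] c nz by (intro divide_left_mono mult_pos_pos) auto
      finally show ?thesis .
    qed
    have Bd: "norm ((q n - q (Suc n)) / ((q (Suc n) - 1) * (q n - 1))) \<le> (B / (real n)\<^sup>2) / (c * c)"
      unfolding norm_divide norm_mult
      using dq[OF n1(1,2)] q[OF n1(1,2)] q[OF n1(3,4)] c B
      by (intro frac_le mult_mono) (auto simp: norm_minus_commute)
    have "norm (of_real (s n) * ((q n - q (Suc n)) / ((q (Suc n) - 1) * (q n - 1))))
        \<le> (1 / sqrt (real M)) * ((B / (real n)\<^sup>2) / (c * c))"
      unfolding norm_mult[of "of_real (s n)"] norm_of_real using smon s_pos[of n] Bd
      by (intro mult_mono) auto
    also have "\<dots> = (B / (c\<^sup>2 * sqrt (real M))) * (1 / (real n)\<^sup>2)"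
      by (simp add: power2_eq_square)
    finally show ?thesis
      unfolding dec using A norm_triangle_ineq by (smt (verit))
  qed
  have tele: "(\<Sum>n=M..<K. s n - s (Suc n)) = s M - s K" if "M \<le> K" for K
    using that by (induction K rule: dec_induct) auto
  have "norm (\<Sum>n=M..<M'. (g (Suc n) - g n) * v (Suc n)) \<le> (\<Sum>n=M..<M'. norm (g (Suc n) - g n))"
    by (rule sum_norm_le) (simp add: norm_mult v)
  also have "\<dots> \<le> (\<Sum>n=M..<M'. (s n - s (Suc n)) / c + (B / (c\<^sup>2 * sqrt (real M))) * (1 / (real n)\<^sup>2))"
    by (intro sum_mono dg)
  also have "\<dots> = (s M - s M') / c + (B / (c\<^sup>2 * sqrt (real M))) * (\<Sum>n=M..<M'. 1 / (real n)\<^sup>2)"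
    by (simp only: sum.distrib sum_distrib_left[symmetric] sum_divide_distrib[symmetric] tele[OF M(2)])
  also have "\<dots> \<le> (s M - s M') / c + (B / (c\<^sup>2 * sqrt (real M))) * (2 / real M)"
    using B by (intro add_left_mono mult_left_mono sum_inverse_squares_le M) auto
  finally have S: "norm (\<Sum>n=M..<M'. (g (Suc n) - g n) * v (Suc n))
      \<le> (s M - s M') / c + (B / (c\<^sup>2 * sqrt (real M))) * (2 / real M)" .
  have "norm (g M' * v M') \<le> s M' / c" "norm (g M * v M) \<le> s M / c"
    using gb M by (auto simp: norm_mult v)
  with S have "norm (g M' * v M' - g M * v M - (\<Sum>n=M..<M'. (g (Suc n) - g n) * v (Suc n)))
      \<le> s M' / c + s M / c + ((s M - s M') / c + (B / (c\<^sup>2 * sqrt (real M))) * (2 / real M))"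
    by (smt (verit) norm_triangle_ineq4)
  \<comment> \<open>The boundary term s M' / c cancels against the telescoped sum, leaving 2 s M /
    c.\<close>
  also have "\<dots> = (2 / c + 2 * B / (c\<^sup>2 * real M)) / sqrt (real M)"
    using M c by (simp add: s_def field_simps)
  finally show ?thesis unfolding eq parts[OF M(2)] .
qed

text \<open>This is n^(-1/2 - i y) in polar form, so that modulus and phase can be read off;
  \<open>inverse_nat_powr_critical\<close> connects it with \<open>powr\<close>.\<close>

definition crit_term :: "real \<Rightarrow> nat \<Rightarrow> complex" where
  "crit_term y n = cis (- (y * ln (real n))) / of_real (sqrt (real n))"

lemma norm_crit_term: "norm (crit_term y n) = 1 / sqrt (real n)"
  by (simp add: crit_term_def norm_divide)

lemma cis_ln_step: "cis (- (y * ln (real (Suc n)))) = cis (- (y * ln (real n))) * cis (- (y * (ln (real n + 1) - ln (real n))))"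
  by (simp add: cis_mult algebra_simps)

lemma cis_ln_step_diff:
  assumes "n > 0" "y \<ge> 0"
  shows "norm (cis (- (y * (ln (real (Suc n) + 1) - ln (real (Suc n))))) - cis (- (y * (ln (real n + 1) - ln (real n)))))
    \<le> y / (real n)\<^sup>2"
proof -
  have "norm (cis (- (y * (ln (real (Suc n) + 1) - ln (real (Suc n))))) - cis (- (y * (ln (real n + 1) - ln (real n)))))
     \<le> \<bar>- (y * (ln (real (Suc n) + 1) - ln (real (Suc n)))) - (- (y * (ln (real n + 1) - ln (real n))))\<bar>"
    by (rule norm_cis_diff_le)
  also have "\<dots> = y * \<bar>(ln (real n + 2) - ln (real n + 1)) - (ln (real n + 1) - ln (real n))\<bar>"
  proof -
    have e: "- (y * (ln (real (Suc n) + 1) - ln (real (Suc n)))) - (- (y * (ln (real n + 1) - ln (real n))))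
      = - (y * ((ln (real n + 2) - ln (real n + 1)) - (ln (real n + 1) - ln (real n))))"
      by (simp add: algebra_simps)
    show ?thesis unfolding e using assms by (simp add: abs_mult)
  qed
  also have "\<dots> \<le> y * (1 / (real n)\<^sup>2)"
    using assms by (intro mult_left_mono ln_second_diff_le) auto
  finally show ?thesis by simp
qed

lemma ln_diff_bounds:
  assumes "n > 0"
  shows "1 / (real n + 1) \<le> ln (real n + 1) - ln (real n)" "ln (real n + 1) - ln (real n) \<le> 1 / real n"
proof -
  have "ln ((real n + 1) / real n) \<le> (real n + 1) / real n - 1"
    using assms by (intro ln_le_minus_one) auto
  then show "ln (real n + 1) - ln (real n) \<le> 1 / real n"
    using assms by (simp add: ln_div field_simps)
  have "ln (real n / (real n + 1)) \<le> real n / (real n + 1) - 1"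
    using assms by (intro ln_le_minus_one) auto
  also have "real n / (real n + 1) - 1 = - (1 / (real n + 1))" by (simp add: field_simps)
  finally show "1 / (real n + 1) \<le> ln (real n + 1) - ln (real n)"
    using assms by (simp add: ln_div)
qed

text \<open>For n >= M >= y the phase turns by an angle in [0, 1] per step, and the alternating sign
  gives the ratio \<open>q n\<close> a nonpositive real part, so |q n - 1| >= 1. The 4 is 2 + 2 y /
  M at its largest.\<close>

lemma alternating_crit_sum_bound:
  assumes M: "1 \<le> M" "M \<le> M'" and y: "0 \<le> y" "y \<le> real M"
  shows "norm (\<Sum>n=M..<M'. (-1) ^ n * crit_term y n) \<le> 4 / sqrt (real M)"
proof -
  define v where "v n = (-1) ^ n * cis (- (y * ln (real n)))" for n :: nat
  define q where "q n = - cis (- (y * (ln (real n + 1) - ln (real n))))" for n :: nat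
  have "norm (\<Sum>n=M..<M'. v n / of_real (sqrt (real n))) \<le> (2 / 1 + 2 * y / (1\<^sup>2 * real M)) / sqrt (real M)"
  proof (rule kusmin_landau[where q = q])
    show "norm (v n) = 1" for n by (simp add: v_def norm_mult norm_power)
    show "v (Suc n) = v n * q n" if "M \<le> n" for n
      by (simp add: v_def q_def cis_ln_step del: of_nat_Suc)
    show "norm (q (Suc n) - q n) \<le> y / (real n)\<^sup>2" if "M \<le> n" for n
      using cis_ln_step_diff[of n y] that M y by (simp add: q_def norm_minus_commute del: of_nat_Suc)
    show "1 \<le> norm (q n - 1)" if "M \<le> n" for n
    proof -
      define \<psi> where "\<psi> = y * (ln (real n + 1) - ln (real n))"
      have n: "n > 0" using that M by simp
      have p: "0 \<le> \<psi>" unfolding \<psi>_def using y n by (intro mult_nonneg_nonneg) auto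
      have "\<psi> \<le> real n * (1 / real n)" unfolding \<psi>_def
        using y n that ln_diff_bounds(2)[OF n] by (intro mult_mono) auto
      then have "\<psi> \<le> 1" using n by simp
      then have "cos \<psi> \<ge> 0" using p pi_ge_two by (intro cos_ge_zero) auto
      then have "1 \<le> \<bar>Re (q n - 1)\<bar>" unfolding q_def \<psi>_def[symmetric] by simp
      also have "\<dots> \<le> norm (q n - 1)" by (rule abs_Re_le_cmod)
      finally show ?thesis .
    qed
  qed (use M y in auto)
  also have "\<dots> \<le> 4 / sqrt (real M)"
    using M y by (intro divide_right_mono) (auto simp: field_simps)
  finally show ?thesis by (simp add: v_def crit_term_def)
qed

text \<open>Without the sign the ratio is \<open>cis (- \<psi>)\<close>, which stays away from 1
  only if \<psi> is bounded below. Since \<psi> >= y / (n + 1), the range has to end before y / c;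
  then |q n - 1| >= sin \<psi> >= sin c.\<close>

lemma crit_sum_bound:
  assumes M: "1 \<le> M" "M \<le> M'" and y: "0 \<le> y" "y \<le> real M"
    and c: "0 < c" "c * (real M' + 1) \<le> y"
  shows "norm (\<Sum>n=M..<M'. crit_term y n) \<le> (2 / sin c + 2 / (sin c)\<^sup>2) / sqrt (real M)"
proof -
  define v where "v n = cis (- (y * ln (real n)))" for n :: nat
  define q where "q n = cis (- (y * (ln (real n + 1) - ln (real n))))" for n :: nat
  have "c * (real M' + 1) \<le> real M' + 1" using c y M by linarith
  then have c1: "c \<le> 1" by (simp add: mult_le_cancel_right1)
  have sc: "sin c > 0" using c c1 pi_gt3 by (intro sin_gt_zero) auto
  have "norm (\<Sum>n=M..<M'. v n / of_real (sqrt (real n))) \<le> (2 / sin c + 2 * y / ((sin c)\<^sup>2 * real M)) / sqrt (real M)"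
  proof (rule kusmin_landau[where q = q])
    show "norm (v n) = 1" for n by (simp add: v_def norm_mult norm_power)
    show "v (Suc n) = v n * q n" for n
      by (simp add: v_def q_def cis_ln_step del: of_nat_Suc)
    show "norm (q (Suc n) - q n) \<le> y / (real n)\<^sup>2" if "M \<le> n" for n
      using cis_ln_step_diff[of n y] that M y by (simp add: q_def del: of_nat_Suc)
    show "sin c \<le> norm (q n - 1)" if "M \<le> n" "n \<le> M'" for n
    proof -
      define \<psi> where "\<psi> = y * (ln (real n + 1) - ln (real n))"
      have n: "n > 0" using that M by simp
      have "\<psi> \<le> real n * (1 / real n)" unfolding \<psi>_def
        using y n that ln_diff_bounds(2)[OF n] by (intro mult_mono) auto
      then have u: "\<psi> \<le> 1" using n by simp
      have "c * (real n + 1) \<le> c * (real M' + 1)" using c that by (intro mult_left_mono) auto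
      then have "c * (real n + 1) \<le> y" using c by linarith
      then have "c \<le> y * (1 / (real n + 1))" by (simp add: field_simps)
      also have "\<dots> \<le> \<psi>" unfolding \<psi>_def using y ln_diff_bounds(1)[OF n] by (intro mult_left_mono) auto
      finally have l: "c \<le> \<psi>" .
      have "sin c \<le> sin \<psi>" using l u c pi_gt3 by (intro sin_monotone_2pi_le) auto
      also have "\<dots> \<le> \<bar>Im (q n - 1)\<bar>" unfolding q_def \<psi>_def[symmetric] by simp
      also have "\<dots> \<le> norm (q n - 1)" by (rule abs_Im_le_cmod)
      finally show ?thesis .
    qed
  qed (use M y sc in auto)
  also have "\<dots> \<le> (2 / sin c + 2 / (sin c)\<^sup>2) / sqrt (real M)"
    using M y sc by (intro divide_right_mono add_left_mono) (auto simp: field_simps)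
  finally show ?thesis by (simp add: v_def crit_term_def)
qed

subsection \<open>Dirichlet polynomial approximation on the critical line\<close>

definition zeta_poly :: "nat \<Rightarrow> real \<Rightarrow> complex" where
  "zeta_poly N y = (\<Sum>n=1..N. crit_term y n)"

definition eta_partial :: "real \<Rightarrow> nat \<Rightarrow> complex" where
  "eta_partial y K = (\<Sum>n<K. (-1) ^ n * crit_term y (Suc n))"

lemma nat_powr_critical:
  assumes "n > 0"
  shows "of_nat n powr Complex (1/2) y = of_real (sqrt (real n)) * cis (y * ln (real n))"
proof -
  have "of_nat n powr Complex (1/2) y = exp (Complex (1/2) y * of_real (ln (real n)))"
    using assms by (simp add: powr_def Ln_of_nat)
  also have "Complex (1/2) y * of_real (ln (real n)) = of_real (ln (real n) / 2) + \<i> * of_real (y * ln (real n))"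
    by (simp add: complex_eq_iff)
  also have "exp \<dots> = of_real (exp (ln (real n) / 2)) * cis (y * ln (real n))"
    by (simp only: exp_add cis_conv_exp exp_of_real)
  also have "exp (ln (real n) / 2) = sqrt (real n)"
    using assms by (simp flip: ln_sqrt)
  finally show ?thesis .
qed

lemma inverse_nat_powr_critical:
  assumes "n > 0"
  shows "1 / of_nat n powr Complex (1/2) y = crit_term y n"
  by (simp add: nat_powr_critical[OF assms] crit_term_def cis_divide divide_simps cis_mult)

lemma dirichlet_eta_critical: "dirichlet_eta (Complex (1/2) y) = lim (eta_partial y)"
proof -
  have "(-1) ^ n / of_nat (Suc n) powr Complex (1/2) y = (-1) ^ n * crit_term y (Suc n)" for n
    unfolding inverse_nat_powr_critical[OF zero_less_Suc, symmetric] by (simp only: times_divide_eq_right mult_1_right)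
  then show ?thesis
    unfolding dirichlet_eta_def eta_partial_def[abs_def] by presburger
qed

text \<open>The bound is uniform for 0 <= y <= M, which yields convergence, a rate, and continuity
  of the limit in y. The index shift by \<open>Suc\<close> only flips the overall sign.\<close>

lemma eta_partial_diff:
  assumes "1 \<le> M" "M \<le> M'" "0 \<le> y" "y \<le> real M"
  shows "norm (eta_partial y M' - eta_partial y M) \<le> 4 / sqrt (real M)"
proof -
  have "eta_partial y M' - eta_partial y M = (\<Sum>n=M..<M'. (-1) ^ n * crit_term y (Suc n))"
    unfolding eta_partial_def using assms by (simp add: lessThan_atLeast0 sum_diff_nat_ivl)
  also have "\<dots> = - (\<Sum>n=Suc M..<Suc M'. (-1) ^ n * crit_term y n)"
    by (subst sum.shift_bounds_Suc_ivl) (simp flip: sum_negf)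
  finally have "norm (eta_partial y M' - eta_partial y M) \<le> 4 / sqrt (real (Suc M))"
    using alternating_crit_sum_bound[of "Suc M" "Suc M'" y] assms by simp
  also have "\<dots> \<le> 4 / sqrt (real M)"
    using assms by (intro divide_left_mono) auto
  finally show ?thesis .
qed

lemma eta_partial_tendsto:
  assumes "0 \<le> y"
  shows "eta_partial y \<longlonglongrightarrow> dirichlet_eta (Complex (1/2) y)"
proof -
  have "Cauchy (eta_partial y)"
  proof (rule CauchyI')
    fix e :: real assume e: "e > 0"
    have "(\<lambda>M. 4 / sqrt (real M)) \<longlonglongrightarrow> 0" by real_asymp
    then have "eventually (\<lambda>M. 4 / sqrt (real M) < e) sequentially"
      using e by (rule order_tendstoD)
    moreover have "eventually (\<lambda>M. real M \<ge> y) sequentially" by real_asymp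
    ultimately obtain M0 where M0: "\<And>M. M \<ge> M0 \<Longrightarrow> 4 / sqrt (real M) < e \<and> real M \<ge> y"
      unfolding eventually_sequentially by (metis nat_le_linear order_trans)
    show "\<exists>M. \<forall>m\<ge>M. \<forall>n>m. dist (eta_partial y m) (eta_partial y n) < e"
    proof (intro exI[of _ "max 1 M0"] allI impI)
      fix m n assume "m \<ge> max 1 M0" "n > m"
      then show "dist (eta_partial y m) (eta_partial y n) < e"
        using eta_partial_diff[of m n y] M0[of m] assms
        by (simp add: dist_norm norm_minus_commute)
    qed
  qed
  then show ?thesis
    unfolding dirichlet_eta_critical by (simp add: Cauchy_convergent_iff convergent_LIMSEQ_iff)
qed

lemma dirichlet_eta_approx:
  assumes "1 \<le> M" "0 \<le> y" "y \<le> real M"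
  shows "norm (dirichlet_eta (Complex (1/2) y) - eta_partial y M) \<le> 4 / sqrt (real M)"
proof (rule tendsto_upperbound)
  show "(\<lambda>K. norm (eta_partial y K - eta_partial y M)) \<longlonglongrightarrow> norm (dirichlet_eta (Complex (1/2) y) - eta_partial y M)"
    by (intro tendsto_intros eta_partial_tendsto assms)
  show "\<forall>\<^sub>F K in sequentially. norm (eta_partial y K - eta_partial y M) \<le> 4 / sqrt (real M)"
    using eventually_ge_at_top[of M] by eventually_elim (intro eta_partial_diff assms)
qed simp

lemma two_powr_critical: "2 powr (1 - Complex (1/2) y) = of_real (sqrt 2) * cis (- (y * ln 2))"
proof -
  have "2 powr (1 - Complex (1/2) y) = of_nat 2 powr (Complex (1/2) (-y))"
    by (rule arg_cong2[where f = "(powr)"]) (auto simp: complex_eq_iff)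
  also have "\<dots> = of_real (sqrt 2) * cis (- (y * ln 2))"
    by (subst nat_powr_critical) auto
  finally show ?thesis .
qed

lemma one_minus_two_powr_critical: "norm (1 - 2 powr (1 - Complex (1/2) y)) \<ge> 2 / 5"
proof -
  have "sqrt 2 \<ge> 7 / 5" by (rule real_le_rsqrt) (simp add: power2_eq_square)
  moreover have "norm (2 powr (1 - Complex (1/2) y)) = sqrt 2"
    by (simp add: two_powr_critical norm_mult)
  ultimately show ?thesis
    using norm_triangle_ineq2[of "2 powr (1 - Complex (1/2) y)" 1] by (simp add: norm_minus_commute)
qed

lemma crit_term_double:
  assumes "n > 0"
  shows "2 * crit_term y (2 * n) = 2 powr (1 - Complex (1/2) y) * crit_term y n"
proof -
  have "cis (- (y * ln (real (2 * n)))) = cis (- (y * ln 2)) * cis (- (y * ln (real n)))"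
    using assms by (simp add: ln_mult cis_mult algebra_simps)
  moreover have "(2::complex) = of_real (sqrt 2) * of_real (sqrt 2)"
    by (simp flip: of_real_mult)
  ultimately show ?thesis
    using assms unfolding two_powr_critical crit_term_def
    by (simp add: real_sqrt_mult field_simps)
qed

text \<open>The finite form of eta(s) = (1 - 2^(1-s)) zeta(s): changing the sign of the even terms
  subtracts each of them twice, and by \<open>crit_term_double\<close> the doubled terms are 2^(1-s)
  times the terms up to N.\<close>

lemma eta_partial_even:
  "eta_partial y (2 * N) = zeta_poly (2 * N) y - 2 powr (1 - Complex (1/2) y) * zeta_poly N y"
proof (induction N)
  case (Suc N)
  have "eta_partial y (2 * Suc N) = eta_partial y (2 * N) + crit_term y (2 * N + 1) - crit_term y (2 * N + 2)"
    by (simp add: eta_partial_def)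
  moreover have "zeta_poly (2 * Suc N) y = zeta_poly (2 * N) y + crit_term y (2 * N + 1) + crit_term y (2 * N + 2)"
    by (simp add: zeta_poly_def)
  moreover have "2 powr (1 - Complex (1/2) y) * zeta_poly (Suc N) y
      = 2 powr (1 - Complex (1/2) y) * zeta_poly N y + 2 * crit_term y (2 * N + 2)"
    using crit_term_double[of "Suc N" y] by (simp add: zeta_poly_def algebra_simps)
  ultimately show ?case using Suc by simp
qed (simp add: eta_partial_def zeta_poly_def)

text \<open>By \<open>eta_partial_even\<close> the eta partial sum of length 2N is (1 - w) D(N) +
  (D(2N) - D(N)). The error thus comes from the eta tail and from the block N < n <= 2N, both O(1 /
  sqrt N). The 2N + 2 is M' + 1 in \<open>crit_sum_bound\<close>, with M' = 2N + 1.\<close>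

lemma zeta_approx:
  assumes N: "1 \<le> N" and y: "0 \<le> y" "y \<le> real N" and c: "0 < c" "c * (2 * real N + 2) \<le> y"
  shows "norm (riemann_zeta (Complex (1/2) y) - zeta_poly N y)
    \<le> 5 / 2 * (4 + 2 / sin c + 2 / (sin c)\<^sup>2) / sqrt (real N)"
proof -
  define w where "w = 2 powr (1 - Complex (1/2) y)"
  define e where "e = dirichlet_eta (Complex (1/2) y)"
  have w: "norm (1 - w) \<ge> 2 / 5" unfolding w_def by (rule one_minus_two_powr_critical)
  then have w0: "1 - w \<noteq> 0" by auto
  have "c * (2 * real N + 2) \<le> 1 * (2 * real N + 2)" by (rule order_trans[OF c(2)]) (use y in simp)
  then have c1: "c \<le> 1" by (subst (asm) mult_le_cancel_right) auto
  have sc: "sin c > 0" using c c1 pi_gt3 by (intro sin_gt_zero) auto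
  define S where "S = 2 / sin c + 2 / (sin c)\<^sup>2"
  have S0: "S \<ge> 0" unfolding S_def using sc by auto
  have "norm (e - eta_partial y (2 * N)) \<le> 4 / sqrt (real (2 * N))"
    unfolding e_def using N y by (intro dirichlet_eta_approx) auto
  also have "\<dots> \<le> 4 / sqrt (real N)" using N by (intro divide_left_mono) auto
  finally have A: "norm (e - eta_partial y (2 * N)) \<le> 4 / sqrt (real N)" .
  have "zeta_poly (2 * N) y - zeta_poly N y = (\<Sum>n=Suc N..<Suc (2*N). crit_term y n)"
  proof -
    have "{1..2*N} = {1..N} \<union> {Suc N..<Suc (2*N)}" by auto
    moreover have "sum (crit_term y) ({1..N} \<union> {Suc N..<Suc (2*N)}) = sum (crit_term y) {1..N} + sum (crit_term y) {Suc N..<Suc (2*N)}"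
      by (intro sum.union_disjoint) auto
    ultimately show ?thesis unfolding zeta_poly_def by (simp del: sum.op_ivl_Suc)
  qed
  then have "norm (zeta_poly (2 * N) y - zeta_poly N y) \<le> S / sqrt (real (Suc N))"
    unfolding S_def using crit_sum_bound[of "Suc N" "Suc (2 * N)" y c] N y c by (simp add: algebra_simps del: sum.op_ivl_Suc)
  also have "\<dots> \<le> S / sqrt (real N)" using N S0 by (intro divide_left_mono) auto
  finally have B: "norm (zeta_poly (2 * N) y - zeta_poly N y) \<le> S / sqrt (real N)" .
  have "riemann_zeta (Complex (1/2) y) - zeta_poly N y
      = ((e - eta_partial y (2 * N)) + (zeta_poly (2 * N) y - zeta_poly N y)) / (1 - w)"
    unfolding riemann_zeta_def e_def[symmetric] w_def[symmetric] eta_partial_even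
    using w0 by (simp add: eq_divide_eq) (simp add: divide_simps, simp add: algebra_simps)
  then have "norm (riemann_zeta (Complex (1/2) y) - zeta_poly N y)
      = norm ((e - eta_partial y (2 * N)) + (zeta_poly (2 * N) y - zeta_poly N y)) / norm (1 - w)"
    by (simp add: norm_divide)
  also have "\<dots> \<le> (4 / sqrt (real N) + S / sqrt (real N)) / (2 / 5)"
  proof (rule frac_le)
    show "norm ((e - eta_partial y (2 * N)) + (zeta_poly (2 * N) y - zeta_poly N y)) \<le> 4 / sqrt (real N) + S / sqrt (real N)"
      by (rule norm_triangle_le) (rule add_mono[OF A B])
  qed (use w S0 in auto)
  also have "\<dots> = 5 / 2 * (4 + 2 / sin c + 2 / (sin c)\<^sup>2) / sqrt (real N)"
    unfolding S_def by (simp add: add_divide_distrib algebra_simps)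
  finally show ?thesis .
qed

section \<open>Continuity of zeta on the critical line\<close>

lemma continuous_on_crit_term: "continuous_on A (\<lambda>y. crit_term y n)"
  unfolding crit_term_def divide_inverse cis_conv_exp by (intro continuous_intros)

text \<open>Eta is a uniform limit of its partial sums on bounded intervals. Continuity makes the
  integrand of the continuous moment integrable.\<close>

lemma continuous_on_zeta_critical:
  "continuous_on {0..Y} (\<lambda>y. riemann_zeta (Complex (1/2) y))"
proof -
  have "continuous_on {0..Y} (\<lambda>y. dirichlet_eta (Complex (1/2) y))"
  proof (rule uniform_limit_theorem)
    show "\<forall>\<^sub>F K in sequentially. continuous_on {0..Y} (\<lambda>y. eta_partial y K)"
      unfolding eta_partial_def by (intro always_eventually allI continuous_intros continuous_on_crit_term)
    show "uniform_limit {0..Y} (\<lambda>K y. eta_partial y K) (\<lambda>y. dirichlet_eta (Complex (1/2) y)) sequentially"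
    proof (rule uniform_limitI)
      fix e :: real assume e: "e > 0"
      have "(\<lambda>M. 4 / sqrt (real M)) \<longlonglongrightarrow> 0" by real_asymp
      then have 1: "\<forall>\<^sub>F M in sequentially. 4 / sqrt (real M) < e"
        using e by (rule order_tendstoD)
      have 2: "\<forall>\<^sub>F M in sequentially. real M \<ge> Y" by real_asymp
      show "\<forall>\<^sub>F K in sequentially. \<forall>y\<in>{0..Y}. dist (eta_partial y K) (dirichlet_eta (Complex (1/2) y)) < e"
        using 1 2 eventually_ge_at_top[of 1]
      proof eventually_elim
        case (elim K)
        show ?case
        proof
          fix y assume "y \<in> {0..Y}"
          then show "dist (eta_partial y K) (dirichlet_eta (Complex (1/2) y)) < e"
            using dirichlet_eta_approx[of K y] elim by (simp add: dist_norm norm_minus_commute)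
        qed
      qed
    qed
  qed simp
  moreover have "1 - 2 powr (1 - Complex (1/2) y) \<noteq> 0" for y
    using one_minus_two_powr_critical[of y] by auto
  ultimately show ?thesis
    unfolding riemann_zeta_def two_powr_critical
    by (intro continuous_on_divide continuous_on_diff continuous_on_const continuous_on_mult
        continuous_on_cis continuous_on_minus continuous_on_id) (auto simp: two_powr_critical)
qed

subsection \<open>Lattice points near and on a line\<close>

text \<open>This is min 1 (1 / u^2), the shape of the kernel bound after rescaling. The case split
  gives 1 at u = 0, where \<open>1 / u\<^sup>2\<close> would be 0.\<close>

definition lattice_weight :: "real \<Rightarrow> real" where
  "lattice_weight u = (if \<bar>u\<bar> < 1 then 1 else 1 / u\<^sup>2)"

lemma lattice_weight_nonneg: "lattice_weight u \<ge> 0"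
  by (simp add: lattice_weight_def)

lemma lattice_weight_le_floor:
  "lattice_weight u \<le> (if nat \<lfloor>\<bar>u\<bar>\<rfloor> = 0 then 1 else 1 / (real (nat \<lfloor>\<bar>u\<bar>\<rfloor>))\<^sup>2)"
proof (cases "\<bar>u\<bar> < 1")
  case True
  then have "\<lfloor>\<bar>u\<bar>\<rfloor> = 0" by (simp add: floor_eq_iff)
  then show ?thesis using True by (simp add: lattice_weight_def)
next
  case False
  then have "\<lfloor>\<bar>u\<bar>\<rfloor> \<ge> 1" by (simp add: le_floor_iff)
  then have "real (nat \<lfloor>\<bar>u\<bar>\<rfloor>) = of_int \<lfloor>\<bar>u\<bar>\<rfloor>" "of_int \<lfloor>\<bar>u\<bar>\<rfloor> \<ge> (1::real)" by simp_all
  moreover have "of_int \<lfloor>\<bar>u\<bar>\<rfloor> \<le> \<bar>u\<bar>" by simp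
  ultimately have "0 < real (nat \<lfloor>\<bar>u\<bar>\<rfloor>)" "real (nat \<lfloor>\<bar>u\<bar>\<rfloor>) \<le> \<bar>u\<bar>" by linarith+
  then have "(real (nat \<lfloor>\<bar>u\<bar>\<rfloor>))\<^sup>2 \<le> u\<^sup>2" "0 < (real (nat \<lfloor>\<bar>u\<bar>\<rfloor>))\<^sup>2"
    using power_mono[of "real (nat \<lfloor>\<bar>u\<bar>\<rfloor>)" "\<bar>u\<bar>" 2] by (simp, intro zero_less_power)
  then have "1 / u\<^sup>2 \<le> 1 / (real (nat \<lfloor>\<bar>u\<bar>\<rfloor>))\<^sup>2"
    by (intro divide_left_mono mult_pos_pos) auto
  then show ?thesis using False \<open>\<lfloor>\<bar>u\<bar>\<rfloor> \<ge> 1\<close> by (simp add: lattice_weight_def)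
qed

text \<open>Distinct values of floor |m - y| allow comparison with 1 plus the sum of 1 / k^2 over k
  >= 1, and the latter is at most 2.\<close>

lemma sum_lattice_weight_le_aux:
  assumes "finite A" "inj_on (\<lambda>m. nat \<lfloor>\<bar>real m - y\<bar>\<rfloor>) A"
  shows "(\<Sum>m\<in>A. lattice_weight (real m - y)) \<le> 3"
proof -
  define h :: "nat \<Rightarrow> real" where "h k = (if k = 0 then 1 else 1 / (real k)\<^sup>2)" for k
  define j where "j m = nat \<lfloor>\<bar>real m - y\<bar>\<rfloor>" for m
  have h0: "h k \<ge> 0" for k by (simp add: h_def)
  have "(\<Sum>m\<in>A. lattice_weight (real m - y)) \<le> (\<Sum>m\<in>A. h (j m))"
    unfolding h_def j_def by (intro sum_mono lattice_weight_le_floor)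
  also have "\<dots> = sum h (j ` A)"
    using assms(2) by (subst sum.reindex) (auto simp: j_def[abs_def])
  also have "\<dots> \<le> sum h (insert 0 {1..<Suc (Max (j ` A))})"
  proof (rule sum_mono2)
    show "j ` A \<subseteq> insert 0 {1..<Suc (Max (j ` A))}"
    proof
      fix k assume "k \<in> j ` A"
      then have "k \<le> Max (j ` A)" using assms(1) by (intro Max_ge) auto
      then show "k \<in> insert 0 {1..<Suc (Max (j ` A))}" by auto
    qed
  qed (auto simp: h0)
  also have "\<dots> = 1 + (\<Sum>k=1..<Suc (Max (j ` A)). 1 / (real k)\<^sup>2)"
    by (simp add: h_def del: sum.op_ivl_Suc)
  also have "\<dots> \<le> 3"
    using sum_inverse_squares_le[of 1 "Suc (Max (j ` A))"] by (simp del: sum.op_ivl_Suc)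
  finally show ?thesis .
qed

text \<open>On each side of y an integer is determined by floor |m - y|; the two sides give 3 +
  3.\<close>

lemma sum_lattice_weight_le:
  fixes A :: "nat set"
  assumes "finite A"
  shows "(\<Sum>m\<in>A. lattice_weight (real m - y)) \<le> 6"
proof -
  define A1 where "A1 = {m\<in>A. y \<le> real m}"
  define A2 where "A2 = {m\<in>A. real m < y}"
  have A: "A = A1 \<union> A2" "A1 \<inter> A2 = {}" "finite A1" "finite A2"
    using assms by (auto simp: A1_def A2_def)
  have i1: "inj_on (\<lambda>m. nat \<lfloor>\<bar>real m - y\<bar>\<rfloor>) A1"
  proof (rule inj_onI)
    fix m n assume *: "m \<in> A1" "n \<in> A1" "nat \<lfloor>\<bar>real m - y\<bar>\<rfloor> = nat \<lfloor>\<bar>real n - y\<bar>\<rfloor>"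
    then have "y \<le> real m" "y \<le> real n" by (auto simp: A1_def)
    with * have "\<bar>real m - real n\<bar> < 1" by linarith
    then show "m = n" by linarith
  qed
  have i2: "inj_on (\<lambda>m. nat \<lfloor>\<bar>real m - y\<bar>\<rfloor>) A2"
  proof (rule inj_onI)
    fix m n assume *: "m \<in> A2" "n \<in> A2" "nat \<lfloor>\<bar>real m - y\<bar>\<rfloor> = nat \<lfloor>\<bar>real n - y\<bar>\<rfloor>"
    then have "y > real m" "y > real n" by (auto simp: A2_def)
    with * have "\<bar>real m - real n\<bar> < 1" by linarith
    then show "m = n" by linarith
  qed
  have "(\<Sum>m\<in>A. lattice_weight (real m - y)) = (\<Sum>m\<in>A1. lattice_weight (real m - y)) + (\<Sum>m\<in>A2. lattice_weight (real m - y))"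
    unfolding A(1) by (rule sum.union_disjoint) (use A in auto)
  then show ?thesis
    using sum_lattice_weight_le_aux[OF A(3) i1] sum_lattice_weight_le_aux[OF A(4) i2] by linarith
qed

text \<open>Separation makes n div D injective on S, so the elements lie in distinct blocks of
  length D. Block 0 contributes at most 1, and block j at most 1 / (D j).\<close>

lemma sum_inverse_separated_le:
  assumes S: "S \<subseteq> {1..N}" and D: "D \<ge> 1"
    and sep: "\<And>n n'. n \<in> S \<Longrightarrow> n' \<in> S \<Longrightarrow> n < n' \<Longrightarrow> n' - n \<ge> D"
  shows "(\<Sum>n\<in>S. 1 / real n) \<le> 1 + harm N / real D"
proof -
  define g where "g j = (if j = 0 then 1 else 1 / (real D * real j))" for j :: nat
  have fin: "finite S" using S finite_subset by blast
  have g0: "g j \<ge> 0" for j by (simp add: g_def)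
  have inj: "inj_on (\<lambda>n. n div D) S"
  proof (rule inj_onI, rule ccontr)
    have *: False if "m \<in> S" "n \<in> S" "m div D = n div D" "m < n" for m n
    proof -
      define X where "X = (n div D) * D"
      have "n < X + D" unfolding X_def
        by (metis D add.commute dividend_less_times_div less_eq_Suc_le mult.commute One_nat_def)
      moreover have "X \<le> m" unfolding X_def using that by (metis div_times_less_eq_dividend)
      ultimately show False using sep[OF that(1,2,4)] that(4) by linarith
    qed
    fix m n assume "m \<in> S" "n \<in> S" "m div D = n div D" "m \<noteq> n"
    then show False using *[of m n] *[of n m] by linarith
  qed
  have "(\<Sum>n\<in>S. 1 / real n) \<le> (\<Sum>n\<in>S. g (n div D))"
  proof (rule sum_mono)
    fix n assume n: "n \<in> S"
    then have n1: "n \<ge> 1" using S by auto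
    show "1 / real n \<le> g (n div D)"
    proof (cases "n div D = 0")
      case True then show ?thesis using n1 by (simp add: g_def)
    next
      case False
      have "D * (n div D) \<le> n" by simp
      then have "real D * real (n div D) \<le> real n" by (metis of_nat_le_iff of_nat_mult)
      moreover have "real D * real (n div D) > 0" using False D by simp
      ultimately have "1 / real n \<le> 1 / (real D * real (n div D))"
        using n1 by (intro divide_left_mono mult_pos_pos[of "real n"]) auto
      then show ?thesis using False by (simp add: g_def)
    qed
  qed
  also have "\<dots> = sum g ((\<lambda>n. n div D) ` S)" using inj by (subst sum.reindex) auto
  also have "\<dots> \<le> sum g (insert 0 {1..N})"
  proof (rule sum_mono2)
    show "(\<lambda>n. n div D) ` S \<subseteq> insert 0 {1..N}"
    proof
      fix k assume "k \<in> (\<lambda>n. n div D) ` S"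
      then obtain n where "n \<in> S" "k = n div D" by auto
      moreover from this have "n \<le> N" using S by auto
      ultimately have "k \<le> N" using div_le_dividend[of n D] by linarith
      then show "k \<in> insert 0 {1..N}" by auto
    qed
  qed (auto simp: g0)
  also have "\<dots> = 1 + (\<Sum>j=1..N. 1 / (real D * real j))" by (simp add: g_def)
  also have "(\<Sum>j=1..N. 1 / (real D * real j)) = harm N / real D"
    unfolding harm_def sum_divide_distrib by (intro sum.cong) (auto simp: field_simps)
  finally show ?thesis .
qed

text \<open>An irrational r keeps the finitely many multiples d r, 1 <= d < D, away from the
  integers, while two near multiples whose indices differ by d would bring d r within 2 \<eta> of
  one.\<close>

lemma near_multiples_separated:
  fixes r :: real and D :: nat
  assumes r: "r > 0"
  obtains \<eta> where "0 < \<eta>" "\<eta> \<le> 1 / 2"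
    "\<And>(n::nat) (n'::nat) (m::int) (m'::int). n < n' \<Longrightarrow> 0 < \<bar>of_int m - real n * r\<bar> \<Longrightarrow> \<bar>of_int m - real n * r\<bar> < \<eta> \<Longrightarrow>
      0 < \<bar>of_int m' - real n' * r\<bar> \<Longrightarrow> \<bar>of_int m' - real n' * r\<bar> < \<eta> \<Longrightarrow> n' - n \<ge> D"
proof (cases "r \<in> \<rat>")
  case True
  then obtain p q :: int where pq: "q > 0" "r = of_int p / of_int q"
    by (metis Rats_cases')
  show ?thesis
  \<comment> \<open>Multiples of a fraction with denominator q are integers or at distance at least
    1 / q from them, so this \<eta> makes the assumptions contradictory.\<close>
  proof (rule that[of "1 / (2 * of_int q)"])
    show "0 < 1 / (2 * real_of_int q)" "1 / (2 * real_of_int q) \<le> 1 / 2"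
      using pq by (auto simp: field_simps)
    fix n n' :: nat and m m' :: int
    assume *: "0 < \<bar>of_int m - real n * r\<bar>" "\<bar>of_int m - real n * r\<bar> < 1 / (2 * of_int q)"
    have e: "of_int m - real n * r = of_int (m * q - int n * p) / of_int q"
      using pq by (simp add: field_simps)
    have "m * q - int n * p \<noteq> 0" using *(1) unfolding e by (metis abs_zero div_0 less_irrefl of_int_0)
    then have "\<bar>m * q - int n * p\<bar> \<ge> 1" by linarith
    then have "\<bar>of_int (m * q - int n * p)\<bar> \<ge> (1::real)" by linarith
    then have "1 / of_int q \<le> \<bar>of_int m - real n * r\<bar>"
      unfolding e abs_divide using pq by (intro frac_le) auto
    moreover have "1 / (2 * of_int q) \<le> 1 / (of_int q :: real)" using pq by (intro divide_left_mono) auto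
    ultimately show "n' - n \<ge> D" using * by linarith
  qed
next
  case False
  define f where "f d = \<bar>real d * r - of_int (round (real d * r))\<bar>" for d :: nat
  \<comment> \<open>The element 1 keeps the set nonempty when D <= 1 and enforces \<eta> <= 1/2;
    halving leaves room for two deviations.\<close>
  define \<eta> where "\<eta> = Min (insert 1 (f ` {1..<D})) / 2"
  have fpos: "f d > 0" if "d \<ge> 1" for d
  proof -
    have "real d * r \<noteq> of_int k" for k :: int
    proof
      assume "real d * r = of_int k"
      then have "r = of_int k / of_nat d" using that by (simp add: field_simps)
      then show False using False by auto
    qed
    then show ?thesis unfolding f_def by (metis eq_iff_diff_eq_0 zero_less_abs_iff)
  qed
  show ?thesis
  proof (rule that[of \<eta>])
    show "\<eta> > 0" unfolding \<eta>_def using fpos by (subst half_gt_zero_iff, subst Min_gr_iff) auto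
    have "Min (insert 1 (f ` {1..<D})) \<le> 1" by (intro Min_le) auto
    then show "\<eta> \<le> 1 / 2" unfolding \<eta>_def by simp
    fix n n' :: nat and m m' :: int
    assume *: "n < n'" "\<bar>of_int m - real n * r\<bar> < \<eta>" "\<bar>of_int m' - real n' * r\<bar> < \<eta>"
    show "n' - n \<ge> D"
    proof (rule ccontr)
      assume "\<not> n' - n \<ge> D"
      then have "n' - n \<in> {1..<D}" using * by auto
      then have "Min (insert 1 (f ` {1..<D})) \<le> f (n' - n)" by (intro Min_le) auto
      then have "2 * \<eta> \<le> f (n' - n)" by (simp add: \<eta>_def)
      also have "\<dots> \<le> \<bar>real (n' - n) * r - of_int (m' - m)\<bar>"
        unfolding f_def by (rule round_diff_minimal)
      also have "real (n' - n) * r - of_int (m' - m) = (of_int m - real n * r) - (of_int m' - real n' * r)"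
        using * by (simp add: of_nat_diff algebra_simps)
      also have "\<bar>\<dots>\<bar> < 2 * \<eta>" using * by linarith
      finally show False by simp
    qed
  qed
qed

section \<open>Pairs n < m and the exact pairs m = n r\<close>

definition pairs :: "nat \<Rightarrow> (nat \<times> nat) set" where
  "pairs N = {(m, n). 1 \<le> n \<and> n < m \<and> m \<le> N}"

lemma finite_pairs: "finite (pairs N)"
  by (rule finite_subset[of _ "{1..N} \<times> {1..N}"]) (auto simp: pairs_def)

definition exact_sum :: "real \<Rightarrow> nat \<Rightarrow> real" where
  "exact_sum r N = (\<Sum>(m, n)\<in>{(m, n)\<in>pairs N. real m = real n * r}. 1 / sqrt (real m * real n))"

lemma exact_sum_eq_0:
  assumes "r \<notin> \<rat> \<or> r = 1" shows "exact_sum r N = 0"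
proof -
  have False if "(m, n) \<in> pairs N" "real m = real n * r" for m n
  proof -
    have mn: "n > 0" "n < m" using that by (auto simp: pairs_def)
    then have "r = of_nat m / of_nat n" using that by (simp add: field_simps)
    then have "r \<in> \<rat>" by auto
    moreover have "r \<noteq> 1" using that mn by auto
    ultimately show False using assms by auto
  qed
  then have "{(m, n)\<in>pairs N. real m = real n * r} = {}" by blast
  then show ?thesis unfolding exact_sum_def by (simp only: sum.empty)
qed

text \<open>By coprimality the exact pairs are (p j, q j), and m <= N means j <= N div p; each
  contributes 1 / (j sqrt (p q)).\<close>

lemma exact_sum_rational:
  assumes pq: "coprime p q" "q > 0" "q < p" and r: "r = real p / real q"
  shows "exact_sum r N = harm (N div p) / sqrt (real p * real q)"
proof -
  have "bij_betw (\<lambda>j. (p * j, q * j)) {1..N div p} {(m, n)\<in>pairs N. real m = real n * r}"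
  proof (rule bij_betw_imageI)
    show "inj_on (\<lambda>j. (p * j, q * j)) {1..N div p}" using pq by (auto intro!: inj_onI)
    show "(\<lambda>j. (p * j, q * j)) ` {1..N div p} = {(m, n)\<in>pairs N. real m = real n * r}"
    proof (intro equalityI subsetI)
      fix x assume "x \<in> (\<lambda>j. (p * j, q * j)) ` {1..N div p}"
      then obtain j where j0: "x = (p * j, q * j)" "j \<in> {1..N div p}"
        by (rule imageE)
      then have j: "x = (p * j, q * j)" "1 \<le> j" "j \<le> N div p" by simp_all
      have "p * j \<le> N" using j(3) pq by (simp add: less_eq_div_iff_mult_less_eq mult.commute)
      then show "x \<in> {(m, n)\<in>pairs N. real m = real n * r}"
        using j pq by (auto simp: pairs_def r)
    next
      fix x assume "x \<in> {(m, n)\<in>pairs N. real m = real n * r}"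
      then obtain m n where x: "x = (m, n)" "1 \<le> n" "n < m" "m \<le> N" "real m = real n * r"
        by (auto simp: pairs_def)
      have "real m * real q = real n * real p" using x pq by (simp add: r field_simps)
      then have e: "m * q = n * p" by (metis of_nat_eq_iff of_nat_mult)
      then have "p dvd m * q" by simp
      then have "p dvd m" using pq by (simp add: coprime_dvd_mult_left_iff)
      then obtain j where j: "m = p * j" by auto
      then have "n = q * j" using e pq by auto
      moreover have "j \<le> N div p" using j x pq by (simp add: less_eq_div_iff_mult_less_eq mult.commute)
      moreover have "j \<ge> 1" using j x by (cases j) auto
      ultimately show "x \<in> (\<lambda>j. (p * j, q * j)) ` {1..N div p}" using j x by auto
    qed
  qed
  then have "exact_sum r N = (\<Sum>j=1..N div p. 1 / sqrt (real (p * j) * real (q * j)))"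
    unfolding exact_sum_def by (subst sum.reindex_bij_betw[symmetric]) (auto simp: case_prod_beta)
  also have "\<dots> = (\<Sum>j=1..N div p. inverse (real j) / sqrt (real p * real q))"
  proof (intro sum.cong refl)
    fix j assume "j \<in> {1..N div p}"
    have "real (p * j) * real (q * j) = (real p * real q) * (real j)\<^sup>2" by (simp add: power2_eq_square)
    then have "sqrt (real (p * j) * real (q * j)) = sqrt (real p * real q) * real j"
      by (simp only: real_sqrt_mult real_sqrt_abs abs_of_nat)
    then show "1 / sqrt (real (p * j) * real (q * j)) = inverse (real j) / sqrt (real p * real q)"
      by (simp add: divide_simps)
  qed
  also have "\<dots> = harm (N div p) / sqrt (real p * real q)"
    by (simp add: harm_def sum_divide_distrib)
  finally show ?thesis .
qed

subsection \<open>Resonant pairs\<close>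

lemma sum_pairs_nested:
  assumes "P \<subseteq> pairs N"
  shows "(\<Sum>(m, n)\<in>P. f m n) = (\<Sum>n=1..N. \<Sum>m\<in>{m. (m, n) \<in> P}. f m n)"
proof -
  have fin: "finite P" using assms finite_pairs finite_subset by blast
  have fs: "finite {m. (m, n) \<in> P}" for n
    using finite_imageI[OF fin, of fst] by (rule rev_finite_subset) force
  have "(\<Sum>n=1..N. \<Sum>m\<in>{m. (m, n) \<in> P}. f m n) = (\<Sum>(n, m)\<in>(SIGMA n:{1..N}. {m. (m, n) \<in> P}). f m n)"
    by (rule sum.Sigma) (auto simp: fs)
  also have "\<dots> = (\<Sum>(m, n)\<in>P. f m n)"
    by (rule sum.reindex_bij_witness[of _ "\<lambda>(m, n). (n, m)" "\<lambda>(n, m). (m, n)"])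
      (use assms in \<open>auto simp: pairs_def\<close>)
  finally show ?thesis ..
qed

text \<open>A consequence of ln x <= x - 1. It translates closeness of a ln (m / n) to k into
  closeness of m to n exp (k / a), where integer points can be counted.\<close>

lemma diff_le_ln_diff:
  assumes "(u::real) > 0" "v > 0"
  shows "\<bar>u - v\<bar> \<le> max u v * \<bar>ln u - ln v\<bar>"
proof -
  have *: "u - v \<le> u * (ln u - ln v)" if "u > 0" "v > 0" for u v :: real
  proof -
    have "ln (v / u) \<le> v / u - 1" using that by (intro ln_le_minus_one) auto
    then have "u * (ln v - ln u) \<le> u * (v / u - 1)" using that by (intro mult_left_mono) (auto simp: ln_div)
    then show ?thesis using that by (simp add: algebra_simps)
  qed
  show ?thesis
  proof (cases "u \<ge> v")
    case True
    then have "ln u \<ge> ln v" using assms by simp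
    then show ?thesis using *[of u v] True assms by simp
  next
    case False
    then have "ln u \<le> ln v" using assms by simp
    then show ?thesis using *[of v u] False assms by simp
  qed
qed

text \<open>The analysis of pairs is axiomatised so that it serves the sum over l and the integral
  over t alike. \<open>\<kappa> k\<close> is the normalised limit of the kernel at the resonance x =
  k / a, and \<open>G k\<close> the normalised weight of the exact pairs there.
  \<open>K_decay\<close> is multiplied out, so that it makes sense at distance 0; T0 >= 2 keeps ln T
  positive.\<close>

locale resonance =
  fixes a \<beta> C c0 T0 :: real and K :: "real \<Rightarrow> real \<Rightarrow> complex" and N :: "real \<Rightarrow> nat"
    and \<kappa> :: "nat \<Rightarrow> complex" and G :: "nat \<Rightarrow> real"
  assumes a: "a > 0" and C: "C \<ge> 0" and c0: "c0 > 0" and T0: "T0 \<ge> 2"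
    and K_trivial: "\<And>T x. T \<ge> T0 \<Longrightarrow> norm (K T x) \<le> C * T"
    and K_decay: "\<And>T x. T \<ge> T0 \<Longrightarrow> norm (K T x) * T * (a * x - of_int (round (a * x)))\<^sup>2 \<le> C"
    and K_lim: "\<And>k. ((\<lambda>T. K T (real k / a) / of_real T) \<longlongrightarrow> \<kappa> k) at_top"
    and N_le: "\<And>T. T \<ge> T0 \<Longrightarrow> real (N T) \<le> c0 * T"
    and harm_N: "((\<lambda>T. harm (N T) / ln T) \<longlongrightarrow> 1) at_top"
    and G_lim: "\<And>k. ((\<lambda>T. exact_sum (exp (real k / a)) (N T) / ln T) \<longlongrightarrow> G k) at_top"
begin

text \<open>On \<open>pairs\<close> the ratio m / n exceeds 1, so truncation by \<open>nat\<close>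
  loses nothing (\<open>idx_eq_round\<close>).\<close>

definition idx :: "nat \<times> nat \<Rightarrow> nat" where
  "idx = (\<lambda>(m, n). nat (round (a * ln (real m / real n))))"

definition level :: "nat \<Rightarrow> nat \<Rightarrow> (nat \<times> nat) set" where
  "level k M = {p \<in> pairs M. idx p = k}"

definition summand :: "real \<Rightarrow> nat \<times> nat \<Rightarrow> complex" where
  "summand T = (\<lambda>(m, n). of_real (1 / sqrt (real m * real n)) * cis (- (\<beta> * ln (real m / real n)))
      * K T (ln (real m / real n)))"

lemma level_subset: "level k M \<subseteq> pairs M"
  by (auto simp: level_def)

lemma finite_level: "finite (level k M)"
  using level_subset finite_pairs finite_subset by blast

lemma idx_eq_round:
  assumes "(m, n) \<in> level k M"
  shows "round (a * ln (real m / real n)) = int k"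
proof -
  have mn: "1 \<le> n" "n < m" and i: "nat (round (a * ln (real m / real n))) = k"
    using assms by (auto simp: level_def pairs_def idx_def)
  have "ln (real m / real n) \<ge> 0" using mn by simp
  then have "a * ln (real m / real n) \<ge> 0" using a by simp
  then have "round (a * ln (real m / real n)) \<ge> 0"
    by (metis round_0 round_mono)
  then show ?thesis using i by simp
qed

text \<open>All three follow from |a ln (m / n) - k| <= 1/2. The third compares n exp (k / a) with m
  at a cost independent of k.\<close>

lemma level_bounds:
  assumes "(m, n) \<in> level k M"
  shows "real n * exp ((real k - 1/2) / a) \<le> real m" "real m \<le> real n * exp ((real k + 1/2) / a)"
    "real n * exp (real k / a) \<le> exp (1 / (2 * a)) * real m"
proof -
  have mn: "1 \<le> n" "n < m" using assms by (auto simp: level_def pairs_def)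
  define x where "x = ln (real m / real n)"
  have m: "real m = real n * exp x" unfolding x_def using mn by simp
  have "\<bar>of_int (round (a * x)) - a * x\<bar> \<le> 1 / 2" by (rule of_int_round_abs_le)
  then have r: "\<bar>real k - a * x\<bar> \<le> 1 / 2" using idx_eq_round[OF assms] by (simp add: x_def)
  have "real k - 1/2 \<le> x * a" "x * a \<le> real k + 1/2"
    using r unfolding mult.commute[of x a] by linarith+
  then have "(real k - 1/2) / a \<le> x" "x \<le> (real k + 1/2) / a"
    using a by (simp_all only: pos_divide_le_eq pos_le_divide_eq)
  then show "real n * exp ((real k - 1/2) / a) \<le> real m" "real m \<le> real n * exp ((real k + 1/2) / a)"
    unfolding m by (auto intro!: mult_left_mono)
  have "real k / a \<le> (1 / 2 + x * a) / a" 
    using r a unfolding mult.commute[of x a] by (intro divide_right_mono) linarith+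
  also have "\<dots> = 1 / (2 * a) + x" using a by (simp add: add_divide_distrib)
  finally have "real k / a \<le> 1 / (2 * a) + x" .
  then have "exp (real k / a) \<le> exp (1 / (2 * a)) * exp x" by (simp flip: exp_add)
  then have "real n * exp (real k / a) \<le> real n * (exp (1 / (2 * a)) * exp x)" by (intro mult_left_mono) auto
  then show "real n * exp (real k / a) \<le> exp (1 / (2 * a)) * real m" unfolding m by (simp add: mult_ac)
qed

definition C1 :: real where "C1 = C * exp (1 / a) / a\<^sup>2"

lemma C1_nonneg: "C1 \<ge> 0" unfolding C1_def using C by simp

text \<open>On level k the distance in \<open>K_decay\<close> is |a ln (m / n) - k|. By
  \<open>diff_le_ln_diff\<close> it bounds |m - n exp (k / a)| up to the factor exp (1 / (2 a)) m /
  a, whose square goes into \<open>C1\<close>.\<close>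

lemma K_level_bound:
  assumes p: "(m, n) \<in> level k M" and T: "T \<ge> T0"
  shows "norm (K T (ln (real m / real n))) * (real m - real n * exp (real k / a))\<^sup>2 \<le> C1 * (real m)\<^sup>2 / T"
proof -
  have mn: "1 \<le> n" "n < m" using p by (auto simp: level_def pairs_def)
  define x where "x = ln (real m / real n)"
  define y where "y = real n * exp (real k / a)"
  define e where "e = exp (1 / (2 * a))"
  have e1: "e \<ge> 1" unfolding e_def using a by simp
  have y0: "y > 0" unfolding y_def using mn by simp
  have T': "T > 0" using T T0 by simp
  have lnd: "ln (real m) - ln y = x - real k / a"
    unfolding x_def y_def using mn by (simp add: ln_mult ln_div)
  have "\<bar>real m - y\<bar> \<le> max (real m) y * \<bar>x - real k / a\<bar>"
    using diff_le_ln_diff[of "real m" y] mn y0 unfolding lnd by simp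
  also have "\<dots> \<le> (e * real m) * \<bar>x - real k / a\<bar>"
  proof (rule mult_right_mono)
    have "1 * real m \<le> e * real m" using e1 by (intro mult_right_mono) auto
    then show "max (real m) y \<le> e * real m"
      using level_bounds(3)[OF p] by (simp add: e_def y_def)
  qed simp
  finally have "\<bar>real m - y\<bar>\<^sup>2 \<le> ((e * real m) * \<bar>x - real k / a\<bar>)\<^sup>2" by (intro power_mono) auto
  then have sq: "(real m - y)\<^sup>2 \<le> e\<^sup>2 * (real m)\<^sup>2 * (x - real k / a)\<^sup>2"
    by (simp add: power_mult_distrib)
  have e2: "e\<^sup>2 = exp (1 / a)" unfolding e_def by (simp flip: exp_double)
  have d: "(x - real k / a)\<^sup>2 = (a * x - real k)\<^sup>2 / a\<^sup>2"
    using a by (simp add: power_divide[symmetric] diff_divide_distrib)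
  have "norm (K T x) * (real m - y)\<^sup>2 \<le> norm (K T x) * (e\<^sup>2 * (real m)\<^sup>2 * (x - real k / a)\<^sup>2)"
    by (intro mult_left_mono sq) auto
  also have "\<dots> = (norm (K T x) * T * (a * x - real k)\<^sup>2) * (exp (1 / a) / a\<^sup>2 * (real m)\<^sup>2 / T)"
    using T' unfolding d e2 by simp
  also have "\<dots> \<le> C * (exp (1 / a) / a\<^sup>2 * (real m)\<^sup>2 / T)"
    using K_decay[OF T, of x] idx_eq_round[OF p] T'
    by (intro mult_right_mono) (auto simp: x_def)
  also have "\<dots> = C1 * (real m)\<^sup>2 / T" by (simp add: C1_def)
  finally show ?thesis unfolding x_def y_def .
qed

definition C2 :: real where "C2 = max C (C1 * c0\<^sup>2)"

lemma C2_nonneg: "C2 \<ge> 0" unfolding C2_def using C by simp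

text \<open>Within distance 1 the trivial bound is used, beyond it the decay; as m <= c0 T, the
  factor m^2 / T in the latter is again of order T.\<close>

lemma K_level_weight:
  assumes p: "(m, n) \<in> level k (N T)" and T: "T \<ge> T0"
  shows "norm (K T (ln (real m / real n))) \<le> C2 * T * lattice_weight (real m - real n * exp (real k / a))"
proof -
  define u where "u = real m - real n * exp (real k / a)"
  define X where "X = norm (K T (ln (real m / real n)))"
  have T': "T > 0" using T T0 by simp
  have m: "real m \<le> c0 * T"
    using p N_le[OF T] by (auto simp: level_def pairs_def)
  show ?thesis
  proof (cases "\<bar>u\<bar> < 1")
    case True
    have "X \<le> C * T" unfolding X_def by (rule K_trivial[OF T])
    also have "\<dots> \<le> C2 * T" using T' by (intro mult_right_mono) (auto simp: C2_def)
    finally show ?thesis using True by (simp add: lattice_weight_def X_def u_def)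
  next
    case False
    then have u: "u\<^sup>2 > 0" by auto
    have "X * u\<^sup>2 \<le> C1 * (real m)\<^sup>2 / T"
      unfolding X_def u_def by (rule K_level_bound[OF p T])
    also have "\<dots> \<le> C1 * (c0 * T)\<^sup>2 / T"
      using m T' C1_nonneg by (intro divide_right_mono mult_left_mono power_mono) auto
    also have "\<dots> = (C1 * c0\<^sup>2) * T" using T' by (simp add: power2_eq_square)
    also have "\<dots> \<le> C2 * T" using T' by (intro mult_right_mono) (auto simp: C2_def)
    finally have "X \<le> C2 * T / u\<^sup>2" using u by (simp add: field_simps)
    then show ?thesis using False by (simp add: lattice_weight_def X_def u_def)
  qed
qed

lemma norm_summand: "norm (summand T (m, n)) = 1 / sqrt (real m * real n) * norm (K T (ln (real m / real n)))"
  by (simp add: summand_def norm_mult norm_divide)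

lemma finite_level_slice: "finite {m. (m, n) \<in> level k M}"
  by (rule finite_subset[of _ "{..M}"]) (auto simp: level_def pairs_def)

text \<open>On level k, m n >= n^2 exp ((k - 1/2) / a), hence a weight decaying geometrically in k;
  for fixed n the integers m contribute at most 6 by \<open>sum_lattice_weight_le\<close>. This is
  the majorant for summing over all levels.\<close>

lemma level_sum_bound:
  assumes T: "T \<ge> T0"
  shows "(\<Sum>p\<in>level k (N T). norm (summand T p))
    \<le> 6 * C2 * exp (1 / (4 * a)) * exp (- (1 / (2 * a))) ^ k * harm (N T) * T"
proof -
  have T': "T > 0" using T T0 by simp
  \<comment> \<open>This is exp (-(k - 1/2) / (2 a)), written as a constant times a k-th
    power.\<close>
  define q where "q = exp (1 / (4 * a)) * exp (- (1 / (2 * a))) ^ k"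
  define w where "w m n = lattice_weight (real m - real n * exp (real k / a))" for m n
  have q0: "q \<ge> 0" unfolding q_def by simp
  have pt: "norm (summand T (m, n)) \<le> (q / real n) * (C2 * T * w m n)" if p: "(m, n) \<in> level k (N T)" for m n
    unfolding norm_summand
  proof (rule mult_mono)
    have n: "real n > 0" "real m > 0" using p by (auto simp: level_def pairs_def)
    have "real n * real n * exp ((real k - 1/2) / a) = (real n * exp ((real k - 1/2) / a)) * real n" by simp
    also have "\<dots> \<le> real m * real n" using level_bounds(1)[OF p] n by (intro mult_right_mono) auto
    finally have le: "sqrt (real n * real n * exp ((real k - 1/2) / a)) \<le> sqrt (real m * real n)"
      by (rule real_sqrt_le_mono)
    have "exp ((real k - 1/2) / a) = (1 / q)\<^sup>2"
    proof -
      have "q\<^sup>2 = exp (2 * (1 / (4 * a)) + (2 * real k) * (- (1 / (2 * a))))"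
      proof -
        have "q = exp (1 / (4 * a) + real k * (- (1 / (2 * a))))"
          unfolding q_def exp_add exp_of_nat_mult ..
        then have "q\<^sup>2 = exp (2 * (1 / (4 * a) + real k * (- (1 / (2 * a)))))"
          by (simp only: exp_double)
        then show ?thesis by (simp only: distrib_left mult.assoc)
      qed
      also have "2 * (1 / (4 * a)) + (2 * real k) * (- (1 / (2 * a))) = - ((real k - 1/2) / a)"
        using a by (simp add: field_simps)
      finally show ?thesis by (simp add: power_divide exp_minus inverse_eq_divide)
    qed
    then have "real n * real n * exp ((real k - 1/2) / a) = (real n / q)\<^sup>2"
      by (simp add: power_divide power2_eq_square)
    moreover have "sqrt ((real n / q)\<^sup>2) = real n / q" using q0 by simp
    ultimately have "real n / q \<le> sqrt (real m * real n)" using le by (simp only:)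
    moreover have "q > 0" unfolding q_def by simp
    ultimately have "1 / sqrt (real m * real n) \<le> 1 / (real n / q)"
      using n by (intro divide_left_mono mult_pos_pos) (auto intro: less_le_trans[OF divide_pos_pos])
    then show "1 / sqrt (real m * real n) \<le> q / real n" by simp
    show "norm (K T (ln (real m / real n))) \<le> C2 * T * w m n"
      unfolding w_def by (rule K_level_weight[OF p T])
  qed (use q0 in auto)
  have "(\<Sum>p\<in>level k (N T). norm (summand T p)) = (\<Sum>(m, n)\<in>level k (N T). norm (summand T (m, n)))"
    by (simp add: case_prod_beta)
  also have "\<dots> = (\<Sum>n=1..N T. \<Sum>m\<in>{m. (m, n) \<in> level k (N T)}. norm (summand T (m, n)))"
    by (rule sum_pairs_nested[OF level_subset])
  also have "\<dots> \<le> (\<Sum>n=1..N T. \<Sum>m\<in>{m. (m, n) \<in> level k (N T)}. (q / real n) * (C2 * T * w m n))"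
    by (intro sum_mono pt) auto
  also have "\<dots> = (\<Sum>n=1..N T. (q / real n) * (C2 * T * (\<Sum>m\<in>{m. (m, n) \<in> level k (N T)}. w m n)))"
    by (simp add: sum_distrib_left)
  also have "\<dots> \<le> (\<Sum>n=1..N T. (q / real n) * (C2 * T * 6))"
    unfolding w_def using q0 C2_nonneg T'
    by (intro sum_mono mult_left_mono sum_lattice_weight_le finite_level_slice) auto
  also have "\<dots> = 6 * C2 * q * T * harm (N T)"
    unfolding harm_def sum_distrib_left by (intro sum.cong) (auto simp: field_simps)
  finally show ?thesis by (simp add: q_def mult_ac)
qed

lemma exp_idx_exact:
  assumes "(m, n) \<in> pairs M" "real m = real n * exp (real k / a)"
  shows "ln (real m / real n) = real k / a" "(m, n) \<in> level k M"
proof -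
  have n: "real n > 0" using assms by (auto simp: pairs_def)
  show *: "ln (real m / real n) = real k / a" using n unfolding assms(2) by simp
  have "a * (real k / a) = of_int (int k)" using a by simp
  then show "(m, n) \<in> level k M" using assms(1) by (simp only: level_def idx_def mem_Collect_eq prod.case * round_of_int nat_int)
qed

definition exact :: "nat \<Rightarrow> nat \<Rightarrow> (nat \<times> nat) set" where
  "exact k M = {(m, n)\<in>pairs M. real m = real n * exp (real k / a)}"

lemma exact_subset_level: "exact k M \<subseteq> level k M"
  using exp_idx_exact(2) by (auto simp: exact_def)

text \<open>All exact pairs share ln (m / n) = k / a, so twist and kernel are constant
  factors.\<close>

lemma exact_level_sum:
  "(\<Sum>p\<in>exact k M. summand T p) = of_real (exact_sum (exp (real k / a)) M) * cis (- (\<beta> * (real k / a))) * K T (real k / a)"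
proof -
  have "(\<Sum>p\<in>exact k M. summand T p) = (\<Sum>(m, n)\<in>exact k M. of_real (1 / sqrt (real m * real n))
      * (cis (- (\<beta> * (real k / a))) * K T (real k / a)))"
  proof (rule sum.cong)
    fix p assume p: "p \<in> exact k M"
    obtain m n where mn: "p = (m, n)" by force
    have "ln (real m / real n) = real k / a"
      using p exp_idx_exact(1)[of m n M k] by (simp add: mn exact_def)
    then show "summand T p = (case p of (m, n) \<Rightarrow> of_real (1 / sqrt (real m * real n))
      * (cis (- (\<beta> * (real k / a))) * K T (real k / a)))"
      by (simp add: mn summand_def)
  qed simp
  also have "\<dots> = (\<Sum>p\<in>exact k M. of_real (case p of (m, n) \<Rightarrow> 1 / sqrt (real m * real n)))
      * (cis (- (\<beta> * (real k / a))) * K T (real k / a))"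
    by (simp add: sum_distrib_right case_prod_beta)
  also have "(\<Sum>p\<in>exact k M. of_real (case p of (m, n) \<Rightarrow> 1 / sqrt (real m * real n)))
      = (of_real (exact_sum (exp (real k / a)) M) :: complex)"
    unfolding exact_sum_def exact_def by (simp only: of_real_sum)
  finally show ?thesis by (simp only: mult.assoc)
qed

text \<open>With \<eta> <= 1/2 each n admits at most one m, and the n that occur are at least D
  apart. So the trivial kernel bound and 1 / sqrt (m n) <= 1 / n already save the factor D in the
  harmonic sum.\<close>

lemma near_sum_bound:
  assumes D: "D \<ge> 1"
  obtains \<eta> where "0 < \<eta>" "\<eta> \<le> 1 / 2"
    "\<And>T. T \<ge> T0 \<Longrightarrow> (\<Sum>(m, n)\<in>{(m, n)\<in>level k (N T). 0 < \<bar>real m - real n * exp (real k / a)\<bar>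
        \<and> \<bar>real m - real n * exp (real k / a)\<bar> < \<eta>}. norm (summand T (m, n))) \<le> C * T * (1 + harm (N T) / real D)"
proof -
  define r where "r = exp (real k / a)"
  have "r > 0" by (simp add: r_def)
  then obtain \<eta> where \<eta>: "0 < \<eta>" "\<eta> \<le> 1 / 2" and
    sep: "\<And>(n::nat) (n'::nat) (m::int) (m'::int). n < n' \<Longrightarrow> 0 < \<bar>of_int m - real n * r\<bar> \<Longrightarrow> \<bar>of_int m - real n * r\<bar> < \<eta> \<Longrightarrow>
      0 < \<bar>of_int m' - real n' * r\<bar> \<Longrightarrow> \<bar>of_int m' - real n' * r\<bar> < \<eta> \<Longrightarrow> n' - n \<ge> D"
    by (rule near_multiples_separated[where D = D]) blast
  have "(\<Sum>(m, n)\<in>{(m, n)\<in>level k (N T). 0 < \<bar>real m - real n * r\<bar> \<and> \<bar>real m - real n * r\<bar> < \<eta>}. norm (summand T (m, n)))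
      \<le> C * T * (1 + harm (N T) / real D)" if T: "T \<ge> T0" for T
  proof -
    define P where "P = {(m, n)\<in>level k (N T). 0 < \<bar>real m - real n * r\<bar> \<and> \<bar>real m - real n * r\<bar> < \<eta>}"
    have T': "T > 0" using T T0 by simp
    have PD: "(m, n) \<in> level k (N T)" "0 < \<bar>real m - real n * r\<bar>" "\<bar>real m - real n * r\<bar> < \<eta>" if "(m, n) \<in> P" for m n
      using that by (auto simp: P_def)
    have inj: "inj_on snd P"
    proof (rule inj_onI)
      fix p p' assume *: "p \<in> P" "p' \<in> P" "snd p = snd p'"
      then obtain m m' n where mn: "p = (m, n)" "p' = (m', n)" by (metis prod.collapse)
      then have "(m, n) \<in> P" "(m', n) \<in> P" using * by simp_all
      then have "\<bar>real m - real m'\<bar> < 1" using PD(3)[of m n] PD(3)[of m' n] \<eta> by linarith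
      then show "p = p'" using mn by simp
    qed
    have "(\<Sum>(m, n)\<in>P. norm (summand T (m, n))) \<le> (\<Sum>(m, n)\<in>P. (1 / real n) * (C * T))"
    proof (rule sum_mono)
      fix p assume p: "p \<in> P"
      obtain m n where mn: "p = (m, n)" by force
      have lv: "(m, n) \<in> level k (N T)" using p PD(1) mn by auto
      then have nm: "1 \<le> n" "n < m" by (auto simp: level_def pairs_def)
      have "real n = sqrt (real n * real n)" by simp
      also have "\<dots> \<le> sqrt (real m * real n)" using nm by (intro real_sqrt_le_mono mult_right_mono) auto
      finally have "1 / sqrt (real m * real n) \<le> 1 / real n" using nm by (intro divide_left_mono) auto
      then have "norm (summand T (m, n)) \<le> (1 / real n) * (C * T)"
        unfolding norm_summand by (intro mult_mono K_trivial[OF T]) auto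
      then show "(case p of (m, n) \<Rightarrow> norm (summand T (m, n))) \<le> (case p of (m, n) \<Rightarrow> (1 / real n) * (C * T))"
        by (simp add: mn)
    qed
    also have "\<dots> = (\<Sum>p\<in>P. 1 / real (snd p)) * (C * T)"
      by (simp add: sum_distrib_right case_prod_beta)
    also have "(\<Sum>p\<in>P. 1 / real (snd p)) = (\<Sum>n\<in>snd ` P. 1 / real n)"
      using inj by (subst sum.reindex) auto
    also have "\<dots> \<le> 1 + harm (N T) / real D"
    proof (rule sum_inverse_separated_le[OF _ D])
      show "snd ` P \<subseteq> {1..N T}" by (auto simp: P_def level_def pairs_def)
      fix n n' assume "n \<in> snd ` P" "n' \<in> snd ` P" and lt: "n < n'"
      then obtain m m' where "(m, n) \<in> P" "(m', n') \<in> P" by (metis imageE prod.collapse)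
      then show "n' - n \<ge> D" using PD(2,3)[of m n] PD(2,3)[of m' n'] sep[OF lt, of "int m" "int m'"] by simp
    qed
    finally show ?thesis using C T' unfolding P_def by (simp add: mult_right_mono mult.commute)
  qed
  then show ?thesis using that[of \<eta>] \<eta> unfolding r_def by blast
qed

text \<open>The decay bound with m <= n E and the weight 1 / n leave n / T times a lattice weight.
  At most c0 T values of n, each giving O(1), make O(T) without a logarithm; the constant may depend
  on k and \<eta>, which are fixed while T grows.\<close>

lemma far_sum_bound:
  assumes \<eta>: "0 < \<eta>" "\<eta> \<le> 1" and T: "T \<ge> T0"
  shows "(\<Sum>(m, n)\<in>{(m, n)\<in>level k (N T). \<eta> \<le> \<bar>real m - real n * exp (real k / a)\<bar>}. norm (summand T (m, n)))
     \<le> (6 * C1 * (exp ((real k + 1/2) / a))\<^sup>2 / \<eta>\<^sup>2 * c0\<^sup>2) * T"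
proof -
  define E where "E = exp ((real k + 1/2) / a)"
  define w where "w m n = lattice_weight (real m - real n * exp (real k / a))" for m n
  define P where "P = {(m, n)\<in>level k (N T). \<eta> \<le> \<bar>real m - real n * exp (real k / a)\<bar>}"
  have T': "T > 0" using T T0 by simp
  have Psub: "P \<subseteq> pairs (N T)" using level_subset by (auto simp: P_def)
  have fsl: "finite {m. (m, n) \<in> P}" for n
    by (rule finite_subset[OF _ finite_level_slice[of n k "N T"]]) (auto simp: P_def)
  have pt: "norm (summand T (m, n)) \<le> (C1 * E\<^sup>2 / \<eta>\<^sup>2 * real n / T) * w m n" if p: "(m, n) \<in> P" for m n
  proof -
    define u where "u = real m - real n * exp (real k / a)"
    define X where "X = norm (K T (ln (real m / real n)))"
    have lv: "(m, n) \<in> level k (N T)" and u\<eta>: "\<eta> \<le> \<bar>u\<bar>" using p by (auto simp: P_def u_def)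
    then have nm: "1 \<le> n" "n < m" by (auto simp: level_def pairs_def)
    have u2: "\<eta>\<^sup>2 \<le> u\<^sup>2" using power_mono[OF u\<eta>, of 2] \<eta> by simp
    have upos: "u\<^sup>2 > 0" using \<eta> u\<eta> by auto
    have "X * u\<^sup>2 \<le> C1 * (real m)\<^sup>2 / T"
      unfolding X_def u_def by (rule K_level_bound[OF lv T])
    also have "\<dots> \<le> C1 * (real n * E)\<^sup>2 / T"
      using level_bounds(2)[OF lv] T' C1_nonneg unfolding E_def
      by (intro divide_right_mono mult_left_mono power_mono) auto
    finally have "X \<le> (C1 * (real n * E)\<^sup>2 / T) / u\<^sup>2" using upos by (simp only: pos_le_divide_eq)
    also have "\<dots> = (C1 * (real n * E)\<^sup>2 / T) * (1 / u\<^sup>2)" by simp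
    also have "\<dots> \<le> (C1 * (real n * E)\<^sup>2 / T) * (w m n / \<eta>\<^sup>2)"
    proof (rule mult_left_mono)
      \<comment> \<open>At distances below 1 it is |u| >= \<eta> that bounds 1 / u^2.\<close>
      show "1 / u\<^sup>2 \<le> w m n / \<eta>\<^sup>2"
      proof (cases "\<bar>u\<bar> < 1")
        case True
        have "1 / u\<^sup>2 \<le> 1 / \<eta>\<^sup>2" using u2 \<eta> upos by (intro divide_left_mono mult_pos_pos) auto
        then show ?thesis using True by (simp add: w_def lattice_weight_def u_def)
      next
        case False
        have "\<eta>\<^sup>2 \<le> 1" using \<eta> by (simp add: power_le_one)
        then have "(1 / u\<^sup>2) * \<eta>\<^sup>2 \<le> (1 / u\<^sup>2) * 1" by (intro mult_left_mono) auto
        then have "1 / u\<^sup>2 \<le> (1 / u\<^sup>2) / \<eta>\<^sup>2" using \<eta> by (subst pos_le_divide_eq) simp_all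
        then show ?thesis using False by (simp add: w_def lattice_weight_def u_def)
      qed
    qed (use C1_nonneg T' in auto)
    finally have X: "X \<le> (C1 * (real n * E)\<^sup>2 / T) * (w m n / \<eta>\<^sup>2)" .
    have "real n = sqrt (real n * real n)" by simp
    also have "\<dots> \<le> sqrt (real m * real n)" using nm by (intro real_sqrt_le_mono mult_right_mono) auto
    finally have s: "1 / sqrt (real m * real n) \<le> 1 / real n" using nm by (intro divide_left_mono) auto
    have "norm (summand T (m, n)) \<le> (1 / real n) * ((C1 * (real n * E)\<^sup>2 / T) * (w m n / \<eta>\<^sup>2))"
      unfolding norm_summand using s X X_def by (intro mult_mono) auto
    also have "\<dots> = (C1 * E\<^sup>2 / \<eta>\<^sup>2 * real n / T) * w m n"
      using nm by (simp add: power2_eq_square field_simps)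
    finally show ?thesis .
  qed
  have "(\<Sum>(m, n)\<in>P. norm (summand T (m, n))) = (\<Sum>n=1..N T. \<Sum>m\<in>{m. (m, n) \<in> P}. norm (summand T (m, n)))"
    by (rule sum_pairs_nested[OF Psub])
  also have "\<dots> \<le> (\<Sum>n=1..N T. \<Sum>m\<in>{m. (m, n) \<in> P}. (C1 * E\<^sup>2 / \<eta>\<^sup>2 * real n / T) * w m n)"
    by (intro sum_mono pt) auto
  also have "\<dots> = (\<Sum>n=1..N T. (C1 * E\<^sup>2 / \<eta>\<^sup>2 * real n / T) * (\<Sum>m\<in>{m. (m, n) \<in> P}. w m n))"
    by (simp add: sum_distrib_left)
  also have "\<dots> \<le> (\<Sum>n=1..N T. (C1 * E\<^sup>2 / \<eta>\<^sup>2 * (c0 * T) / T) * 6)"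
  proof (rule sum_mono)
    fix n assume "n \<in> {1..N T}"
    then have n: "real n \<le> c0 * T" using N_le[OF T] by auto
    show "(C1 * E\<^sup>2 / \<eta>\<^sup>2 * real n / T) * (\<Sum>m\<in>{m. (m, n) \<in> P}. w m n) \<le> (C1 * E\<^sup>2 / \<eta>\<^sup>2 * (c0 * T) / T) * 6"
    proof (rule mult_mono)
      show "C1 * E\<^sup>2 / \<eta>\<^sup>2 * real n / T \<le> C1 * E\<^sup>2 / \<eta>\<^sup>2 * (c0 * T) / T"
        using n T' C1_nonneg by (intro divide_right_mono mult_left_mono) auto
      show "(\<Sum>m\<in>{m. (m, n) \<in> P}. w m n) \<le> 6" unfolding w_def by (rule sum_lattice_weight_le[OF fsl])
    qed (use C1_nonneg c0 T' in \<open>auto intro!: sum_nonneg simp: w_def lattice_weight_nonneg\<close>)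
  qed
  also have "\<dots> = real (N T) * (C1 * E\<^sup>2 / \<eta>\<^sup>2 * c0 * 6)" using T' by simp
  also have "\<dots> \<le> (c0 * T) * (C1 * E\<^sup>2 / \<eta>\<^sup>2 * c0 * 6)"
    using N_le[OF T] C1_nonneg c0 by (intro mult_right_mono) auto
  also have "\<dots> = (6 * C1 * E\<^sup>2 / \<eta>\<^sup>2 * c0\<^sup>2) * T" by (simp add: power2_eq_square)
  finally show ?thesis unfolding P_def E_def .
qed

lemma harm_N_div: "((\<lambda>T. (A + B * harm (N T)) / ln T) \<longlongrightarrow> B) at_top"
proof -
  have "((\<lambda>T. A / ln T) \<longlongrightarrow> 0) at_top" by real_asymp
  from tendsto_add[OF this tendsto_mult[OF tendsto_const[of B] harm_N]]
  show ?thesis by (simp add: add_divide_distrib)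
qed

text \<open>D is chosen first, with C / D below the given e, and only then \<eta>. After division by
  T ln T the near pairs contribute at most about C / D, and the far ones vanish in the
  limit.\<close>

lemma level_inexact_limit:
  "((\<lambda>T. (\<Sum>p\<in>level k (N T) - exact k (N T). norm (summand T p)) / (T * ln T)) \<longlongrightarrow> 0) at_top"
proof (rule tendstoI)
  fix e :: real assume e: "e > 0"
  obtain D :: nat where D: "real D > C / e" using reals_Archimedean2 by blast
  have D0: "real D > 0" using D C e by (meson divide_nonneg_pos le_less_trans)
  then have D1: "D \<ge> 1" by simp
  obtain \<eta> where \<eta>: "0 < \<eta>" "\<eta> \<le> 1 / 2" and near:
    "\<And>T. T \<ge> T0 \<Longrightarrow> (\<Sum>(m, n)\<in>{(m, n)\<in>level k (N T). 0 < \<bar>real m - real n * exp (real k / a)\<bar>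
        \<and> \<bar>real m - real n * exp (real k / a)\<bar> < \<eta>}. norm (summand T (m, n))) \<le> C * T * (1 + harm (N T) / real D)"
    by (rule near_sum_bound[OF D1, where k = k]) blast
  define F where "F = 6 * C1 * (exp ((real k + 1/2) / a))\<^sup>2 / \<eta>\<^sup>2 * c0\<^sup>2"
  have "((\<lambda>T. ((C + F) + (C / real D) * harm (N T)) / ln T) \<longlongrightarrow> C / real D) at_top"
    by (rule harm_N_div)
  moreover have "C / real D < e" using D D0 e by (simp add: field_simps)
  ultimately have "\<forall>\<^sub>F T in at_top. ((C + F) + (C / real D) * harm (N T)) / ln T < e"
    by (rule order_tendstoD)
  then show "\<forall>\<^sub>F T in at_top. dist ((\<Sum>p\<in>level k (N T) - exact k (N T). norm (summand T p)) / (T * ln T)) 0 < e"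
    using eventually_ge_at_top[of T0]
  proof eventually_elim
    case (elim T)
    have T': "T \<ge> 2" using elim T0 by simp
    then have lnT: "ln T > 0" by simp
    define P1 where "P1 = {(m, n)\<in>level k (N T). 0 < \<bar>real m - real n * exp (real k / a)\<bar>
        \<and> \<bar>real m - real n * exp (real k / a)\<bar> < \<eta>}"
    define P2 where "P2 = {(m, n)\<in>level k (N T). \<eta> \<le> \<bar>real m - real n * exp (real k / a)\<bar>}"
    have fin: "finite P1" "finite P2"
      by (rule finite_subset[OF _ finite_level[of k "N T"]]; auto simp: P1_def P2_def)+
    have "level k (N T) - exact k (N T) \<subseteq> P1 \<union> P2"
      by (auto simp: P1_def P2_def exact_def level_def)
    then have "(\<Sum>p\<in>level k (N T) - exact k (N T). norm (summand T p)) \<le> (\<Sum>p\<in>P1 \<union> P2. norm (summand T p))"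
      using fin by (intro sum_mono2) auto
    also have "\<dots> = (\<Sum>p\<in>P1. norm (summand T p)) + (\<Sum>p\<in>P2. norm (summand T p))"
      using fin by (intro sum.union_disjoint) (auto simp: P1_def P2_def)
    also have "\<dots> \<le> C * T * (1 + harm (N T) / real D) + F * T"
      using near[OF elim(2)] far_sum_bound[OF \<eta>(1) _ elim(2), of k] \<eta>
      unfolding P1_def[symmetric] P2_def[symmetric] F_def by (simp add: case_prod_beta)
    also have "\<dots> = ((C + F) + (C / real D) * harm (N T)) * T" by (simp add: algebra_simps)
    finally have "(\<Sum>p\<in>level k (N T) - exact k (N T). norm (summand T p)) / (T * ln T)
        \<le> ((C + F) + (C / real D) * harm (N T)) * T / (T * ln T)"
      using T' lnT by (intro divide_right_mono) auto
    also have "\<dots> < e" using elim T' by simp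
    finally show ?case using T' lnT by (simp add: sum_nonneg)
  qed
qed

lemma level_limit:
  "((\<lambda>T. (\<Sum>p\<in>level k (N T). summand T p) / of_real (T * ln T))
     \<longlongrightarrow> of_real (G k) * cis (- (\<beta> * (real k / a))) * \<kappa> k) at_top"
proof -
  have 1: "((\<lambda>T. (\<Sum>p\<in>level k (N T) - exact k (N T). summand T p) / of_real (T * ln T)) \<longlongrightarrow> 0) at_top"
  proof (rule Lim_null_comparison[OF _ level_inexact_limit[of k]])
    show "\<forall>\<^sub>F T in at_top. norm ((\<Sum>p\<in>level k (N T) - exact k (N T). summand T p) / of_real (T * ln T))
        \<le> (\<Sum>p\<in>level k (N T) - exact k (N T). norm (summand T p)) / (T * ln T)"
      using eventually_ge_at_top[of 2]
    proof eventually_elim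
      case (elim T)
      then have "T * ln T > 0" by simp
      then show ?case unfolding norm_divide norm_of_real
        by (auto intro!: divide_right_mono norm_sum)
    qed
  qed
  have "((\<lambda>T. of_real (exact_sum (exp (real k / a)) (N T) / ln T) * cis (- (\<beta> * (real k / a)))
      * (K T (real k / a) / of_real T)) \<longlongrightarrow> of_real (G k) * cis (- (\<beta> * (real k / a))) * \<kappa> k) at_top"
    by (intro tendsto_intros G_lim K_lim)
  then have 2: "((\<lambda>T. (\<Sum>p\<in>exact k (N T). summand T p) / of_real (T * ln T))
     \<longlongrightarrow> of_real (G k) * cis (- (\<beta> * (real k / a))) * \<kappa> k) at_top"
    unfolding exact_level_sum by (simp add: mult_ac)
  have "(\<Sum>p\<in>level k (N T). summand T p) = (\<Sum>p\<in>level k (N T) - exact k (N T). summand T p) + (\<Sum>p\<in>exact k (N T). summand T p)" for T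
    by (rule sum.subset_diff[OF exact_subset_level finite_level])
  then show ?thesis using tendsto_add[OF 1 2] by (simp add: add_divide_distrib)
qed

text \<open>Tannery's theorem exchanges the limit in T with the sum over levels; for each T only
  finitely many levels are inhabited.\<close>

lemma pair_sum_limit:
  "((\<lambda>T. (\<Sum>p\<in>pairs (N T). summand T p) / of_real (T * ln T))
     \<longlongrightarrow> (\<Sum>k. of_real (G k) * cis (- (\<beta> * (real k / a))) * \<kappa> k)) at_top"
proof -
  define b where "b k = of_real (G k) * cis (- (\<beta> * (real k / a))) * \<kappa> k" for k
  define Q where "Q k T = (\<Sum>p\<in>level k (N T). summand T p) / of_real (T * ln T)" for k T
  \<comment> \<open>The 12 is the 6 of \<open>level_sum_bound\<close> times 2, an eventual bound for
    harm (N T) / ln T.\<close>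
  define M where "M k = 12 * C2 * exp (1 / (4 * a)) * exp (- (1 / (2 * a))) ^ k" for k :: nat
  have "\<forall>\<^sub>F T in at_top. harm (N T) / ln T < 2"
    by (rule order_tendstoD[OF harm_N]) simp
  then have ev: "\<forall>\<^sub>F T in at_top. \<forall>k. norm (Q k T) \<le> M k"
    using eventually_ge_at_top[of T0]
  proof eventually_elim
    case (elim T)
    have T: "T \<ge> 2" using elim T0 by simp
    then have lnT: "ln T > 0" by simp
    show ?case
    proof
      fix k
      have "norm (Q k T) = norm (\<Sum>p\<in>level k (N T). summand T p) / (T * ln T)"
        unfolding Q_def norm_divide norm_of_real using T lnT by simp
      also have "\<dots> \<le> (\<Sum>p\<in>level k (N T). norm (summand T p)) / (T * ln T)"
        using T lnT by (intro divide_right_mono norm_sum) auto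
      also have "\<dots> \<le> (6 * C2 * exp (1 / (4 * a)) * exp (- (1 / (2 * a))) ^ k * harm (N T) * T) / (T * ln T)"
        using T lnT elim by (intro divide_right_mono level_sum_bound) auto
      also have "\<dots> = (6 * C2 * exp (1 / (4 * a)) * exp (- (1 / (2 * a))) ^ k) * (harm (N T) / ln T)"
        using T by simp
      also have "\<dots> \<le> (6 * C2 * exp (1 / (4 * a)) * exp (- (1 / (2 * a))) ^ k) * 2"
        using elim C2_nonneg by (intro mult_left_mono) auto
      also have "\<dots> = M k" by (simp add: M_def)
      finally show "norm (Q k T) \<le> M k" .
    qed
  qed
  have "exp (- (1 / (2 * a))) < 1" using a by simp
  then have sM: "summable M" unfolding M_def by (intro summable_mult summable_geometric) auto
  \<comment> \<open>One threshold for T serves all k, so the predicate for k in the product filter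
    is \<open>True\<close>.\<close>
  have bound: "\<forall>\<^sub>F (k, T) in at_top \<times>\<^sub>F at_top. norm (Q k T) \<le> M k"
    unfolding eventually_prod_filter case_prod_conv
    by (rule exI[of _ "\<lambda>_. True"], rule exI[of _ "\<lambda>T. \<forall>k. norm (Q k T) \<le> M k"]) (use ev in auto)
  have lim: "((\<lambda>T. Q k T) \<longlongrightarrow> b k) at_top" for k
    unfolding Q_def b_def by (rule level_limit)
  have *: "((\<lambda>T. \<Sum>k. Q k T) \<longlongrightarrow> suminf b) at_top"
    using tannerys_theorem[of Q b at_top M, OF lim bound sM] by simp
  have "(\<Sum>k. Q k T) = (\<Sum>p\<in>pairs (N T). summand T p) / of_real (T * ln T)" for T
  proof -
    define I where "I = idx ` pairs (N T)"
    have finI: "finite I" unfolding I_def using finite_pairs by simp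
    have "(\<Sum>k. Q k T) = (\<Sum>k\<in>I. Q k T)"
    proof (rule suminf_finite[OF finI])
      fix k assume "k \<notin> I"
      then have "level k (N T) = {}" by (auto simp: level_def I_def)
      then show "Q k T = 0" by (simp add: Q_def)
    qed
    also have "\<dots> = (\<Sum>k\<in>I. \<Sum>p\<in>level k (N T). summand T p) / of_real (T * ln T)"
      unfolding Q_def by (simp only: sum_divide_distrib)
    also have "(\<Sum>k\<in>I. \<Sum>p\<in>level k (N T). summand T p) = (\<Sum>p\<in>pairs (N T). summand T p)"
      unfolding level_def by (rule sum.group[OF finite_pairs finI]) (simp add: I_def)
    finally show ?thesis .
  qed
  then show ?thesis using * unfolding b_def by simp
qed

end

subsection \<open>Kernels of a bump function\<close>

text \<open>On |x| <= pi / 2 <= 1.6 the cubic Taylor remainder |x|^3 / 6 is at most |x| / 2.\<close>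

lemma abs_sin_ge_half:
  assumes "\<bar>x\<bar> \<le> pi / 2" shows "\<bar>x\<bar> / 2 \<le> \<bar>sin x\<bar>"
proof -
  have "\<bar>x\<bar> \<le> 1.6" using assms pi_less_4 pi_approx by simp
  then have "\<bar>x\<bar>\<^sup>2 \<le> 1.6\<^sup>2" by (intro power_mono) auto
  then have "\<bar>x\<bar>\<^sup>2 \<le> 3" by (simp add: power2_eq_square)
  have "\<bar>sin x - x\<bar> \<le> inverse (fact 3) * \<bar>x\<bar> ^ 3"
    using Maclaurin_sin_bound[of x 3] by (simp add: sin_coeff_def eval_nat_numeral)
  also have "\<dots> = \<bar>x\<bar> * (\<bar>x\<bar>\<^sup>2 / 6)" by (simp add: fact_numeral power3_eq_cube power2_eq_square)
  also have "\<dots> \<le> \<bar>x\<bar> * (1 / 2)" using \<open>\<bar>x\<bar>\<^sup>2 \<le> 3\<close> by (intro mult_left_mono) auto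
  finally show ?thesis by linarith
qed

text \<open>With \<theta> the signed distance of a x from the nearest integer, the right side is 2
  |sin (pi \<theta>)| >= pi |\<theta>|.\<close>

lemma norm_one_minus_cis_ge:
  assumes "\<alpha> > 0" and a: "a = \<alpha> / (2 * pi)"
  shows "\<bar>a * x - of_int (round (a * x))\<bar> \<le> norm (1 - cis (- (\<alpha> * x)))"
proof -
  define k where "k = round (a * x)"
  define \<theta> where "\<theta> = a * x - of_int k"
  have \<theta>: "\<bar>\<theta>\<bar> \<le> 1 / 2" using of_int_round_abs_le[of "a * x"] by (simp add: \<theta>_def k_def abs_minus_commute)
  have "- (\<alpha> * x) = - (2 * pi * \<theta>) + 2 * pi * (- of_int k)"
    unfolding \<theta>_def a by (simp add: field_simps)
  then have "cis (- (\<alpha> * x)) = cis (- (2 * pi * \<theta>)) * cis (2 * pi * (- of_int k))"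
    by (simp only: cis_mult)
  also have "cis (2 * pi * (- of_int k)) = 1" by (rule cis_multiple_2pi) auto
  finally have "norm (1 - cis (- (\<alpha> * x))) = norm (exp (\<i> * of_real (- (2 * pi * \<theta>))) - 1)"
    by (simp add: cis_conv_exp norm_minus_commute)
  also have "\<dots> = 2 * \<bar>sin (- (2 * pi * \<theta>) / 2)\<bar>"
    using dist_exp_i_1[of "- (2 * pi * \<theta>)"] by (simp only: dist_norm)
  also have "\<dots> \<ge> 2 * (\<bar>- (2 * pi * \<theta>) / 2\<bar> / 2)"
    using \<theta> by (intro mult_left_mono abs_sin_ge_half) (auto simp: abs_mult)
  finally have "pi * \<bar>\<theta>\<bar> \<le> norm (1 - cis (- (\<alpha> * x)))" by (simp add: abs_mult)
  moreover have "1 * \<bar>\<theta>\<bar> \<le> pi * \<bar>\<theta>\<bar>" using pi_ge_two by (intro mult_right_mono) auto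
  ultimately show ?thesis by (simp add: \<theta>_def k_def)
qed

text \<open>Two bounded derivatives give kernels decaying like the inverse square of the distance;
  \<open>z0\<close> and \<open>z1\<close> remove the boundary terms.\<close>

locale bump =
  fixes \<phi> \<phi>1 \<phi>2 :: "real \<Rightarrow> real" and B :: real
  assumes d1: "\<And>x. (\<phi> has_real_derivative \<phi>1 x) (at x)"
    and d2: "\<And>x. (\<phi>1 has_real_derivative \<phi>2 x) (at x)"
    and bd0: "\<And>x. \<bar>\<phi> x\<bar> \<le> B" and bd1: "\<And>x. \<bar>\<phi>1 x\<bar> \<le> B" and bd2: "\<And>x. \<bar>\<phi>2 x\<bar> \<le> B"
    and z0: "\<And>x. x \<notin> {1..2} \<Longrightarrow> \<phi> x = 0" and z1: "\<And>x. x \<notin> {1..2} \<Longrightarrow> \<phi>1 x = 0"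
begin

lemma B_nonneg: "B \<ge> 0" using bd0[of 0] by linarith

lemma cont0: "continuous_on A \<phi>"
  using d1 by (meson DERIV_isCont continuous_at_imp_continuous_on)

lemma lipschitz: "\<bar>\<phi> x - \<phi> y\<bar> \<le> B * \<bar>x - y\<bar>"
proof -
  have *: "\<bar>\<phi> y - \<phi> x\<bar> \<le> B * (y - x)" if xy: "x < y" for x y
  proof -
    obtain z where z: "\<phi> y - \<phi> x = (y - x) * \<phi>1 z"
      using MVT2[OF xy, of \<phi> \<phi>1] d1 by auto
    then have "\<bar>\<phi> y - \<phi> x\<bar> = (y - x) * \<bar>\<phi>1 z\<bar>" using xy by (simp add: abs_mult)
    also have "\<dots> \<le> (y - x) * B" using xy bd1 by (intro mult_left_mono) auto
    finally show ?thesis by (simp add: mult.commute)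
  qed
  show ?thesis using *[of x y] *[of y x] by (cases x y rule: linorder_cases) (auto simp: abs_minus_commute)
qed

lemma second_difference:
  assumes h: "h > 0"
  shows "\<bar>\<phi> (u + 2 * h) - 2 * \<phi> (u + h) + \<phi> u\<bar> \<le> B * h\<^sup>2"
proof -
  define \<psi> where "\<psi> s = \<phi> (s + h) - \<phi> s" for s
  have "DERIV \<psi> s :> \<phi>1 (s + h) - \<phi>1 s" for s
    unfolding \<psi>_def using DERIV_shift[of \<phi> "\<phi>1 (s + h)" s h] d1 by (intro DERIV_diff) auto
  then obtain s where s: "\<psi> (u + h) - \<psi> u = h * (\<phi>1 (s + h) - \<phi>1 s)"
    using MVT2[of u "u + h" \<psi> "\<lambda>s. \<phi>1 (s + h) - \<phi>1 s"] h by auto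
  obtain r where r: "\<phi>1 (s + h) - \<phi>1 s = h * \<phi>2 r"
    using MVT2[of s "s + h" \<phi>1 \<phi>2] d2 h by auto
  have "\<phi> (u + 2 * h) - 2 * \<phi> (u + h) + \<phi> u = \<psi> (u + h) - \<psi> u"
    by (simp add: \<psi>_def algebra_simps)
  also have "\<dots> = h\<^sup>2 * \<phi>2 r" unfolding s r by (simp add: power2_eq_square)
  finally have "\<bar>\<phi> (u + 2 * h) - 2 * \<phi> (u + h) + \<phi> u\<bar> = h\<^sup>2 * \<bar>\<phi>2 r\<bar>" by (simp add: abs_mult)
  also have "\<dots> \<le> h\<^sup>2 * B" using bd2 by (intro mult_left_mono) auto
  finally show ?thesis by (simp add: mult.commute)
qed

text \<open>The range l < \<open>len T\<close> passes the end 2T of the support, so \<phi> (l / T)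
  vanishes from l = \<open>len T\<close> on and sums can be shifted without loss.\<close>

definition len :: "real \<Rightarrow> nat" where "len T = nat \<lceil>2 * T\<rceil> + 2"

lemma len_bounds: "T \<ge> 2 \<Longrightarrow> real (len T) \<le> 4 * T" "T \<ge> 2 \<Longrightarrow> real (len T) \<ge> 2 * T + 2"
  unfolding len_def by linarith+

lemma phi_tail: "T \<ge> 2 \<Longrightarrow> l \<ge> len T \<Longrightarrow> \<phi> (real l / T) = 0"
proof (rule z0)
  assume T: "T \<ge> 2" "l \<ge> len T"
  then have "real l \<ge> 2 * T + 2" using len_bounds(2)[OF T(1)] by linarith
  then have "real l / T > 2" using T by (simp add: field_simps)
  then show "real l / T \<notin> {1..2}" by simp
qed

lemma phi_head: "T \<ge> 2 \<Longrightarrow> l \<le> 1 \<Longrightarrow> \<phi> (real l / T) = 0"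
proof (rule z0)
  assume T: "T \<ge> 2" "l \<le> 1"
  then have "real l < T" by linarith
  then show "real l / T \<notin> {1..2}" using T by simp
qed

section \<open>The kernel of the sum over l\<close>

definition disc_kernel :: "real \<Rightarrow> real \<Rightarrow> real \<Rightarrow> complex" where
  "disc_kernel \<alpha> T x = (\<Sum>l<len T. of_real (\<phi> (real l / T)) * cis (- (\<alpha> * real l * x)))"

lemma disc_kernel_trivial:
  assumes "T \<ge> 2" shows "norm (disc_kernel \<alpha> T x) \<le> 4 * B * T"
proof -
  have "norm (disc_kernel \<alpha> T x) \<le> real (card {..<len T}) * B"
    unfolding disc_kernel_def by (rule sum_norm_bound) (simp add: norm_mult bd0)
  also have "\<dots> \<le> (4 * T) * B" using len_bounds(1)[OF assms] B_nonneg by (intro mult_right_mono) auto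
  finally show ?thesis by (simp add: mult_ac)
qed

text \<open>Multiplying by (1 - z)^2 performs summation by parts twice: it replaces \<phi> (l / T)
  by its second difference, of size B / T^2. No boundary terms arise, as \<phi> (l / T) vanishes at
  l = 0, 1 and from \<open>len T\<close> on.\<close>

lemma disc_kernel_second_difference:
  assumes T: "T \<ge> 2"
  shows "norm (disc_kernel \<alpha> T x) * (norm (1 - cis (- (\<alpha> * x))))\<^sup>2 \<le> 4 * B / T"
proof -
  define z where "z = cis (- (\<alpha> * x))"
  define f where "f l = \<phi> (real l / T)" for l :: nat
  define h where "h l = of_real (f l) * z ^ l" for l
  define S where "S = (\<Sum>l<len T. h l)"
  have S: "disc_kernel \<alpha> T x = S"
    unfolding disc_kernel_def S_def h_def f_def z_def
    by (intro sum.cong refl) (simp add: Complex.DeMoivre mult_ac)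
  have shift: "(\<Sum>l<M. g (Suc l)) = (\<Sum>l<M. g l)" if "g 0 = 0" "g M = 0" for g :: "nat \<Rightarrow> complex" and M
    using sum.lessThan_Suc_shift[of g M] that by simp
  have f0: "f 0 = 0" "f 1 = 0" "f (len T) = 0" "f (len T + 1) = 0"
    unfolding f_def using phi_head[OF T, of 0] phi_head[OF T, of 1] phi_tail[OF T, of "len T"] phi_tail[OF T, of "len T + 1"]
    by simp_all
  have s1: "(\<Sum>l<len T. h (Suc l)) = S" unfolding S_def by (rule shift) (use f0 in \<open>auto simp: h_def\<close>)
  have s2: "(\<Sum>l<len T. h (Suc (Suc l))) = S"
    unfolding s1[symmetric] using f0 by (intro shift) (auto simp: h_def)
  have "(\<Sum>l<len T. of_real (f (Suc (Suc l)) - 2 * f (Suc l) + f l) * z ^ Suc (Suc l))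
      = (\<Sum>l<len T. h (Suc (Suc l)) - 2 * z * h (Suc l) + z\<^sup>2 * h l)"
    by (intro sum.cong refl) (simp add: h_def algebra_simps power2_eq_square)
  also have "\<dots> = S - 2 * z * S + z\<^sup>2 * S"
    by (simp only: sum.distrib sum_subtractf sum_distrib_left[symmetric] s1 s2 S_def[symmetric])
  also have "\<dots> = (1 - z)\<^sup>2 * S" by (simp add: power2_eq_square algebra_simps)
  finally have "norm ((1 - z)\<^sup>2 * S) = norm (\<Sum>l<len T. of_real (f (Suc (Suc l)) - 2 * f (Suc l) + f l) * z ^ Suc (Suc l))"
    by simp
  also have "\<dots> \<le> real (card {..<len T}) * (B * (1 / T)\<^sup>2)"
  proof (rule sum_norm_bound)
    fix l
    have "norm (of_real (f (Suc (Suc l)) - 2 * f (Suc l) + f l) * z ^ Suc (Suc l)) = \<bar>f (Suc (Suc l)) - 2 * f (Suc l) + f l\<bar>"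
      unfolding norm_mult norm_of_real norm_power by (simp add: z_def)
    also have "\<dots> = \<bar>\<phi> (real l / T + 2 * (1 / T)) - 2 * \<phi> (real l / T + 1 / T) + \<phi> (real l / T)\<bar>"
      by (simp add: f_def add_divide_distrib algebra_simps)
    also have "\<dots> \<le> B * (1 / T)\<^sup>2" using T by (intro second_difference) simp
    finally show "norm (of_real (f (Suc (Suc l)) - 2 * f (Suc l) + f l) * z ^ Suc (Suc l)) \<le> B * (1 / T)\<^sup>2" .
  qed
  also have "\<dots> \<le> (4 * T) * (B * (1 / T)\<^sup>2)"
    using len_bounds(1)[OF T] B_nonneg by (intro mult_right_mono) auto
  also have "\<dots> = 4 * B / T" using T by (simp add: power2_eq_square field_simps)
  finally show ?thesis unfolding S z_def[symmetric] by (simp add: norm_mult norm_power mult.commute)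
qed

lemma disc_kernel_decay:
  assumes T: "T \<ge> 2" and \<alpha>: "\<alpha> > 0" and a: "a = \<alpha> / (2 * pi)"
  shows "norm (disc_kernel \<alpha> T x) * T * (a * x - of_int (round (a * x)))\<^sup>2 \<le> 4 * B"
proof -
  have "(a * x - of_int (round (a * x)))\<^sup>2 \<le> (norm (1 - cis (- (\<alpha> * x))))\<^sup>2"
    using power_mono[OF norm_one_minus_cis_ge[OF \<alpha> a, of x], of 2] by simp
  then have "norm (disc_kernel \<alpha> T x) * T * (a * x - of_int (round (a * x)))\<^sup>2
      \<le> norm (disc_kernel \<alpha> T x) * T * (norm (1 - cis (- (\<alpha> * x))))\<^sup>2"
    using T by (intro mult_left_mono) auto
  also have "\<dots> = (norm (disc_kernel \<alpha> T x) * (norm (1 - cis (- (\<alpha> * x))))\<^sup>2) * T" by simp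
  also have "\<dots> \<le> (4 * B / T) * T"
    using T by (intro mult_right_mono disc_kernel_second_difference) auto
  finally show ?thesis using T by simp
qed

definition mass :: real where "mass = integral {1..2} \<phi>"

lemma has_integral_phi: "(\<phi> has_integral integral {u..v} \<phi>) {u..v}"
  by (intro integrable_integral integrable_continuous_real cont0)

lemma integral_phi:
  assumes "u \<le> 1" "v \<ge> 2" shows "integral {u..v} \<phi> = mass"
proof -
  have "(\<phi> has_integral mass) {u..v}"
    unfolding mass_def by (rule has_integral_on_superset[OF has_integral_phi]) (use assms z0 in auto)
  then show ?thesis by (rule integral_unique)
qed

lemma riemann_sum:
  assumes h: "h > 0"
  shows "\<bar>integral {0..real M * h} \<phi> - (\<Sum>l<M. \<phi> (real l * h) * h)\<bar> \<le> real M * (B * h\<^sup>2)"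
proof (induction M)
  case (Suc M)
  define u where "u = real M * h"
  have u: "real (Suc M) * h = u + h" "u \<ge> 0" unfolding u_def using h by (auto simp: algebra_simps)
  have "integral {0..u} \<phi> + integral {u..u + h} \<phi> = integral {0..u + h} \<phi>"
    using h u by (intro Henstock_Kurzweil_Integration.integral_combine integrable_continuous_real cont0) auto
  moreover have "\<bar>integral {u..u + h} \<phi> - \<phi> u * h\<bar> \<le> B * h\<^sup>2"
  proof -
    have "((\<lambda>x. \<phi> x - \<phi> u) has_integral (integral {u..u + h} \<phi> - \<phi> u * h)) {u..u + h}"
      using has_integral_diff[OF has_integral_phi[of u "u + h"] has_integral_const_real[of "\<phi> u" u "u + h"]] h
      by (simp add: mult.commute)
    moreover have "norm (\<phi> x - \<phi> u) \<le> B * h" if "x \<in> {u..u + h} - {}" for x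
    proof -
      have "\<bar>\<phi> x - \<phi> u\<bar> \<le> B * \<bar>x - u\<bar>" by (rule lipschitz)
      also have "\<dots> \<le> B * h" using that B_nonneg by (intro mult_left_mono) auto
      finally show ?thesis by simp
    qed
    ultimately show ?thesis
      using has_integral_bound_real[of "B * h" "{}" "\<lambda>x. \<phi> x - \<phi> u" _ u "u + h"] h B_nonneg
      by (simp add: power2_eq_square mult.assoc)
  qed
  moreover have "real (Suc M) * (B * h\<^sup>2) = real M * (B * h\<^sup>2) + B * h\<^sup>2" by (simp add: algebra_simps)
  ultimately show ?case using Suc unfolding u sum.lessThan_Suc u_def[symmetric] by linarith
qed simp

text \<open>At x = k / a the angle \<alpha> l x is 2 pi l k, so all terms are in phase: this is the
  resonance.\<close>

lemma disc_kernel_resonant: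
  assumes \<alpha>: "\<alpha> > 0" and a: "a = \<alpha> / (2 * pi)"
  shows "disc_kernel \<alpha> T (real k / a) = of_real (\<Sum>l<len T. \<phi> (real l / T))"
proof -
  have "cis (- (\<alpha> * real l * (real k / a))) = 1" for l
  proof -
    have "- (\<alpha> * real l * (real k / a)) = 2 * pi * (- (real l * real k))" unfolding a using \<alpha> by simp
    then show ?thesis by (simp only:) (rule cis_multiple_2pi, auto)
  qed
  then show ?thesis unfolding disc_kernel_def by simp
qed

lemma disc_mass_limit: "((\<lambda>T. (\<Sum>l<len T. \<phi> (real l / T)) / T) \<longlongrightarrow> mass) at_top"
proof -
  have "((\<lambda>T. (\<Sum>l<len T. \<phi> (real l / T)) / T - mass) \<longlongrightarrow> 0) at_top"
  proof (rule Lim_null_comparison)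
    show "((\<lambda>T. 4 * B / T) \<longlongrightarrow> 0) at_top" by real_asymp
    show "\<forall>\<^sub>F T in at_top. norm ((\<Sum>l<len T. \<phi> (real l / T)) / T - mass) \<le> 4 * B / T"
      using eventually_ge_at_top[of 2]
    proof eventually_elim
      case (elim T)
      have "real (len T) * (1 / T) \<ge> 2" using len_bounds(2)[OF elim] elim by (simp add: field_simps)
      then have "integral {0..real (len T) * (1 / T)} \<phi> = mass" by (intro integral_phi) auto
      then have "\<bar>(\<Sum>l<len T. \<phi> (real l / T)) / T - mass\<bar> \<le> real (len T) * (B * (1 / T)\<^sup>2)"
        using riemann_sum[of "1 / T" "len T"] elim by (simp add: sum_divide_distrib abs_minus_commute)
      also have "\<dots> \<le> (4 * T) * (B * (1 / T)\<^sup>2)"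
        using len_bounds(1)[OF elim] B_nonneg by (intro mult_right_mono) auto
      also have "\<dots> = 4 * B / T" using elim by (simp add: power2_eq_square field_simps)
      finally show ?case by simp
    qed
  qed
  then show ?thesis by (rule LIM_zero_cancel)
qed

lemma disc_kernel_limit:
  assumes \<alpha>: "\<alpha> > 0" and a: "a = \<alpha> / (2 * pi)"
  shows "((\<lambda>T. disc_kernel \<alpha> T (real k / a) / of_real T) \<longlongrightarrow> of_real mass) at_top"
  unfolding disc_kernel_resonant[OF assms] using tendsto_of_real[OF disc_mass_limit, where ?'a = complex] by (simp only: of_real_divide)

section \<open>The kernel of the integral over t\<close>

definition cont_kernel :: "real \<Rightarrow> real \<Rightarrow> real \<Rightarrow> complex" where
  "cont_kernel \<alpha> T x = integral {0..3 * T} (\<lambda>t. of_real (\<phi> (t / T)) * cis (- (\<alpha> * t * x)))"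

lemma continuous_on_phi_scaled: "continuous_on A (\<lambda>t. \<phi> (t / T))"
  unfolding divide_inverse by (rule continuous_on_compose2[OF cont0[of UNIV]]) (intro continuous_intros, auto)

lemma cont_kernel_has_integral:
  "((\<lambda>t. of_real (\<phi> (t / T)) * cis (- (\<alpha> * t * x))) has_integral cont_kernel \<alpha> T x) {0..3 * T}"
  unfolding cont_kernel_def
  by (intro integrable_integral integrable_continuous_real continuous_intros continuous_on_phi_scaled)

lemma cont_kernel_trivial:
  assumes "T \<ge> 2" shows "norm (cont_kernel \<alpha> T x) \<le> 4 * B * T"
proof -
  have "norm (cont_kernel \<alpha> T x) \<le> B * (3 * T)"
    using has_integral_bound_real[OF B_nonneg _ cont_kernel_has_integral, of "{}" T \<alpha> x] assms bd0
    by (simp add: norm_mult)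
  also have "\<dots> \<le> 4 * B * T" using assms B_nonneg by simp
  finally show ?thesis .
qed

text \<open>Two integrations by parts, packed into one antiderivative: the derivative of
  \<open>F\<close> is y^2 times the integrand of the kernel plus a term in \<open>\<phi>2\<close>,
  and \<open>F\<close> vanishes at 0 and 3T, outside the support.\<close>

lemma cont_kernel_two_parts:
  assumes T: "T \<ge> 2"
  shows "norm (cont_kernel \<alpha> T x) * (\<alpha> * x)\<^sup>2 \<le> 3 * B / T"
proof -
  define y where "y = \<alpha> * x"
  define F where "F t = cis (- (y * t)) * (\<i> * of_real (y * \<phi> (t / T)) + of_real (\<phi>1 (t / T) / T))" for t
  define f2 where "f2 t = cis (- (y * t)) * of_real (\<phi>2 (t / T) / T\<^sup>2)" for t
  have dcis: "((\<lambda>t. cis (- (y * t))) has_vector_derivative (- \<i> * of_real y * cis (- (y * t)))) (at t within S)" for t S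
  proof -
    have "((\<lambda>z. exp (- \<i> * of_real y * z)) has_field_derivative (- \<i> * of_real y * exp (- \<i> * of_real y * of_real t))) (at (of_real t))"
      by (auto intro!: derivative_eq_intros)
    from has_vector_derivative_real_field[OF this, of S] show ?thesis
      by (simp add: cis_conv_exp mult.assoc)
  qed
  have sc: "((\<lambda>t. t / T) has_real_derivative (1 / T)) (at t within S)" for t S
    using T by (auto intro!: derivative_eq_intros)
  have dphi: "((\<lambda>t. \<phi> (t / T)) has_real_derivative \<phi>1 (t / T) / T) (at t within S)" for t S
    using DERIV_chain2[OF d1[of "t / T"] sc[of t S]] by simp
  have dphi1: "((\<lambda>t. \<phi>1 (t / T)) has_real_derivative \<phi>2 (t / T) / T) (at t within S)" for t S
    using DERIV_chain2[OF d2[of "t / T"] sc[of t S]] by simp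
  have dF: "(F has_vector_derivative (of_real (y\<^sup>2) * (of_real (\<phi> (t / T)) * cis (- (\<alpha> * t * x))) + f2 t)) (at t within S)" for t S
  proof -
    have r: "((\<lambda>t. of_real (f t) :: complex) has_vector_derivative of_real f') (at t within S)"
      if "(f has_real_derivative f') (at t within S)" for f f'
      using that by (simp add: has_real_derivative_iff_has_vector_derivative has_vector_derivative_of_real)
    have 1: "((\<lambda>t. \<i> * of_real (y * \<phi> (t / T)) + of_real (\<phi>1 (t / T) / T)) has_vector_derivative
       (\<i> * of_real (y * (\<phi>1 (t / T) / T)) + of_real (\<phi>2 (t / T) / T / T))) (at t within S)"
      by (intro has_vector_derivative_add has_vector_derivative_mult_right r DERIV_cmult DERIV_cdivide dphi dphi1)
    have "(F has_vector_derivative (cis (- (y * t)) * (\<i> * of_real (y * (\<phi>1 (t / T) / T)) + of_real (\<phi>2 (t / T) / T / T))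
        + (- \<i> * of_real y * cis (- (y * t))) * (\<i> * of_real (y * \<phi> (t / T)) + of_real (\<phi>1 (t / T) / T)))) (at t within S)"
      unfolding F_def by (rule has_vector_derivative_mult[OF dcis 1])
    moreover have "cis (- (y * t)) * (\<i> * of_real (y * (\<phi>1 (t / T) / T)) + of_real (\<phi>2 (t / T) / T / T))
        + (- \<i> * of_real y * cis (- (y * t))) * (\<i> * of_real (y * \<phi> (t / T)) + of_real (\<phi>1 (t / T) / T))
        = of_real (y\<^sup>2) * (of_real (\<phi> (t / T)) * cis (- (\<alpha> * t * x))) + f2 t"
      by (simp add: f2_def y_def power2_eq_square algebra_simps)
    ultimately show ?thesis by simp
  qed
  have "((\<lambda>t. of_real (y\<^sup>2) * (of_real (\<phi> (t / T)) * cis (- (\<alpha> * t * x))) + f2 t) has_integral (F (3 * T) - F 0)) {0..3 * T}"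
    using T by (intro fundamental_theorem_of_calculus dF) auto
  moreover have "F (3 * T) = 0" "F 0 = 0"
    using T z0[of 3] z1[of 3] z0[of 0] z1[of 0] by (simp_all add: F_def)
  ultimately have *: "((\<lambda>t. of_real (y\<^sup>2) * (of_real (\<phi> (t / T)) * cis (- (\<alpha> * t * x))) + f2 t) has_integral 0) {0..3 * T}"
    by simp
  have "(f2 has_integral (0 - of_real (y\<^sup>2) * cont_kernel \<alpha> T x)) {0..3 * T}"
    using has_integral_diff[OF * has_integral_mult_right[OF cont_kernel_has_integral[of T \<alpha> x], of "of_real (y\<^sup>2)"]] by simp
  moreover have "norm (f2 t) \<le> B / T\<^sup>2" for t
    unfolding f2_def using bd2[of "t / T"] T by (simp add: norm_mult norm_divide divide_right_mono norm_power)
  ultimately have "norm (0 - of_real (y\<^sup>2) * cont_kernel \<alpha> T x) \<le> (B / T\<^sup>2) * (3 * T)"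
    using has_integral_bound_real[of "B / T\<^sup>2" "{}" f2 "0 - of_real (y\<^sup>2) * cont_kernel \<alpha> T x" 0 "3 * T"] B_nonneg T by simp
  also have "\<dots> = 3 * B / T" using T by (simp add: power2_eq_square)
  finally show ?thesis by (simp add: y_def norm_mult norm_power power_mult_distrib mult.commute)
qed

text \<open>This kernel peaks only at x = 0, but the distance of a x from the nearest integer is at
  most |a x|, so the hypothesis shaped for the discrete kernel holds for it too.\<close>

lemma cont_kernel_decay:
  assumes T: "T \<ge> 2" and \<alpha>: "\<alpha> > 0" and a: "a = \<alpha> / (2 * pi)"
  shows "norm (cont_kernel \<alpha> T x) * T * (a * x - of_int (round (a * x)))\<^sup>2 \<le> 4 * B"
proof -
  have "\<bar>a * x - of_int (round (a * x))\<bar> \<le> \<bar>a * x - of_int 0\<bar>" by (rule round_diff_minimal)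
  also have "\<dots> = \<bar>\<alpha> * x\<bar> / (2 * pi)" unfolding a by (simp add: abs_mult)
  also have "\<dots> \<le> \<bar>\<alpha> * x\<bar> / 1" using pi_ge_two by (intro divide_left_mono) auto
  finally have "(a * x - of_int (round (a * x)))\<^sup>2 \<le> (\<alpha> * x)\<^sup>2" by (simp add: abs_le_square_iff)
  then have "norm (cont_kernel \<alpha> T x) * T * (a * x - of_int (round (a * x)))\<^sup>2
      \<le> norm (cont_kernel \<alpha> T x) * T * (\<alpha> * x)\<^sup>2"
    using T by (intro mult_left_mono) auto
  also have "\<dots> = (norm (cont_kernel \<alpha> T x) * (\<alpha> * x)\<^sup>2) * T" by simp
  also have "\<dots> \<le> (3 * B / T) * T"
    using T by (intro mult_right_mono cont_kernel_two_parts) auto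
  finally show ?thesis using T B_nonneg by simp
qed

lemma cont_kernel_0: "T > 0 \<Longrightarrow> cont_kernel \<alpha> T 0 = of_real (T * mass)"
proof -
  assume T: "T > 0"
  have "(\<phi> has_integral mass) {0..3}" using has_integral_phi[of 0 3] integral_phi[of 0 3] by simp
  from has_integral_stretch_real[OF this, of "1 / T"]
  have "((\<lambda>t. \<phi> (t / T)) has_integral (T * mass)) ((\<lambda>x. x * T) ` {0..3})" using T by simp
  also have "(\<lambda>x. x * T) ` {0..3} = {0..3 * T}" using T by (simp add: image_mult_atLeastAtMost_if' mult.commute)
  finally have "((\<lambda>t. \<phi> (t / T)) has_integral (T * mass)) {0..3 * T}" .
  from has_integral_linear[OF this bounded_linear_of_real[where ?'a = complex]]
  have "((\<lambda>t. of_real (\<phi> (t / T)) * cis (- (\<alpha> * t * 0))) has_integral of_real (T * mass)) {0..3 * T}"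
    by (simp add: o_def)
  then show ?thesis using cont_kernel_has_integral has_integral_unique by blast
qed

text \<open>For k > 0 the kernel at k / a is O(1 / T), so only k = 0 survives, where n < m excludes
  exact pairs. This is how they drop out of the integral.\<close>

lemma cont_kernel_limit:
  assumes \<alpha>: "\<alpha> > 0" and a: "a > 0"
  shows "((\<lambda>T. cont_kernel \<alpha> T (real k / a) / of_real T) \<longlongrightarrow> (if k = 0 then of_real mass else 0)) at_top"
proof (cases "k = 0")
  case True
  have "\<forall>\<^sub>F T in at_top. cont_kernel \<alpha> T (real k / a) / of_real T = (if k = 0 then of_real mass else 0)"
    using eventually_gt_at_top[of 0] by eventually_elim (simp add: True cont_kernel_0)
  then show ?thesis by (rule tendsto_eventually)
next
  case False
  define y where "y = (\<alpha> * (real k / a))\<^sup>2"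
  have y: "y > 0" unfolding y_def using False assms by simp
  have "((\<lambda>T. cont_kernel \<alpha> T (real k / a) / of_real T) \<longlongrightarrow> 0) at_top"
  proof (rule Lim_null_comparison)
    show "((\<lambda>T. (3 * B / y) / T\<^sup>2) \<longlongrightarrow> 0) at_top" by real_asymp
    show "\<forall>\<^sub>F T in at_top. norm (cont_kernel \<alpha> T (real k / a) / of_real T) \<le> (3 * B / y) / T\<^sup>2"
      using eventually_ge_at_top[of 2]
    proof eventually_elim
      case (elim T)
      have "norm (cont_kernel \<alpha> T (real k / a)) \<le> 3 * B / T / y"
        using cont_kernel_two_parts[OF elim, of \<alpha> "real k / a"] y
        unfolding y_def[symmetric] by (simp only: pos_le_divide_eq)
      then have "norm (cont_kernel \<alpha> T (real k / a)) / T \<le> 3 * B / T / y / T"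
        using elim by (intro divide_right_mono) auto
      then show ?case using elim by (simp add: norm_divide power2_eq_square mult_ac)
    qed
  qed
  then show ?thesis using False by simp
qed

lemma mass_pos:
  assumes "\<And>x. \<phi> x \<ge> 0" "\<phi> x0 \<noteq> 0"
  shows "mass > 0"
proof -
  have x0: "x0 \<in> {1..2}" using assms z0 by blast
  have "mass \<ge> 0" unfolding mass_def by (intro integral_nonneg integrable_continuous_real cont0 assms)
  moreover have "mass \<noteq> 0"
    unfolding mass_def using integral_eq_0_iff[of 1 2 \<phi>] cont0 assms x0 by auto
  ultimately show ?thesis by simp
qed

end

subsection \<open>The coefficients of the resonances\<close>

text \<open>On the open complement of [1, 2] the function is locally zero, so all derivatives vanish
  there; on [1, 2] compactness bounds them.\<close>

lemma smooth_real_imp_bump: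
  assumes "smooth_real \<phi>" "supp_real \<phi> \<subseteq> {1..2}"
  obtains B where "bump \<phi> (deriv \<phi>) (deriv (deriv \<phi>)) B"
proof -
  have D: "((deriv ^^ k) \<phi> has_real_derivative deriv ((deriv ^^ k) \<phi>) x) (at x)" for k x
    using assms(1) by (simp add: smooth_real_def DERIV_deriv_iff_real_differentiable)
  have z: "(deriv ^^ k) \<phi> x = 0" if "x \<notin> {1..2}" for k x
    using that
  proof (induction k arbitrary: x)
    case 0
    then have "x \<notin> supp_real \<phi>" using assms(2) by blast
    then have "x \<notin> {x. \<phi> x \<noteq> 0}" unfolding supp_real_def using closure_subset[of "{x. \<phi> x \<noteq> 0}"] by auto
    then show ?case by simp
  next
    case (Suc k)
    have "open (- {1..2::real})" by (simp add: open_Compl)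
    then have "\<forall>\<^sub>F u in nhds x. u \<in> - {1..2}" using Suc.prems by (intro eventually_nhds_in_open) auto
    then have "\<forall>\<^sub>F u in nhds x. (deriv ^^ k) \<phi> u = 0" by eventually_elim (simp add: Suc.IH)
    then have "deriv ((deriv ^^ k) \<phi>) x = deriv (\<lambda>_. 0) x" by (rule deriv_cong_ev) simp
    then show ?case by simp
  qed
  have c: "continuous_on A ((deriv ^^ k) \<phi>)" for k A
    using D by (meson DERIV_isCont continuous_at_imp_continuous_on)
  have "\<exists>B. \<forall>x. \<bar>(deriv ^^ k) \<phi> x\<bar> \<le> B" for k
  proof -
    have "bounded ((deriv ^^ k) \<phi> ` {1..2})"
      by (intro compact_imp_bounded compact_continuous_image c) simp
    then obtain B where "\<forall>y\<in>(deriv ^^ k) \<phi> ` {1..2}. norm y \<le> B"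
      unfolding bounded_iff by blast
    then have B: "\<bar>(deriv ^^ k) \<phi> x\<bar> \<le> B" if "x \<in> {1..2}" for x using that by simp
    have "\<bar>(deriv ^^ k) \<phi> x\<bar> \<le> \<bar>B\<bar>" for x
      using B[of x] z[of x k] by (cases "x \<in> {1..2}") auto
    then show ?thesis by blast
  qed
  then obtain b where b: "\<And>k x. \<bar>(deriv ^^ k) \<phi> x\<bar> \<le> b k" by metis
  define B where "B = max (b 0) (max (b 1) (b 2))"
  have "bump \<phi> (deriv \<phi>) (deriv (deriv \<phi>)) B"
  proof
    show "\<bar>\<phi> x\<bar> \<le> B" "\<bar>deriv \<phi> x\<bar> \<le> B" "\<bar>deriv (deriv \<phi>) x\<bar> \<le> B" for x
      using b[of 0 x] b[of 1 x] b[of 2 x] by (auto simp: B_def eval_nat_numeral le_max_iff_disj)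
    show "(\<phi> has_real_derivative deriv \<phi> x) (at x)" "(deriv \<phi> has_real_derivative deriv (deriv \<phi>) x) (at x)" for x
      using D[of 0 x] D[of 1 x] by simp_all
    show "\<phi> x = 0" "deriv \<phi> x = 0" if "x \<notin> {1..2}" for x using z[OF that, of 0] z[OF that, of 1] by simp_all
  qed
  then show ?thesis by (rule that)
qed

section \<open>Harmonic sums and the density of exact pairs\<close>

lemma harm_over_ln_limit:
  fixes M :: "real \<Rightarrow> nat"
  assumes c: "c1 > 0" "c2 > 0" and ev: "\<forall>\<^sub>F T in at_top. c1 * T \<le> real (M T) \<and> real (M T) \<le> c2 * T"
  shows "((\<lambda>T. harm (M T) / ln T) \<longlongrightarrow> 1) at_top"
proof -
  have "filterlim (\<lambda>T. real (M T)) at_top at_top"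
  proof (rule filterlim_at_top_mono)
    show "filterlim (\<lambda>T. c1 * T) at_top at_top" using c by real_asymp
    show "\<forall>\<^sub>F T in at_top. c1 * T \<le> real (M T)" using ev by eventually_elim simp
  qed
  then have "filterlim M at_top at_top"
    by (simp add: filterlim_at_top_mono filterlim_sequentially_iff_filterlim_real)
  from filterlim_compose[OF euler_mascheroni_LIMSEQ this]
  have g: "((\<lambda>T. harm (M T) - ln (real (M T))) \<longlongrightarrow> (euler_mascheroni :: real)) at_top" by simp
  have l: "((\<lambda>T. ln (real (M T)) / ln T) \<longlongrightarrow> 1) at_top"
  proof (rule tendsto_sandwich)
    show "((\<lambda>T. ln (c1 * T) / ln T) \<longlongrightarrow> 1) at_top" "((\<lambda>T. ln (c2 * T) / ln T) \<longlongrightarrow> 1) at_top"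
      using c by real_asymp+
    show "\<forall>\<^sub>F T in at_top. ln (c1 * T) / ln T \<le> ln (real (M T)) / ln T"
      using ev eventually_ge_at_top[of 2]
    proof eventually_elim
      case (elim T)
      have "0 < c1 * T" using c elim by simp
      then show ?case using elim by (intro divide_right_mono) auto
    qed
    show "\<forall>\<^sub>F T in at_top. ln (real (M T)) / ln T \<le> ln (c2 * T) / ln T"
      using ev eventually_ge_at_top[of 2]
    proof eventually_elim
      case (elim T)
      have "0 < c1 * T" using c elim by simp
      then show ?case using elim by (intro divide_right_mono) auto
    qed
  qed
  have "((\<lambda>T::real. 1 / ln T) \<longlongrightarrow> 0) at_top" by real_asymp
  from tendsto_add[OF tendsto_mult[OF g this] l]
  show ?thesis by (simp add: diff_divide_distrib)
qed

lemma exact_sum_limit_rational: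
  assumes pq: "coprime p q" "q > 0" "q < p" and r: "r = real p / real q" and \<gamma>: "\<gamma> > 0"
  shows "((\<lambda>T. exact_sum r (nat \<lceil>\<gamma> * T\<rceil>) / ln T) \<longlongrightarrow> 1 / sqrt (real p * real q)) at_top"
proof -
  have p: "real p > 0" using pq by simp
  have "((\<lambda>T. harm (nat \<lceil>\<gamma> * T\<rceil> div p) / ln T) \<longlongrightarrow> (1::real)) at_top"
  \<comment> \<open>Halving the slope \<gamma> / p absorbs the loss of at most 1 in
    \<open>div p\<close>; the extra 1 in the upper slope absorbs the rounding up.\<close>
  proof (rule harm_over_ln_limit[of "\<gamma> / (2 * real p)" "\<gamma> + 1"])
    have "\<forall>\<^sub>F T in at_top. \<gamma> / (2 * real p) * T \<ge> 1" using p \<gamma> by real_asymp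
    then show "\<forall>\<^sub>F T in at_top. \<gamma> / (2 * real p) * T \<le> real (nat \<lceil>\<gamma> * T\<rceil> div p) \<and> real (nat \<lceil>\<gamma> * T\<rceil> div p) \<le> (\<gamma> + 1) * T"
      using eventually_ge_at_top[of 1]
    proof eventually_elim
      case (elim T)
      define n where "n = nat \<lceil>\<gamma> * T\<rceil>"
      have gT: "\<gamma> * T > 0" using \<gamma> elim by simp
      have n: "\<gamma> * T \<le> real n" "real n \<le> \<gamma> * T + 1" unfolding n_def using gT by linarith+
      have "n < p * (n div p) + p" using pq by (simp add: dividend_less_times_div add.commute)
      then have "real n < real (p * (n div p) + p)" by (rule of_nat_less_iff[THEN iffD2])
      then have "\<gamma> * T \<le> (real (n div p) + 1) * real p" using n by (simp add: algebra_simps)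
      then have "\<gamma> * T / real p \<le> real (n div p) + 1" using p by (simp only: pos_divide_le_eq)
      moreover have "\<gamma> * T / real p = \<gamma> / (2 * real p) * T + \<gamma> / (2 * real p) * T" by (simp add: field_simps)
      ultimately have 1: "\<gamma> / (2 * real p) * T \<le> real (n div p)" using elim by linarith
      have "real (n div p) \<le> real n" by simp
      also have "\<dots> \<le> (\<gamma> + 1) * T" using n elim by (simp add: algebra_simps)
      finally show ?case using 1 unfolding n_def by simp
    qed
  qed (use p \<gamma> in auto)
  from tendsto_divide[OF this tendsto_const[of "sqrt (real p * real q)"]]
  show ?thesis unfolding exact_sum_rational[OF pq r] using pq by (simp add: mult.commute)
qed

text \<open>The definition of \<open>delta\<close> recast over natural p, q. If exp (2 pi l /
  \<alpha>) is rational, so is the same expression at l mod l0, and leastness of l0 forces this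
  remainder to be 0; hence l0 divides l.\<close>

lemma delta_cases:
  fixes \<alpha> \<beta> :: real
  assumes \<alpha>: "\<alpha> > 0"
  obtains (irrational) "\<And>l::nat. l > 0 \<Longrightarrow> exp (2 * pi * real l / \<alpha>) \<notin> \<rat>" "delta \<alpha> \<beta> = 0"
  | (rational) l0 p q :: nat where "l0 > 0" "coprime p q" "q > 0" "q < p"
      "exp (2 * pi * real l0 / \<alpha>) = real p / real q"
      "\<And>l. exp (2 * pi * real l / \<alpha>) \<in> \<rat> \<Longrightarrow> l0 dvd l"
      "delta \<alpha> \<beta> = (2 * cos (\<beta> * ln (real p / real q)) * sqrt (real p * real q) - 2)
         / (real p * real q + 1 - 2 * sqrt (real p * real q) * cos (\<beta> * ln (real p / real q)))"
proof (cases "\<forall>l::nat. l > 0 \<longrightarrow> exp (2 * pi * real l / \<alpha>) \<notin> \<rat>")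
  case True
  then show ?thesis by (intro irrational) (auto simp: delta_def)
next
  case False
  define e where "e l = exp (2 * pi * real l / \<alpha>)" for l :: nat
  define l0 where "l0 = (LEAST l::nat. l > 0 \<and> e l \<in> \<rat>)"
  define r where "r = (THE r::rat. of_rat r = e l0)"
  define m where "m = fst (quotient_of r)"
  define n where "n = snd (quotient_of r)"
  have "\<exists>l. l > 0 \<and> e l \<in> \<rat>" using False by (auto simp: e_def)
  then have l0: "l0 > 0" "e l0 \<in> \<rat>" unfolding l0_def using LeastI_ex[of "\<lambda>l. l > 0 \<and> e l \<in> \<rat>"] by auto
  have least: "l0 \<le> l" if "l > 0" "e l \<in> \<rat>" for l unfolding l0_def using that by (intro Least_le) auto
  have add: "e (k + l) = e k * e l" for k l by (simp add: e_def exp_add[symmetric] add_divide_distrib distrib_left)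
  have mult: "e (k * l) = e k ^ l" for k l
    unfolding e_def by (simp add: exp_of_nat_mult[symmetric] mult_ac)
  have dvd: "l0 dvd l" if "e l \<in> \<rat>" for l
  proof (rule ccontr)
    assume "\<not> l0 dvd l"
    then have pos: "l mod l0 > 0" by (simp add: dvd_eq_mod_eq_0)
    have "e l = e (l0 * (l div l0)) * e (l mod l0)" by (simp flip: add)
    moreover have "e (l0 * (l div l0)) \<noteq> 0" by (simp add: e_def)
    ultimately have "e (l mod l0) = e l / e l0 ^ (l div l0)" by (simp add: mult field_simps)
    then have "e (l mod l0) \<in> \<rat>" using that l0 by (simp add: Rats_divide Rats_power)
    then have "l0 \<le> l mod l0" using pos by (intro least)
    then show False using l0 by (metis mod_less_divisor not_le)
  qed
  obtain r' :: rat where r': "e l0 = of_rat r'" using l0 by (auto elim: Rats_cases)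
  \<comment> \<open>\<open>of_rat\<close> is injective, so the description by \<open>THE\<close>
    picks the intended rational.\<close>
  have r: "of_rat r = e l0" unfolding r_def
    by (rule theI[of _ r']) (auto simp: r' of_rat_eq_iff)
  have q: "quotient_of r = (m, n)" by (simp add: m_def n_def)
  have n0: "n > 0" using quotient_of_denom_pos[OF q] .
  have cop: "coprime m n" using quotient_of_coprime[OF q] .
  have "r = of_int m / of_int n" using quotient_of_div[OF q] .
  then have el: "e l0 = of_int m / of_int n" unfolding r[symmetric] by (simp add: of_rat_divide)
  have "e l0 > 1" unfolding e_def using l0 \<alpha> by simp
  then have mn: "n < m" using el n0 by (simp add: less_divide_eq)
  have nat: "real (nat m) = of_int m" "real (nat n) = of_int n" using n0 mn by auto
  show ?thesis
  proof (rule rational[of l0 "nat m" "nat n"])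
    show "l0 > 0" by fact
    show "coprime (nat m) (nat n)" using cop n0 mn by (simp add: coprime_int_iff[symmetric])
    show "nat n > 0" "nat n < nat m" using n0 mn by auto
    show "exp (2 * pi * real l0 / \<alpha>) = real (nat m) / real (nat n)" unfolding nat using el by (simp add: e_def)
    show "l0 dvd l" if "exp (2 * pi * real l / \<alpha>) \<in> \<rat>" for l using that dvd[of l] by (simp add: e_def)
    show "delta \<alpha> \<beta> = (2 * cos (\<beta> * ln (real (nat m) / real (nat n))) * sqrt (real (nat m) * real (nat n)) - 2)
         / (real (nat m) * real (nat n) + 1 - 2 * sqrt (real (nat m) * real (nat n)) * cos (\<beta> * ln (real (nat m) / real (nat n))))"
      unfolding nat delta_def Let_def if_not_P[OF False]
      unfolding l0_def[unfolded e_def, symmetric] r_def[unfolded e_def, symmetric] m_def[symmetric] n_def[symmetric]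
      by (simp only: of_int_mult)
  qed
qed

text \<open>With w = e^(-i \<theta>) / s, Re (w / (1 - w)) = (Re w - |w|^2) / |1 - w|^2; clearing
  s^2 gives the right side, which is \<delta> when s^2 = p q.\<close>

lemma two_Re_geometric:
  assumes s: "s > 1"
  shows "2 * Re (of_real (1 / s) * cis (- \<theta>) / (1 - of_real (1 / s) * cis (- \<theta>)))
    = (2 * cos \<theta> * s - 2) / (s\<^sup>2 + 1 - 2 * s * cos \<theta>)"
proof -
  define w where "w = of_real (1 / s) * cis (- \<theta>)"
  have Re: "Re w = cos \<theta> / s" and Im: "Im w = - sin \<theta> / s" by (simp_all add: w_def)
  have n1: "norm w = 1 / s" using s by (simp add: w_def norm_mult norm_divide)
  have n2: "(Re w)\<^sup>2 + (Im w)\<^sup>2 = 1 / s\<^sup>2"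
    using n1 unfolding cmod_power2[symmetric] by (simp add: power_divide)
  have D: "(Re (1 - w))\<^sup>2 + (Im (1 - w))\<^sup>2 = (s\<^sup>2 + 1 - 2 * s * cos \<theta>) / s\<^sup>2"
  proof -
    have "(Re (1 - w))\<^sup>2 + (Im (1 - w))\<^sup>2 = 1 - 2 * Re w + ((Re w)\<^sup>2 + (Im w)\<^sup>2)"
      by (simp add: power2_eq_square algebra_simps)
    also have "\<dots> = (s\<^sup>2 + 1 - 2 * s * cos \<theta>) / s\<^sup>2" unfolding n2 unfolding Re using s by (simp add: field_simps power2_eq_square)
    finally show ?thesis .
  qed
  have "Re (w / (1 - w)) = (Re w * Re (1 - w) + Im w * Im (1 - w)) / ((Re (1 - w))\<^sup>2 + (Im (1 - w))\<^sup>2)"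
    by (rule Re_divide)
  also have "Re w * Re (1 - w) + Im w * Im (1 - w) = Re w - ((Re w)\<^sup>2 + (Im w)\<^sup>2)"
    by (simp add: power2_eq_square algebra_simps)
  also have "\<dots> = (s * cos \<theta> - 1) / s\<^sup>2" unfolding n2 unfolding Re using s by (simp add: field_simps power2_eq_square)
  finally have "Re (w / (1 - w)) = (s * cos \<theta> - 1) / (s\<^sup>2 + 1 - 2 * s * cos \<theta>)"
    unfolding D using s by simp
  then have "2 * Re (w / (1 - w)) = 2 * (s * cos \<theta> - 1) / (s\<^sup>2 + 1 - 2 * s * cos \<theta>)" by simp
  also have "2 * (s * cos \<theta> - 1) = 2 * cos \<theta> * s - 2" by simp
  finally show ?thesis unfolding w_def .
qed

text \<open>In the rational case exp (k / a) is rational exactly for k = l0 j, where it is p^j /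
  q^j, still in lowest terms. So G k = (p q)^(-j/2), and the series is geometric without its term j
  = 0, since k = 0 would mean m = n.\<close>

lemma resonance_coefficients:
  fixes \<alpha> \<beta> \<gamma> :: real
  assumes \<alpha>: "\<alpha> > 0" and a: "a = \<alpha> / (2 * pi)" and \<gamma>: "\<gamma> > 0"
  obtains G :: "nat \<Rightarrow> real" and S where
    "\<And>k. ((\<lambda>T. exact_sum (exp (real k / a)) (nat \<lceil>\<gamma> * T\<rceil>) / ln T) \<longlongrightarrow> G k) at_top"
    "G 0 = 0"
    "(\<lambda>k. of_real (G k) * cis (- (\<beta> * (real k / a)))) sums S"
    "2 * Re S = delta \<alpha> \<beta>"
proof -
  have ka: "real k / a = 2 * pi * real k / \<alpha>" for k unfolding a using \<alpha> by (simp add: field_simps)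
  show ?thesis using \<alpha>
  proof (cases rule: delta_cases[where \<beta> = \<beta>])
    case irrational
    show ?thesis
    proof (rule that[of "\<lambda>_. 0" 0])
      fix k
      have "exact_sum (exp (real k / a)) M = 0" for M
        using irrational(1)[of k] by (intro exact_sum_eq_0) (cases "k = 0", auto simp: ka)
      then show "((\<lambda>T. exact_sum (exp (real k / a)) (nat \<lceil>\<gamma> * T\<rceil>) / ln T) \<longlongrightarrow> 0) at_top" by simp
    qed (use irrational in auto)
  next
    case (rational l0 p q)
    define s where "s = sqrt (real p * real q)"
    define \<theta> where "\<theta> = \<beta> * ln (real p / real q)"
    define w where "w = of_real (1 / s) * cis (- \<theta>)"
    define G where "G k = (if k > 0 \<and> l0 dvd k then (1 / s) ^ (k div l0) else 0)" for k
    have "1 * 1 < real p * real q" using rational by (intro mult_less_le_imp_less) auto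
    then have s1: "s > 1" unfolding s_def by simp
    have s2: "s\<^sup>2 = real p * real q" unfolding s_def by simp
    have nw: "norm w < 1" using s1 by (simp add: w_def norm_mult norm_divide)
    have lim: "((\<lambda>T. exact_sum (exp (real k / a)) (nat \<lceil>\<gamma> * T\<rceil>) / ln T) \<longlongrightarrow> G k) at_top" for k
    proof (cases "k > 0 \<and> l0 dvd k")
      case True
      then obtain j where j: "k = l0 * j" "j > 0" by auto
      have "exp (real k / a) = exp (2 * pi * real l0 / \<alpha>) ^ j"
        unfolding ka j by (simp add: exp_of_nat_mult[symmetric] mult_ac)
      also have "\<dots> = real (p ^ j) / real (q ^ j)" unfolding rational(5) by (simp add: power_divide)
      finally have e: "exp (real k / a) = real (p ^ j) / real (q ^ j)" .
      have "((\<lambda>T. exact_sum (exp (real k / a)) (nat \<lceil>\<gamma> * T\<rceil>) / ln T) \<longlongrightarrow> 1 / sqrt (real (p ^ j) * real (q ^ j))) at_top"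
        using rational j by (intro exact_sum_limit_rational e \<gamma>) (auto intro: power_strict_mono)
      also have "1 / sqrt (real (p ^ j) * real (q ^ j)) = (1 / s) ^ j"
        unfolding s_def by (simp add: power_divide real_sqrt_power[symmetric] power_mult_distrib)
      also have "\<dots> = G k" using j rational by (simp add: G_def)
      finally show ?thesis .
    next
      case False
      have "exact_sum (exp (real k / a)) M = 0" for M
        using False rational(6)[of k] by (intro exact_sum_eq_0) (cases "k = 0", auto simp: ka)
      moreover have "G k = 0" using False by (auto simp: G_def)
      ultimately show ?thesis by simp
    qed
    have "(\<lambda>j. w ^ Suc j) sums (w / (1 - w))"
      using sums_mult[OF geometric_sums[OF nw], of w] by simp
    moreover have "of_real (G (l0 * Suc j)) * cis (- (\<beta> * (real (l0 * Suc j) / a))) = w ^ Suc j" for j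
    proof -
      have "ln (real p / real q) = 2 * pi * real l0 / \<alpha>" unfolding rational(5)[symmetric] by simp
      then have "- (\<beta> * (real (l0 * Suc j) / a)) = real (Suc j) * (- \<theta>)"
        unfolding ka \<theta>_def by (simp add: field_simps)
      moreover have "G (l0 * Suc j) = (1 / s) ^ Suc j" using rational(1) by (simp add: G_def)
      ultimately show ?thesis unfolding w_def power_mult_distrib Complex.DeMoivre by (simp only: of_real_power)
    qed
    ultimately have "(\<lambda>j. of_real (G (l0 * Suc j)) * cis (- (\<beta> * (real (l0 * Suc j) / a)))) sums (w / (1 - w))" by simp
    then have sums: "(\<lambda>k. of_real (G k) * cis (- (\<beta> * (real k / a)))) sums (w / (1 - w))"
    \<comment> \<open>The series lives on k = l0 (j + 1), so the geometric series is spread out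
      along this sequence, with zeros elsewhere.\<close>
    proof (subst (asm) sums_mono_reindex[of "\<lambda>j. l0 * Suc j"])
      show "strict_mono (\<lambda>j. l0 * Suc j)" using rational(1) by (intro strict_monoI) auto
      fix k assume k: "k \<notin> range (\<lambda>j. l0 * Suc j)"
      have "\<not> (k > 0 \<and> l0 dvd k)"
      proof
        assume "k > 0 \<and> l0 dvd k"
        then obtain j where "k = l0 * j" "j > 0" by auto
        then have "k = l0 * Suc (j - 1)" by simp
        then show False using k by blast
      qed
      then show "of_real (G k) * cis (- (\<beta> * (real k / a))) = 0" by (auto simp: G_def)
    qed
    have "2 * Re (w / (1 - w)) = delta \<alpha> \<beta>"
      using two_Re_geometric[OF s1, of \<theta>] unfolding rational(7) w_def s2 unfolding s_def \<theta>_def by simp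
    then show ?thesis using lim sums by (intro that[of G "w / (1 - w)"]) (auto simp: G_def)
  qed
qed

subsection \<open>Second moments\<close>

lemma crit_term_mult_cnj:
  assumes "m > 0" "n > 0"
  shows "crit_term y m * cnj (crit_term y n) = of_real (1 / sqrt (real m * real n)) * cis (- (y * ln (real m / real n)))"
proof -
  have "cis (- (y * ln (real m / real n))) = cis (- (y * ln (real m))) * cis (y * ln (real n))"
    using assms by (simp add: cis_mult ln_div algebra_simps)
  then show ?thesis by (simp add: crit_term_def cis_cnj real_sqrt_mult)
qed

lemma pairs_Suc: "pairs (Suc N) = pairs N \<union> Pair (Suc N) ` {1..N}"
  by (auto simp: pairs_def le_Suc_eq)

text \<open>The diagonal gives the harmonic number; a pair n < m and its mirror image give twice a
  real part.\<close>

lemma norm_zeta_poly_square: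
  "(norm (zeta_poly N y))\<^sup>2 = harm N
    + 2 * Re (\<Sum>(m, n)\<in>pairs N. of_real (1 / sqrt (real m * real n)) * cis (- (y * ln (real m / real n))))"
proof (induction N)
  case 0
  have "pairs 0 = {}" by (auto simp: pairs_def)
  then show ?case by (simp add: zeta_poly_def harm_def)
next
  case (Suc N)
  define t where "t = crit_term y (Suc N)"
  define f where "f = (\<lambda>(m, n). of_real (1 / sqrt (real m * real n)) * cis (- (y * ln (real m / real n))))"
  have "zeta_poly (Suc N) y = zeta_poly N y + t" by (simp add: zeta_poly_def t_def)
  then have "(norm (zeta_poly (Suc N) y))\<^sup>2 = (norm (zeta_poly N y))\<^sup>2 + (norm t)\<^sup>2 + 2 * Re (t * cnj (zeta_poly N y))"
    unfolding cmod_power2 by (simp add: power2_eq_square algebra_simps)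
  moreover have "(norm t)\<^sup>2 = inverse (real (Suc N))"
    unfolding t_def norm_crit_term by (simp add: power_divide inverse_eq_divide del: of_nat_Suc)
  moreover have "t * cnj (zeta_poly N y) = sum f (Pair (Suc N) ` {1..N})"
  proof -
    have "t * cnj (zeta_poly N y) = (\<Sum>n=1..N. t * cnj (crit_term y n))"
      by (simp add: zeta_poly_def sum_distrib_left)
    also have "\<dots> = (\<Sum>n=1..N. f (Suc N, n))"
    proof (rule sum.cong)
      fix n assume "n \<in> {1..N}"
      then show "t * cnj (crit_term y n) = f (Suc N, n)"
        unfolding t_def f_def prod.case by (intro crit_term_mult_cnj) auto
    qed simp
    also have "\<dots> = sum f (Pair (Suc N) ` {1..N})"
      by (subst sum.reindex) (auto simp: inj_on_def)
    finally show ?thesis .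
  qed
  moreover have "sum f (pairs (Suc N)) = sum f (pairs N) + sum f (Pair (Suc N) ` {1..N})"
    unfolding pairs_Suc by (rule sum.union_disjoint) (auto simp: finite_pairs, auto simp: pairs_def)
  ultimately show ?case using Suc unfolding f_def[symmetric] by (simp add: harm_Suc)
qed

lemma sum_inverse_sqrt_le: "(\<Sum>n=1..N. 1 / sqrt (real n)) \<le> 2 * sqrt (real N)"
proof (induction N)
  case (Suc N)
  define u v where "u = sqrt (real N)" and "v = sqrt (real (Suc N))"
  have uv: "v > 0" "u \<ge> 0" "u \<le> v" "v\<^sup>2 - u\<^sup>2 = 1" by (auto simp: u_def v_def)
  have "1 = (v - u) * (v + u)" using uv by (simp add: power2_eq_square algebra_simps)
  also have "\<dots> \<le> (v - u) * (2 * v)" using uv by (intro mult_left_mono) auto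
  also have "\<dots> = 2 * (v - u) * v" by simp
  finally have "1 / v \<le> 2 * (v - u)" using uv by (simp only: pos_divide_le_eq)
  then show ?case using Suc by (simp add: u_def v_def del: of_nat_Suc)
qed simp

lemma norm_zeta_poly_le: "norm (zeta_poly N y) \<le> 2 * sqrt (real N)"
proof -
  have "norm (zeta_poly N y) \<le> (\<Sum>n=1..N. 1 / sqrt (real n))"
    unfolding zeta_poly_def by (rule sum_norm_le) (simp add: norm_crit_term)
  then show ?thesis using sum_inverse_sqrt_le[of N] by linarith
qed

text \<open>Since zeta - D is O(1 / sqrt N) and D is O(sqrt N), the factorisation z^2 - d^2 = (z -
  d) (z + d) leaves an error O(1) at every t.\<close>

lemma zeta_square_approx:
  assumes \<alpha>: "\<alpha> > 0"
  obtains A T1 where "A \<ge> 0" "T1 \<ge> 2"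
    "\<And>T t. T \<ge> T1 \<Longrightarrow> T \<le> t \<Longrightarrow> t \<le> 2 * T \<Longrightarrow>
      0 \<le> \<alpha> * t + \<beta> \<and>
      \<bar>(norm (riemann_zeta (Complex (1/2) (\<alpha> * t + \<beta>))))\<^sup>2
        - (norm (zeta_poly (nat \<lceil>3 * \<alpha> * T\<rceil>) (\<alpha> * t + \<beta>)))\<^sup>2\<bar> \<le> A"
proof -
  define C3 where "C3 = 5 / 2 * (4 + 2 / sin (1/14) + 2 / (sin (1/14))\<^sup>2 :: real)"
  have "sin (1/14 :: real) > 0" using pi_gt3 by (intro sin_gt_zero) auto
  then have C3: "C3 \<ge> 0" unfolding C3_def by simp
  \<comment> \<open>This ensures 2 |\<beta>| <= \<alpha> T and 4 <= \<alpha> T, whence \<alpha> T /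
    2 <= y <= 3 \<alpha> T <= N.\<close>
  define T1 where "T1 = max 2 (max (2 * \<bar>\<beta>\<bar> / \<alpha>) (4 / \<alpha>))"
  show ?thesis
  proof (rule that[of "C3 * (C3 + 4)" T1])
    show "C3 * (C3 + 4) \<ge> 0" "T1 \<ge> 2" using C3 by (auto simp: T1_def)
    fix T t assume T: "T \<ge> T1" "T \<le> t" "t \<le> 2 * T"
    define N where "N = nat \<lceil>3 * \<alpha> * T\<rceil>"
    define y where "y = \<alpha> * t + \<beta>"
    have "2 * \<bar>\<beta>\<bar> / \<alpha> \<le> T" "4 / \<alpha> \<le> T" "T \<ge> 2" using T by (auto simp: T1_def)
    then have b: "2 * \<bar>\<beta>\<bar> \<le> \<alpha> * T" "4 \<le> \<alpha> * T" using \<alpha> by (simp_all add: field_simps)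
    have at: "\<alpha> * T \<le> \<alpha> * t" "\<alpha> * t \<le> 2 * (\<alpha> * T)" using T \<alpha> by auto
    have y: "\<alpha> * T / 2 \<le> y" "y \<le> 3 * (\<alpha> * T)" unfolding y_def using at b by linarith+
    have N: "3 * (\<alpha> * T) \<le> real N" "real N \<le> 3 * (\<alpha> * T) + 1"
      unfolding N_def using b by linarith+
    have N1: "N \<ge> 1" using N b by linarith
    have "norm (riemann_zeta (Complex (1/2) y) - zeta_poly N y) \<le> C3 / sqrt (real N)"
      unfolding C3_def
    proof (intro zeta_approx)
      \<comment> \<open>The origin of 1/14: 2N + 2 <= 6 \<alpha> T + 4 <= 7 \<alpha> T <= 14
        y.\<close>
      have "2 * real N + 2 \<le> 14 * y" using y(1) N(2) b(2) by linarith
      then show "1 / 14 * (2 * real N + 2) \<le> y" by simp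
    qed (use y N N1 b in linarith)+
    then have e: "norm (riemann_zeta (Complex (1/2) y) - zeta_poly N y) \<le> C3 / sqrt (real N)" .
    define z where "z = norm (riemann_zeta (Complex (1/2) y))"
    define d where "d = norm (zeta_poly N y)"
    define \<epsilon> where "\<epsilon> = C3 / sqrt (real N)"
    have sN: "sqrt (real N) \<ge> 1" using N1 by simp
    have \<epsilon>: "0 \<le> \<epsilon>" "\<epsilon> \<le> C3 * sqrt (real N)" "\<epsilon> * sqrt (real N) = C3" "\<epsilon> \<le> C3"
    proof -
      show "0 \<le> \<epsilon>" unfolding \<epsilon>_def using C3 by simp
      show "\<epsilon> * sqrt (real N) = C3" unfolding \<epsilon>_def using sN by simp
      have "C3 / sqrt (real N) \<le> C3 / 1" using sN C3 by (intro divide_left_mono) auto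
      then show "\<epsilon> \<le> C3" by (simp add: \<epsilon>_def)
      also have "C3 * 1 \<le> C3 * sqrt (real N)" using sN C3 by (intro mult_left_mono) auto
      finally show "\<epsilon> \<le> C3 * sqrt (real N)" by simp
    qed
    have d: "0 \<le> d" "d \<le> 2 * sqrt (real N)" unfolding d_def by (auto intro: norm_zeta_poly_le)
    have z: "0 \<le> z" "\<bar>z - d\<bar> \<le> \<epsilon>"
      unfolding z_def d_def \<epsilon>_def using e norm_triangle_ineq3[of "riemann_zeta (Complex (1/2) y)" "zeta_poly N y"]
      by auto
    have "\<bar>z\<^sup>2 - d\<^sup>2\<bar> = \<bar>z - d\<bar> * \<bar>z + d\<bar>"
      by (simp add: abs_mult[symmetric] power2_eq_square algebra_simps)
    also have "\<dots> \<le> \<epsilon> * (\<epsilon> + 4 * sqrt (real N))"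
      using z d \<epsilon> by (intro mult_mono) auto
    also have "\<dots> = \<epsilon> * \<epsilon> + 4 * C3" using \<epsilon>(3) by (simp add: algebra_simps)
    also have "\<dots> \<le> C3 * C3 + 4 * C3" using \<epsilon> by (intro add_right_mono mult_mono) auto
    finally have "\<bar>z\<^sup>2 - d\<^sup>2\<bar> \<le> C3 * (C3 + 4)" by (simp add: algebra_simps)
    moreover have "0 \<le> y" using y b by linarith
    ultimately show "0 \<le> \<alpha> * t + \<beta> \<and>
      \<bar>(norm (riemann_zeta (Complex (1/2) (\<alpha> * t + \<beta>))))\<^sup>2
        - (norm (zeta_poly (nat \<lceil>3 * \<alpha> * T\<rceil>) (\<alpha> * t + \<beta>)))\<^sup>2\<bar> \<le> C3 * (C3 + 4)"
      unfolding z_def d_def y_def N_def by simp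
  qed
qed

text \<open>The sum of \<open>summand\<close> from the locale, with the kernel as a parameter, so
  that both moments can be expressed outside it.\<close>

definition pair_sum :: "real \<Rightarrow> (real \<Rightarrow> complex) \<Rightarrow> nat \<Rightarrow> complex" where
  "pair_sum \<beta> K N = (\<Sum>(m, n)\<in>pairs N. of_real (1 / sqrt (real m * real n)) * cis (- (\<beta> * ln (real m / real n)))
      * K (ln (real m / real n)))"

lemma harm_ceiling_limit:
  assumes "\<alpha> > 0"
  shows "((\<lambda>T. harm (nat \<lceil>3 * \<alpha> * T\<rceil>) / ln T) \<longlongrightarrow> (1::real)) at_top"
proof (rule harm_over_ln_limit[of "3 * \<alpha>" "3 * \<alpha> + 1"])
  show "\<forall>\<^sub>F T in at_top. 3 * \<alpha> * T \<le> real (nat \<lceil>3 * \<alpha> * T\<rceil>) \<and> real (nat \<lceil>3 * \<alpha> * T\<rceil>) \<le> (3 * \<alpha> + 1) * T"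
    using eventually_ge_at_top[of 1]
  proof eventually_elim
    case (elim T)
    have "3 * \<alpha> * T > 0" using elim assms by simp
    then have "real (nat \<lceil>3 * \<alpha> * T\<rceil>) \<le> 3 * \<alpha> * T + 1" by linarith
    also have "\<dots> \<le> (3 * \<alpha> + 1) * T" using elim by (simp add: algebra_simps)
    finally show ?case by (auto intro: real_nat_ceiling_ge)
  qed
qed (use assms in auto)

lemma pair_sum_asymptotics:
  assumes "\<alpha> > 0" "a = \<alpha> / (2 * pi)" "C \<ge> 0"
    and "\<And>T x. T \<ge> 2 \<Longrightarrow> norm (K T x) \<le> C * T"
    and "\<And>T x. T \<ge> 2 \<Longrightarrow> norm (K T x) * T * (a * x - of_int (round (a * x)))\<^sup>2 \<le> C"
    and "\<And>k. ((\<lambda>T. K T (real k / a) / of_real T) \<longlongrightarrow> \<kappa> k) at_top"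
    and "\<And>k. ((\<lambda>T. exact_sum (exp (real k / a)) (nat \<lceil>3 * \<alpha> * T\<rceil>) / ln T) \<longlongrightarrow> G k) at_top"
  shows "((\<lambda>T. pair_sum \<beta> (K T) (nat \<lceil>3 * \<alpha> * T\<rceil>) / of_real (T * ln T))
     \<longlongrightarrow> (\<Sum>k. of_real (G k) * cis (- (\<beta> * (real k / a))) * \<kappa> k)) at_top"
proof -
  have up: "real (nat \<lceil>3 * \<alpha> * T\<rceil>) \<le> (3 * \<alpha> + 1) * T" if "T \<ge> 2" for T
  proof -
    have "3 * \<alpha> * T > 0" using that assms by simp
    then have "real (nat \<lceil>3 * \<alpha> * T\<rceil>) \<le> 3 * \<alpha> * T + 1" by linarith
    also have "\<dots> \<le> (3 * \<alpha> + 1) * T" using that by (simp add: algebra_simps)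
    finally show ?thesis .
  qed
  interpret resonance a \<beta> C "3 * \<alpha> + 1" 2 K "\<lambda>T. nat \<lceil>3 * \<alpha> * T\<rceil>" \<kappa> G
    by standard (use assms up harm_ceiling_limit in auto)
  show ?thesis using pair_sum_limit unfolding pair_sum_def summand_def .
qed

context bump
begin

text \<open>After exchanging the sums, each pair n < m collects its sum over l into the kernel, and
  the shift \<beta> becomes a twist.\<close>

lemma disc_zeta_poly:
  "(\<Sum>l<len T. \<phi> (real l / T) * (norm (zeta_poly N (\<alpha> * real l + \<beta>)))\<^sup>2)
    = (\<Sum>l<len T. \<phi> (real l / T)) * harm N + 2 * Re (pair_sum \<beta> (disc_kernel \<alpha> T) N)"
proof -
  define E where "E l = (\<Sum>(m, n)\<in>pairs N. of_real (1 / sqrt (real m * real n)) * cis (- ((\<alpha> * real l + \<beta>) * ln (real m / real n))))" for l :: nat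
  have "pair_sum \<beta> (disc_kernel \<alpha> T) N = (\<Sum>(m, n)\<in>pairs N. \<Sum>l<len T. of_real (\<phi> (real l / T))
      * (of_real (1 / sqrt (real m * real n)) * cis (- ((\<alpha> * real l + \<beta>) * ln (real m / real n)))))"
    unfolding pair_sum_def disc_kernel_def sum_distrib_left
  proof (intro sum.cong refl, clarify, intro sum.cong refl)
    fix m n l
    define x where "x = ln (real m / real n)"
    have "cis (- ((\<alpha> * real l + \<beta>) * x)) = cis (- (\<beta> * x)) * cis (- (\<alpha> * real l * x))"
      by (simp add: cis_mult algebra_simps)
    then show "of_real (1 / sqrt (real m * real n)) * cis (- (\<beta> * ln (real m / real n))) *
           (of_real (\<phi> (real l / T)) * cis (- (\<alpha> * real l * ln (real m / real n)))) =
           of_real (\<phi> (real l / T)) * (of_real (1 / sqrt (real m * real n)) * cis (- ((\<alpha> * real l + \<beta>) * ln (real m / real n))))"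
      unfolding x_def[symmetric] by (simp only: mult_ac)
  qed
  also have "\<dots> = (\<Sum>l<len T. of_real (\<phi> (real l / T)) * E l)"
    unfolding E_def sum_distrib_left case_prod_beta by (rule sum.swap)
  finally have "Re (pair_sum \<beta> (disc_kernel \<alpha> T) N) = (\<Sum>l<len T. \<phi> (real l / T) * Re (E l))" by simp
  moreover have "(\<Sum>l<len T. \<phi> (real l / T) * (norm (zeta_poly N (\<alpha> * real l + \<beta>)))\<^sup>2)
      = (\<Sum>l<len T. \<phi> (real l / T) * harm N + 2 * (\<phi> (real l / T) * Re (E l)))"
    unfolding norm_zeta_poly_square E_def by (intro sum.cong refl) (simp only: distrib_left mult_ac)
  ultimately show ?thesis by (simp only: sum.distrib sum_distrib_left sum_distrib_right)
qed

lemma cont_zeta_poly: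
  assumes T: "T > 0"
  shows "((\<lambda>t. \<phi> (t / T) * (norm (zeta_poly N (\<alpha> * t + \<beta>)))\<^sup>2) has_integral
    (T * mass * harm N + 2 * Re (pair_sum \<beta> (cont_kernel \<alpha> T) N))) {0..3 * T}"
proof -
  define f where "f p t = (case p of (m, n) \<Rightarrow> of_real (1 / sqrt (real m * real n)) * cis (- (\<beta> * ln (real m / real n)))
      * (of_real (\<phi> (t / T)) * cis (- (\<alpha> * t * ln (real m / real n)))))" for p :: "nat \<times> nat" and t
  have "((\<lambda>t. \<Sum>p\<in>pairs N. f p t) has_integral pair_sum \<beta> (cont_kernel \<alpha> T) N) {0..3 * T}"
    unfolding pair_sum_def
  proof (rule has_integral_sum[OF finite_pairs], clarify)
    fix m n
    show "(f (m, n) has_integral of_real (1 / sqrt (real m * real n)) * cis (- (\<beta> * ln (real m / real n)))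
       * cont_kernel \<alpha> T (ln (real m / real n))) {0..3 * T}"
      unfolding f_def prod.case by (rule has_integral_mult_right[OF cont_kernel_has_integral])
  qed
  from has_integral_linear[OF this bounded_linear_Re]
  have 1: "((\<lambda>t. Re (\<Sum>p\<in>pairs N. f p t)) has_integral Re (pair_sum \<beta> (cont_kernel \<alpha> T) N)) {0..3 * T}"
    by (simp only: o_def)
  have "((\<lambda>t. of_real (\<phi> (t / T)) * cis (- (\<alpha> * t * 0))) has_integral complex_of_real (T * mass)) {0..3 * T}"
    using cont_kernel_has_integral[of T \<alpha> 0] cont_kernel_0[OF T, of \<alpha>] by simp
  from has_integral_linear[OF this bounded_linear_Re]
  have 2: "((\<lambda>t. \<phi> (t / T)) has_integral (T * mass)) {0..3 * T}" by (simp add: o_def)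
  have "\<phi> (t / T) * (norm (zeta_poly N (\<alpha> * t + \<beta>)))\<^sup>2 = \<phi> (t / T) * harm N + 2 * Re (\<Sum>p\<in>pairs N. f p t)" for t
  proof -
    have "(\<Sum>p\<in>pairs N. f p t) = of_real (\<phi> (t / T)) *
       (\<Sum>(m, n)\<in>pairs N. of_real (1 / sqrt (real m * real n)) * cis (- ((\<alpha> * t + \<beta>) * ln (real m / real n))))"
      unfolding sum_distrib_left
    proof (intro sum.cong refl, clarify)
      fix m n
      define x where "x = ln (real m / real n)"
      have "cis (- ((\<alpha> * t + \<beta>) * x)) = cis (- (\<beta> * x)) * cis (- (\<alpha> * t * x))"
        by (simp add: cis_mult algebra_simps)
      then show "f (m, n) t = of_real (\<phi> (t / T)) * (of_real (1 / sqrt (real m * real n)) * cis (- ((\<alpha> * t + \<beta>) * ln (real m / real n))))"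
        unfolding f_def prod.case x_def[symmetric] by (simp only: mult_ac)
    qed
    then have "Re (\<Sum>p\<in>pairs N. f p t) = \<phi> (t / T) *
       Re (\<Sum>(m, n)\<in>pairs N. of_real (1 / sqrt (real m * real n)) * cis (- ((\<alpha> * t + \<beta>) * ln (real m / real n))))"
      by simp
    then show ?thesis unfolding norm_zeta_poly_square by (simp only: distrib_left mult_ac)
  qed
  then show ?thesis
    using has_integral_add[OF has_integral_mult_left[OF 2, of "harm N"] has_integral_mult_right[OF 1, of 2]] by simp
qed

end

section \<open>Asymptotics of the two moments\<close>

lemma tendsto_of_bounded_diff:
  fixes f g :: "real \<Rightarrow> real"
  assumes "((\<lambda>T. g T / (T * ln T)) \<longlongrightarrow> L) at_top" "\<forall>\<^sub>F T in at_top. \<bar>f T - g T\<bar> \<le> c * T"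
  shows "((\<lambda>T. f T / (T * ln T)) \<longlongrightarrow> L) at_top"
proof -
  have "((\<lambda>T. f T / (T * ln T) - g T / (T * ln T)) \<longlongrightarrow> 0) at_top"
  proof (rule Lim_null_comparison)
    show "((\<lambda>T::real. c / ln T) \<longlongrightarrow> 0) at_top" by real_asymp
    show "\<forall>\<^sub>F T in at_top. norm (f T / (T * ln T) - g T / (T * ln T)) \<le> c / ln T"
      using assms(2) eventually_ge_at_top[of 2]
    proof eventually_elim
      case (elim T)
      then have "\<bar>f T - g T\<bar> / (T * ln T) \<le> c * T / (T * ln T)" by (intro divide_right_mono) auto
      then show ?case using elim by (simp add: diff_divide_distrib[symmetric] abs_mult)
    qed
  qed
  from tendsto_add[OF this assms(1)] show ?thesis by simp
qed

context bump
begin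

lemma infsum_eq_finite_sum:
  assumes T: "T \<ge> 2"
  shows "(\<Sum>\<^sub>\<infinity>l\<in>(UNIV::int set). F (of_int l) * \<phi> (of_int l / T)) = (\<Sum>l<len T. F (real l) * \<phi> (real l / T))"
proof -
  have "(\<Sum>\<^sub>\<infinity>l\<in>(UNIV::int set). F (of_int l) * \<phi> (of_int l / T)) = (\<Sum>\<^sub>\<infinity>l\<in>int ` {..<len T}. F (of_int l) * \<phi> (of_int l / T))"
  proof (rule infsum_cong_neutral)
    fix l :: int assume l: "l \<in> UNIV - int ` {..<len T}"
    have "\<phi> (of_int l / T) = 0"
    proof (cases "l < 0")
      case True
      then have "of_int l / T < 0" using T by (simp add: divide_neg_pos)
      then show ?thesis by (intro z0) auto
    next
      case False
      then have li: "l = int (nat l)" by simp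
      then have "nat l \<ge> len T" using l by (metis Diff_iff image_eqI lessThan_iff not_le)
      then have "\<phi> (real (nat l) / T) = 0" by (rule phi_tail[OF T])
      then show ?thesis using False by simp
    qed
    then show "F (of_int l) * \<phi> (of_int l / T) = 0" by simp
  qed auto
  also have "\<dots> = (\<Sum>l\<in>int ` {..<len T}. F (of_int l) * \<phi> (of_int l / T))" by (rule infsum_finite) simp
  also have "\<dots> = (\<Sum>l<len T. F (real l) * \<phi> (real l / T))" by (subst sum.reindex) (auto simp: inj_on_def)
  finally show ?thesis .
qed

lemma main_term_limit:
  fixes P :: "real \<Rightarrow> complex"
  assumes "\<alpha> > 0" "((\<lambda>T. M T / T) \<longlongrightarrow> mass) at_top" "((\<lambda>T. P T / of_real (T * ln T)) \<longlongrightarrow> S) at_top"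
  shows "((\<lambda>T. (M T * harm (nat \<lceil>3 * \<alpha> * T\<rceil>) + 2 * Re (P T)) / (T * ln T)) \<longlongrightarrow> mass + 2 * Re S) at_top"
proof -
  have "((\<lambda>T. (M T / T) * (harm (nat \<lceil>3 * \<alpha> * T\<rceil>) / ln T) + 2 * Re (P T / of_real (T * ln T))) \<longlongrightarrow> mass * 1 + 2 * Re S) at_top"
    by (intro tendsto_intros assms harm_ceiling_limit)
  moreover have "(M T / T) * (harm (nat \<lceil>3 * \<alpha> * T\<rceil>) / ln T) + 2 * Re (P T / of_real (T * ln T))
      = (M T * harm (nat \<lceil>3 * \<alpha> * T\<rceil>) + 2 * Re (P T)) / (T * ln T)" for T
    unfolding Re_divide_of_real by (simp add: add_divide_distrib)
  ultimately show ?thesis by simp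
qed

text \<open>The diagonal yields \<open>mass\<close>, and the exact pairs yield 2 Re S = \<delta>
  times \<open>mass\<close>; passing from zeta to D costs at most 4 A B T.\<close>

lemma disc_moment_limit:
  assumes \<alpha>: "\<alpha> > 0"
  shows "((\<lambda>T. (\<Sum>\<^sub>\<infinity>l\<in>(UNIV::int set).
          (cmod (riemann_zeta (Complex (1/2) (\<alpha> * of_int l + \<beta>))))\<^sup>2 * \<phi> (of_int l / T)) / (T * ln T))
      \<longlongrightarrow> mass * (1 + delta \<alpha> \<beta>)) at_top"
proof -
  define a where "a = \<alpha> / (2 * pi)"
  define F where "F t = (cmod (riemann_zeta (Complex (1/2) (\<alpha> * t + \<beta>))))\<^sup>2" for t
  define N where "N T = nat \<lceil>3 * \<alpha> * T\<rceil>" for T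
  define g where "g T = (\<Sum>l<len T. \<phi> (real l / T) * (norm (zeta_poly (N T) (\<alpha> * real l + \<beta>)))\<^sup>2)" for T
  obtain G :: "nat \<Rightarrow> real" and S where
    G: "\<And>k. ((\<lambda>T. exact_sum (exp (real k / a)) (nat \<lceil>3 * \<alpha> * T\<rceil>) / ln T) \<longlongrightarrow> G k) at_top" and
    S: "(\<lambda>k. of_real (G k) * cis (- (\<beta> * (real k / a)))) sums S" "2 * Re S = delta \<alpha> \<beta>"
    by (rule resonance_coefficients[OF \<alpha> a_def, of "3 * \<alpha>" \<beta>]) (use \<alpha> in auto)
  have "((\<lambda>T. pair_sum \<beta> (disc_kernel \<alpha> T) (N T) / of_real (T * ln T))
     \<longlongrightarrow> (\<Sum>k. of_real (G k) * cis (- (\<beta> * (real k / a))) * of_real mass)) at_top"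
    unfolding N_def
    by (rule pair_sum_asymptotics[OF \<alpha> a_def _ disc_kernel_trivial disc_kernel_decay[OF _ \<alpha> a_def] disc_kernel_limit[OF \<alpha> a_def] G])
      (use B_nonneg in auto)
  also have "(\<Sum>k. of_real (G k) * cis (- (\<beta> * (real k / a))) * of_real mass) = S * of_real mass"
    by (rule sums_unique[symmetric]) (rule sums_mult2[OF S(1)])
  finally have "((\<lambda>T. g T / (T * ln T)) \<longlongrightarrow> mass + 2 * Re (S * of_real mass)) at_top"
    unfolding g_def disc_zeta_poly N_def by (rule main_term_limit[OF \<alpha> disc_mass_limit])
  also have "mass + 2 * Re (S * of_real mass) = mass * (1 + delta \<alpha> \<beta>)"
    unfolding S(2)[symmetric] by (simp add: algebra_simps)
  finally have g: "((\<lambda>T. g T / (T * ln T)) \<longlongrightarrow> mass * (1 + delta \<alpha> \<beta>)) at_top" .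
  obtain A T1 where A: "A \<ge> 0" "T1 \<ge> 2" and approx:
    "\<And>T t. T \<ge> T1 \<Longrightarrow> T \<le> t \<Longrightarrow> t \<le> 2 * T \<Longrightarrow>
      0 \<le> \<alpha> * t + \<beta> \<and> \<bar>F t - (norm (zeta_poly (N T) (\<alpha> * t + \<beta>)))\<^sup>2\<bar> \<le> A"
    unfolding F_def N_def by (rule zeta_square_approx[OF \<alpha>, of \<beta>]) blast
  have "\<forall>\<^sub>F T in at_top. \<bar>(\<Sum>\<^sub>\<infinity>l\<in>(UNIV::int set). F (of_int l) * \<phi> (of_int l / T)) - g T\<bar> \<le> (4 * (A * B)) * T"
    using eventually_ge_at_top[of T1]
  proof eventually_elim
    case (elim T)
    then have T: "T \<ge> 2" using A by simp
    have "\<bar>F (real l) * \<phi> (real l / T) - \<phi> (real l / T) * (norm (zeta_poly (N T) (\<alpha> * real l + \<beta>)))\<^sup>2\<bar> \<le> A * B" for l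
    proof (cases "real l / T \<in> {1..2}")
      case True
      then have "T \<le> real l" "real l \<le> 2 * T" using T by (simp_all add: field_simps)
      then have "\<bar>F (real l) - (norm (zeta_poly (N T) (\<alpha> * real l + \<beta>)))\<^sup>2\<bar> * \<bar>\<phi> (real l / T)\<bar> \<le> A * B"
        using approx[OF elim, of "real l"] A bd0 by (intro mult_mono) auto
      then show ?thesis by (simp add: abs_mult[symmetric] algebra_simps)
    next
      case False
      then have "\<phi> (real l / T) = 0" by (rule z0)
      then show ?thesis using A B_nonneg by simp
    qed
    then have "norm (\<Sum>l<len T. F (real l) * \<phi> (real l / T) - \<phi> (real l / T) * (norm (zeta_poly (N T) (\<alpha> * real l + \<beta>)))\<^sup>2)
        \<le> real (card {..<len T}) * (A * B)" by (intro sum_norm_bound) (simp add: real_norm_def)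
    also have "\<dots> \<le> (4 * T) * (A * B)"
      using len_bounds(1)[OF T] A B_nonneg by (intro mult_right_mono) auto
    finally show ?case unfolding infsum_eq_finite_sum[OF T] g_def
      by (simp add: sum_subtractf mult_ac)
  qed
  from tendsto_of_bounded_diff[OF g this] show ?thesis unfolding F_def .
qed

lemma cont_moment_limit:
  assumes \<alpha>: "\<alpha> > 0"
  shows "((\<lambda>T. integral UNIV (\<lambda>t. (cmod (riemann_zeta (Complex (1/2) (\<alpha> * t + \<beta>))))\<^sup>2 * \<phi> (t / T)) / (T * ln T))
      \<longlongrightarrow> mass) at_top"
proof -
  define a where "a = \<alpha> / (2 * pi)"
  have a: "a > 0" using \<alpha> by (simp add: a_def)
  define F where "F t = (cmod (riemann_zeta (Complex (1/2) (\<alpha> * t + \<beta>))))\<^sup>2" for t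
  define N where "N T = nat \<lceil>3 * \<alpha> * T\<rceil>" for T
  define h where "h T t = \<phi> (t / T) * (norm (zeta_poly (N T) (\<alpha> * t + \<beta>)))\<^sup>2" for T t
  define g where "g T = T * mass * harm (N T) + 2 * Re (pair_sum \<beta> (cont_kernel \<alpha> T) (N T))" for T
  obtain G :: "nat \<Rightarrow> real" where G0: "G 0 = 0" and
    G: "\<And>k. ((\<lambda>T. exact_sum (exp (real k / a)) (nat \<lceil>3 * \<alpha> * T\<rceil>) / ln T) \<longlongrightarrow> G k) at_top"
    by (rule resonance_coefficients[OF \<alpha> a_def, of "3 * \<alpha>" \<beta>]) (use \<alpha> in auto)
  have "((\<lambda>T. pair_sum \<beta> (cont_kernel \<alpha> T) (N T) / of_real (T * ln T))
     \<longlongrightarrow> (\<Sum>k. of_real (G k) * cis (- (\<beta> * (real k / a))) * (if k = 0 then of_real mass else 0))) at_top"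
    unfolding N_def
    by (rule pair_sum_asymptotics[OF \<alpha> a_def _ cont_kernel_trivial cont_kernel_decay[OF _ \<alpha> a_def] cont_kernel_limit[OF \<alpha> a] G])
      (use B_nonneg in auto)
  \<comment> \<open>Every term is zero: \<open>G 0 = 0\<close>, and the kernel limit is zero for k >
    0.\<close>
  also have "(\<lambda>k. of_real (G k) * cis (- (\<beta> * (real k / a))) * (if k = 0 then of_real mass else 0)) = (\<lambda>_. 0)"
    using G0 by auto
  finally have P: "((\<lambda>T. pair_sum \<beta> (cont_kernel \<alpha> T) (N T) / of_real (T * ln T)) \<longlongrightarrow> 0) at_top" by simp
  have "\<forall>\<^sub>F T::real in at_top. T * mass / T = mass"
    using eventually_gt_at_top[of 0] by eventually_elim simp
  then have "((\<lambda>T. T * mass / T) \<longlongrightarrow> mass) at_top" by (rule tendsto_eventually)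
  from main_term_limit[OF \<alpha> this P[unfolded N_def]]
  have g: "((\<lambda>T. g T / (T * ln T)) \<longlongrightarrow> mass) at_top" unfolding g_def N_def by simp
  obtain A T1 where A: "A \<ge> 0" "T1 \<ge> 2" and approx:
    "\<And>T t. T \<ge> T1 \<Longrightarrow> T \<le> t \<Longrightarrow> t \<le> 2 * T \<Longrightarrow>
      0 \<le> \<alpha> * t + \<beta> \<and> \<bar>F t - (norm (zeta_poly (N T) (\<alpha> * t + \<beta>)))\<^sup>2\<bar> \<le> A"
    unfolding F_def N_def by (rule zeta_square_approx[OF \<alpha>, of \<beta>]) blast
  have "\<forall>\<^sub>F T in at_top. \<bar>integral UNIV (\<lambda>t. F t * \<phi> (t / T)) - g T\<bar> \<le> (A * B) * T"
    using eventually_ge_at_top[of T1]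
  proof eventually_elim
    case (elim T)
    then have T: "T \<ge> 2" using A by simp
    have out: "\<phi> (t / T) = 0" if "t \<notin> {T..2 * T}" for t
      using that T by (intro z0) (auto simp: field_simps)
    \<comment> \<open>\<open>continuous_on_zeta_critical\<close> concerns nonnegative ordinates;
      \<open>approx\<close> supplies 0 <= \<alpha> t + \<beta>.\<close>
    have "continuous_on {T..2 * T} (\<lambda>t. riemann_zeta (Complex (1/2) (\<alpha> * t + \<beta>)))"
      by (rule continuous_on_compose2[OF continuous_on_zeta_critical[of "\<alpha> * (2 * T) + \<beta>"]])
        (use approx[OF elim] \<alpha> in \<open>auto intro!: continuous_intros\<close>)
    then have "continuous_on {T..2 * T} (\<lambda>t. F t * \<phi> (t / T))"
      unfolding F_def by (intro continuous_intros continuous_on_phi_scaled)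
    then obtain I where I: "((\<lambda>t. F t * \<phi> (t / T)) has_integral I) {T..2 * T}"
      using integrable_continuous_real by blast
    then have "((\<lambda>t. F t * \<phi> (t / T)) has_integral I) UNIV"
      by (rule has_integral_on_superset) (auto simp: out)
    then have IU: "integral UNIV (\<lambda>t. F t * \<phi> (t / T)) = I" by (rule integral_unique)
    have "continuous_on {T..2 * T} (h T)"
      unfolding h_def zeta_poly_def
      by (intro continuous_intros continuous_on_phi_scaled continuous_on_compose2[OF continuous_on_crit_term[of UNIV]]) auto
    then obtain J where J: "(h T has_integral J) {T..2 * T}"
      using integrable_continuous_real by blast
    then have "(h T has_integral J) {0..3 * T}"
      by (rule has_integral_on_superset) (use T in \<open>auto simp: out h_def\<close>)
    moreover have "(h T has_integral g T) {0..3 * T}"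
      unfolding h_def g_def using T by (intro cont_zeta_poly) auto
    ultimately have "J = g T" by (rule has_integral_unique)
    with has_integral_diff[OF I J]
    have D: "((\<lambda>t. F t * \<phi> (t / T) - h T t) has_integral (I - g T)) {T..2 * T}" by simp
    have "norm (F t * \<phi> (t / T) - h T t) \<le> A * B" if "t \<in> {T..2 * T} - {}" for t
    proof -
      have "\<bar>F t - (norm (zeta_poly (N T) (\<alpha> * t + \<beta>)))\<^sup>2\<bar> * \<bar>\<phi> (t / T)\<bar> \<le> A * B"
        using that approx[OF elim, of t] A bd0 by (intro mult_mono) auto
      then show ?thesis by (simp add: h_def abs_mult[symmetric] algebra_simps)
    qed
    from has_integral_bound_real[OF _ finite.emptyI D this] have "norm (I - g T) \<le> (A * B) * T"
      using A B_nonneg T by simp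
    then show ?case unfolding IU using T by simp
  qed
  from tendsto_of_bounded_diff[OF g this] show ?thesis unfolding F_def .
qed

end

theorem theorem2:
  fixes \<alpha> \<beta> :: real and \<phi> :: "real \<Rightarrow> real"
  assumes "\<alpha> > 0"
    and "smooth_real \<phi>"
    and "\<forall>x. \<phi> x \<ge> 0"
    and "\<exists>x. \<phi> x \<noteq> 0"
    and "compact (supp_real \<phi>)"
    and "supp_real \<phi> \<subseteq> {1..2}"
  shows "\<exists>\<epsilon> :: real \<Rightarrow> real. (\<epsilon> \<longlongrightarrow> 0) at_top \<and>
    (\<forall>\<^sub>F T in at_top.
      (\<Sum>\<^sub>\<infinity>l\<in>(UNIV::int set).
          (cmod (riemann_zeta (Complex (1/2) (\<alpha> * of_int l + \<beta>))))\<^sup>2 * \<phi> (of_int l / T))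
      = (1 + delta \<alpha> \<beta> + \<epsilon> T) *
        integral UNIV (\<lambda>t. (cmod (riemann_zeta (Complex (1/2) (\<alpha> * t + \<beta>))))\<^sup>2 * \<phi> (t / T)))"
proof -
  obtain B where "bump \<phi> (deriv \<phi>) (deriv (deriv \<phi>)) B"
    using smooth_real_imp_bump[OF assms(2,6)] .
  then interpret bump \<phi> "deriv \<phi>" "deriv (deriv \<phi>)" B .
  define L where "L T = (\<Sum>\<^sub>\<infinity>l\<in>(UNIV::int set).
          (cmod (riemann_zeta (Complex (1/2) (\<alpha> * of_int l + \<beta>))))\<^sup>2 * \<phi> (of_int l / T))" for T
  define R where "R T = integral UNIV (\<lambda>t. (cmod (riemann_zeta (Complex (1/2) (\<alpha> * t + \<beta>))))\<^sup>2 * \<phi> (t / T))" for T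
  have L: "((\<lambda>T. L T / (T * ln T)) \<longlongrightarrow> mass * (1 + delta \<alpha> \<beta>)) at_top"
    unfolding L_def by (rule disc_moment_limit[OF assms(1)])
  have R: "((\<lambda>T. R T / (T * ln T)) \<longlongrightarrow> mass) at_top"
    unfolding R_def by (rule cont_moment_limit[OF assms(1)])
  have m: "mass > 0" using mass_pos assms by blast
  \<comment> \<open>The witness for \<epsilon> is the quotient of the two moments minus 1 +
    \<delta>; the quotient converges because the limit \<open>mass\<close> of the denominator is
    nonzero.\<close>
  have "((\<lambda>T. (L T / (T * ln T)) / (R T / (T * ln T)) - (1 + delta \<alpha> \<beta>)) \<longlongrightarrow>
      mass * (1 + delta \<alpha> \<beta>) / mass - (1 + delta \<alpha> \<beta>)) at_top"
    using m by (intro tendsto_intros L R) auto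
  then have lim: "((\<lambda>T. (L T / (T * ln T)) / (R T / (T * ln T)) - (1 + delta \<alpha> \<beta>)) \<longlongrightarrow> 0) at_top"
    using m by simp
  \<comment> \<open>Positivity makes both R T and T ln T nonzero, so the quotient can be
    cleared.\<close>
  have "\<forall>\<^sub>F T in at_top. R T / (T * ln T) > 0" by (rule order_tendstoD(1)[OF R m])
  then have "\<forall>\<^sub>F T in at_top. L T = (1 + delta \<alpha> \<beta> + ((L T / (T * ln T)) / (R T / (T * ln T)) - (1 + delta \<alpha> \<beta>))) * R T"
    by eventually_elim (auto simp: field_simps)
  with lim show ?thesis unfolding L_def[symmetric] R_def[symmetric] by blast
qed

end
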